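(* Let $E$ be a sofic equivalence relation on $(X,\mu)$ ($M(E)$ embeds in some $\Pi_{k\to\omega}M_{n_k}(\mathbb{C})$ as in the definition of soficity of $E$ given in the context). Then $E$ is also sofic in the sense of Elek-Lippner.
   Context: Ultraproducts. Fix a free ultrafilter $\omega$ on $\mathbb{N}$; $Tr$ on $M_n(\mathbb{C})$ is the normalized trace, $\|x\|_2=Tr(x^*x)^{1/2}$. $\Pi_{k\to\omega}M_{n_k}(\mathbb{C})$ is the tracial ultraproduct (bounded sequences modulo those with $\lim_{k\to\omega}\|x_k\|_2=0$, with trace $\lim_{k\to\omega}Tr(x_k)$). $D_n$, $P_n\subset M_n(\mathbb{C})$ are the diagonal algebra and the group of permutation matrices; $\Pi_{k\to\omega}D_{n_k}$, $\Pi_{k\to\omega}P_{n_k}$ are the subsets of elements represented by sequences in $D_{n_k}$, resp. $P_{n_k}$. Embeddings are unital trace-preserving $*$-homomorphisms. Equivalence relations. $(X,\mathcal{B},\mu)$ is a standard Borel probability space; $E\subset X^2$ is a measurable equivalence relation with countable classes that is $\mu$-invariant (every measurable bijection $\phi:A\to B$, $A,B\subset X$, with graph in $E$ satisfies $\mu(A)=\mu(B)$). $M_0(E)$ is the $*$-algebra of bounded measurable functions $a:E\to\mathbb{C}$ for which there is $n$ such that each row and each column has at most $n$ nonzero entries, with $(ab)(x,z)=\sum_y a(x,y)b(y,z)$, $a^*(x,y)=\overline{a(y,x)}$, $Tr(a)=\int_X a(x,x)\,d\mu$. $M(E)$ is the weak closure of $M_0(E)$ in the GNS representation of $(M_0(E),Tr)$;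 its elements can be seen as functions on $E$. $A=\{a\in M(E): supp(a)\subset\Delta\}\simeq L^\infty(X)$, $\Delta$ the diagonal. $\mathcal{U}(A)$ is the unitary group of $A$ and $\mathcal{N}(A)$ is the group of unitaries $u\in M(E)$ with $uAu^*=A$. $E$ is sofic if for some $(n_k)$ there is an embedding $\Theta:M(E)\to\Pi_{k\to\omega}M_{n_k}(\mathbb{C})$ with $\Theta(A)\subset\Pi_{k\to\omega}D_{n_k}$ and $\Theta(\mathcal{N}(A))\subset\Theta(\mathcal{U}(A))\cdot\Pi_{k\to\omega}P_{n_k}$. Elek-Lippner soficity. A basic sequence of projections for $L^\infty(X)$ is a family $\{e_{i,m}\}_{1\le i\le 2^m,m\ge0}$ of projections with weakly dense linear span in $L^\infty(X)$, $\mu(e_{i,m})=2^{-m}$, and $e_{2i-1,m}+e_{2i,m}=e_{i,m-1}$ for $m\ge1$; $X$ is given together with a fixed such sequence (so $\mu$ is nonatomic; projections are identified with subsets). An $X$-set is a finite set $Y$ with normalized counting measure together with subsets $\{e_{i,m}\}_{1\le i\le2^m,m\ge0}$, $e_{1,0}=Y$, satisfying the same summation relations. Let $\mathbb{F}_\infty=\langle\gamma_1,\gamma_2,\ldots\rangle$ be the free group, and let $W_r$ be the set of reduced words of length at most $r$ in $\gamma_1^{\pm1},\ldots,\gamma_r^{\pm1}$. An $r$-labeled $r$-neighborhood is a finite oriented multigraph with a root such that every vertex is joined to the root by a path of length at most $r$; every vertex has a label in $\{1,\ldots,2^r\}$; the out-edges of every vertex have different colors from $\{\gamma_1^{\pm1},\ldots,\gamma_r^{\pm1}\}$;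 and if an edge $xy$ has color $\gamma$ then $yx$ is an edge of color $\gamma^{-1}$. $U^{r,r}$ is the finite set of isomorphism classes of these. For a measure-preserving action $\alpha$ of $\mathbb{F}_\infty$ on $X$ (or an action on an $X$-set) and a point $x$, $B_r^r(x)\in U^{r,r}$ has vertices $\{\alpha(w)x: w\in W_r\}$, root $x$, vertex $y$ labeled by the $i$ with $y\in e_{i,r}$, and an edge colored $\gamma_j^{\pm1}$ from $\alpha(w)x$ to $\alpha(\gamma_j^{\pm1}w)x$ whenever $w,\gamma_j^{\pm1}w\in W_r$. For $G\in U^{r,r}$, $T(\alpha,G)=\{x: B_r^r(x)\equiv G\}$ and $p_G(\alpha)$ is the measure of $T(\alpha,G)$. The action $\alpha$ on $X$ is sofic in the Elek-Lippner sense if there are actions $\alpha_k$ of $\mathbb{F}_\infty$ on $X$-sets with $\lim_{k\to\infty}p_G(\alpha_k)=p_G(\alpha)$ for all $r\ge1$, $G\in U^{r,r}$. $E$ is sofic in the Elek-Lippner sense if (up to null sets) it is the orbit equivalence relation of an action of $\mathbb{F}_\infty$ on $X$ that is sofic in the Elek-Lippner sense. *)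

theory Defs
  imports
    "HOL-Probability.Probability"
    "HOL-Algebra.Group_Action"
    "Jordan_Normal_Form.Schur_Decomposition"
begin

section \<open>Tracial star-algebras\<close>

definition free_ultrafilter :: "nat filter \<Rightarrow> bool" where
  "free_ultrafilter \<omega> \<longleftrightarrow> \<omega> \<noteq> bot \<and> \<omega> \<le> cofinite \<and>
     (\<forall>P. eventually P \<omega> \<or> eventually (\<lambda>k. \<not> P k) \<omega>)"

record 'a tracial_algebra = "(complex, 'a) module" +
  involution :: "'a \<Rightarrow> 'a"
  tau :: "'a \<Rightarrow> complex"

definition tracial_embedding ::
  "'a tracial_algebra \<Rightarrow> 'b tracial_algebra \<Rightarrow> ('a \<Rightarrow> 'b) \<Rightarrow> bool" where
  "tracial_embedding R S \<Theta> \<longleftrightarrow> \<Theta> \<in> Ring.ring_hom R S \<and>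
     (\<forall>c. \<forall>a\<in>carrier R. \<Theta> (c \<odot>\<^bsub>R\<^esub> a) = c \<odot>\<^bsub>S\<^esub> \<Theta> a) \<and>
     (\<forall>a\<in>carrier R. \<Theta> (involution R a) = involution S (\<Theta> a)) \<and>
     (\<forall>a\<in>carrier R. tau S (\<Theta> a) = tau R a)"

definition unitaries :: "'a tracial_algebra \<Rightarrow> 'a set" where
  "unitaries R = {u \<in> carrier R.
     involution R u \<otimes>\<^bsub>R\<^esub> u = \<one>\<^bsub>R\<^esub> \<and> u \<otimes>\<^bsub>R\<^esub> involution R u = \<one>\<^bsub>R\<^esub>}"

definition normalizer_group :: "'a tracial_algebra \<Rightarrow> 'a set \<Rightarrow> 'a set" where
  "normalizer_group R A =
     {u \<in> unitaries R. (\<lambda>a. u \<otimes>\<^bsub>R\<^esub> a \<otimes>\<^bsub>R\<^esub> involution R u) ` A = A}"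

text \<open>Both quotients below consist of equivalence classes, represented as sets; operations on
  classes are computed on chosen representatives.\<close>

definition rep :: "'a set \<Rightarrow> 'a" where
  "rep C = (SOME x. x \<in> C)"


section \<open>The tracial ultraproduct of matrix algebras\<close>

definition ntr :: "complex mat \<Rightarrow> complex" where
  "ntr x = (\<Sum>i<dim_row x. x $$ (i, i)) / of_nat (dim_row x)"

definition norm2_mat :: "complex mat \<Rightarrow> real" where
  "norm2_mat x = sqrt (Re (ntr (mat_adjoint x * x)))"

definition cvec_norm :: "complex vec \<Rightarrow> real" where
  "cvec_norm v = sqrt (\<Sum>i<dim_vec v. (cmod (vec_index v i))\<^sup>2)"

text \<open>Boundedness refers to the operator norm on the matrix algebras.\<close>

definition bounded_seqs :: "(nat \<Rightarrow> nat) \<Rightarrow> (nat \<Rightarrow> complex mat) set" where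
  "bounded_seqs n = {x. (\<forall>k. x k \<in> carrier_mat (n k) (n k)) \<and>
     (\<exists>K. \<forall>k. \<forall>v\<in>carrier_vec (n k). cvec_norm (x k *\<^sub>v v) \<le> K * cvec_norm v)}"

definition ultra_class ::
  "nat filter \<Rightarrow> (nat \<Rightarrow> nat) \<Rightarrow> (nat \<Rightarrow> complex mat) \<Rightarrow> (nat \<Rightarrow> complex mat) set" where
  "ultra_class \<omega> n x = {y \<in> bounded_seqs n. ((\<lambda>k. norm2_mat (y k - x k)) \<longlongrightarrow> 0) \<omega>}"

definition ultraproduct ::
  "nat filter \<Rightarrow> (nat \<Rightarrow> nat) \<Rightarrow> (nat \<Rightarrow> complex mat) set tracial_algebra" where
  "ultraproduct \<omega> n = \<lparr>
     carrier = ultra_class \<omega> n ` bounded_seqs n,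
     monoid.mult = (\<lambda>C D. ultra_class \<omega> n (\<lambda>k. rep C k * rep D k)),
     one = ultra_class \<omega> n (\<lambda>k. 1\<^sub>m (n k)),
     ring.zero = ultra_class \<omega> n (\<lambda>k. 0\<^sub>m (n k) (n k)),
     add = (\<lambda>C D. ultra_class \<omega> n (\<lambda>k. rep C k + rep D k)),
     smult = (\<lambda>c C. ultra_class \<omega> n (\<lambda>k. c \<cdot>\<^sub>m rep C k)),
     involution = (\<lambda>C. ultra_class \<omega> n (\<lambda>k. mat_adjoint (rep C k))),
     tau = (\<lambda>C. Lim \<omega> (\<lambda>k. ntr (rep C k)))\<rparr>"

definition ultra_diag ::
  "nat filter \<Rightarrow> (nat \<Rightarrow> nat) \<Rightarrow> (nat \<Rightarrow> complex mat) set set" where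
  "ultra_diag \<omega> n = ultra_class \<omega> n ` {x \<in> bounded_seqs n. \<forall>k. diagonal_mat (x k)}"

definition permutation_matrices :: "nat \<Rightarrow> complex mat set" where
  "permutation_matrices m =
     {mat m m (\<lambda>(i, j). if i = \<sigma> j then 1 else 0) | \<sigma>. \<sigma> permutes {..<m}}"

definition ultra_perm ::
  "nat filter \<Rightarrow> (nat \<Rightarrow> nat) \<Rightarrow> (nat \<Rightarrow> complex mat) set set" where
  "ultra_perm \<omega> n = ultra_class \<omega> n ` {x. \<forall>k. x k \<in> permutation_matrices (n k)}"


section \<open>Operators on a complex inner product space\<close>

record 'v inner_space =
  vecs :: "'v set"
  vadd :: "'v \<Rightarrow> 'v \<Rightarrow> 'v"
  vscale :: "complex \<Rightarrow> 'v \<Rightarrow> 'v"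
  vinner :: "'v \<Rightarrow> 'v \<Rightarrow> complex"

definition vnorm :: "'v inner_space \<Rightarrow> 'v \<Rightarrow> real" where
  "vnorm H \<xi> = sqrt (Re (vinner H \<xi> \<xi>))"

text \<open>Operators are extensional functions, so that they are determined by their values on the
  space.\<close>

definition bounded_operators :: "'v inner_space \<Rightarrow> ('v \<Rightarrow> 'v) set" where
  "bounded_operators H = {T \<in> vecs H \<rightarrow>\<^sub>E vecs H.
     (\<forall>\<xi>\<in>vecs H. \<forall>\<eta>\<in>vecs H. T (vadd H \<xi> \<eta>) = vadd H (T \<xi>) (T \<eta>)) \<and>
     (\<forall>c. \<forall>\<xi>\<in>vecs H. T (vscale H c \<xi>) = vscale H c (T \<xi>)) \<and>
     (\<exists>K. \<forall>\<xi>\<in>vecs H. vnorm H (T \<xi>) \<le> K * vnorm H \<xi>)}"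

definition weak_closure :: "'v inner_space \<Rightarrow> ('v \<Rightarrow> 'v) set \<Rightarrow> ('v \<Rightarrow> 'v) set" where
  "weak_closure H B = {T \<in> bounded_operators H.
     \<forall>F \<epsilon>. finite F \<and> F \<subseteq> vecs H \<times> vecs H \<and> \<epsilon> > 0 \<longrightarrow>
       (\<exists>S\<in>B. \<forall>(\<xi>, \<eta>)\<in>F. cmod (vinner H (T \<xi>) \<eta> - vinner H (S \<xi>) \<eta>) < \<epsilon>)}"

definition operator_adjoint :: "'v inner_space \<Rightarrow> ('v \<Rightarrow> 'v) \<Rightarrow> 'v \<Rightarrow> 'v" where
  "operator_adjoint H T = (THE S. S \<in> bounded_operators H \<and>
     (\<forall>\<xi>\<in>vecs H. \<forall>\<eta>\<in>vecs H. vinner H (T \<xi>) \<eta> = vinner H \<xi> (S \<eta>)))"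

definition operator_algebra ::
  "'v inner_space \<Rightarrow> ('v \<Rightarrow> 'v) set \<Rightarrow> 'v \<Rightarrow> ('v \<Rightarrow> 'v) tracial_algebra" where
  "operator_algebra H N \<xi>\<^sub>0 = \<lparr>
     carrier = N,
     monoid.mult = (\<lambda>S T. compose (vecs H) S T),
     one = (\<lambda>\<xi>\<in>vecs H. \<xi>),
     ring.zero = (\<lambda>\<xi>\<in>vecs H. vscale H 0 \<xi>),
     add = (\<lambda>S T. \<lambda>\<xi>\<in>vecs H. vadd H (S \<xi>) (T \<xi>)),
     smult = (\<lambda>c T. \<lambda>\<xi>\<in>vecs H. vscale H c (T \<xi>)),
     involution = operator_adjoint H,
     tau = (\<lambda>T. vinner H (T \<xi>\<^sub>0) \<xi>\<^sub>0)\<rparr>"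


section \<open>Countable measure-preserving equivalence relations and their von Neumann algebras\<close>

definition standard_borel :: "'a measure \<Rightarrow> bool" where
  "standard_borel M \<longleftrightarrow> (\<exists>T. completely_metrizable_space T \<and> second_countable T \<and>
     topspace T = space M \<and> sets M = sigma_sets (topspace T) {U. openin T U})"

definition pmp_equivalence_relation :: "'a measure \<Rightarrow> ('a \<times> 'a) set \<Rightarrow> bool" where
  "pmp_equivalence_relation M E \<longleftrightarrow>
     equiv (space M) E \<and> E \<in> sets (M \<Otimes>\<^sub>M M) \<and> (\<forall>x\<in>space M. countable (E `` {x})) \<and>
     (\<forall>A B \<phi>. A \<in> sets M \<and> B \<in> sets M \<and> bij_betw \<phi> A B \<and>
        \<phi> \<in> measurable (restrict_space M A) (restrict_space M B) \<and> (\<forall>x\<in>A. (x, \<phi> x) \<in> E)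
        \<longrightarrow> measure M A = measure M B)"

text \<open>Functions on \<open>E\<close> are extended by zero to all pairs. This makes the matrix product
  independent of \<open>E\<close>: for \<open>(x, z)\<close> outside \<open>E\<close> every summand vanishes.\<close>

type_synonym 'a kernel = "'a \<times> 'a \<Rightarrow> complex"

definition kernels :: "'a measure \<Rightarrow> ('a \<times> 'a) set \<Rightarrow> 'a kernel set" where
  "kernels M E = {a \<in> borel_measurable (M \<Otimes>\<^sub>M M). \<forall>p. p \<notin> E \<longrightarrow> a p = 0}"

definition kmult :: "'a kernel \<Rightarrow> 'a kernel \<Rightarrow> 'a kernel" where
  "kmult a b = (\<lambda>(x, z). \<Sum>\<^sub>\<infinity>y. a (x, y) * b (y, z))"

definition kadj :: "'a kernel \<Rightarrow> 'a kernel" where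
  "kadj a = (\<lambda>(x, y). cnj (a (y, x)))"

definition ktrace :: "'a measure \<Rightarrow> 'a kernel \<Rightarrow> complex" where
  "ktrace M a = (\<integral>x. a (x, x) \<partial>M)"

definition M0 :: "'a measure \<Rightarrow> ('a \<times> 'a) set \<Rightarrow> 'a kernel set" where
  "M0 M E = {a \<in> kernels M E. (\<exists>K. \<forall>p. cmod (a p) \<le> K) \<and>
     (\<exists>n. \<forall>x. finite {y. a (x, y) \<noteq> 0} \<and> card {y. a (x, y) \<noteq> 0} \<le> n \<and>
              finite {y. a (y, x) \<noteq> 0} \<and> card {y. a (y, x) \<noteq> 0} \<le> n)}"

text \<open>The square \<open>Tr (a\<^sup>* a)\<close> of the GNS norm, for arbitrary measurable \<open>a\<close> on \<open>E\<close>.\<close>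

definition gns_sq :: "'a measure \<Rightarrow> 'a kernel \<Rightarrow> ennreal" where
  "gns_sq M a = (\<integral>\<^sup>+x. (\<integral>\<^sup>+y. ennreal ((cmod (a (y, x)))\<^sup>2) \<partial>count_space UNIV) \<partial>M)"

text \<open>The GNS Hilbert space of \<open>(M0, Tr)\<close>, i.e. the completion of \<open>M0\<close> (modulo null
  vectors) for the inner product \<open>Tr (b\<^sup>* a)\<close>, is realised as the closure of \<open>M0\<close> inside the
  complete space of square-integrable functions on \<open>E\<close> modulo null functions. In this way its
  vectors are classes of functions on \<open>E\<close>.\<close>

definition gns_kernels :: "'a measure \<Rightarrow> ('a \<times> 'a) set \<Rightarrow> 'a kernel set" where
  "gns_kernels M E = {f \<in> kernels M E. \<exists>a :: nat \<Rightarrow> 'a kernel. (\<forall>k. a k \<in> M0 M E) \<and>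
     (\<lambda>k. gns_sq M (\<lambda>p. a k p - f p)) \<longlonglongrightarrow> 0}"

definition gns_class :: "'a measure \<Rightarrow> ('a \<times> 'a) set \<Rightarrow> 'a kernel \<Rightarrow> 'a kernel set" where
  "gns_class M E f = {g \<in> kernels M E. gns_sq M (\<lambda>p. g p - f p) = 0}"

definition gns_space :: "'a measure \<Rightarrow> ('a \<times> 'a) set \<Rightarrow> 'a kernel set inner_space" where
  "gns_space M E = \<lparr>
     vecs = gns_class M E ` gns_kernels M E,
     vadd = (\<lambda>C D. gns_class M E (\<lambda>p. rep C p + rep D p)),
     vscale = (\<lambda>c C. gns_class M E (\<lambda>p. c * rep C p)),
     vinner = (\<lambda>C D. ktrace M (kmult (kadj (rep D)) (rep C)))\<rparr>"

definition gns_left_mult ::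
  "'a measure \<Rightarrow> ('a \<times> 'a) set \<Rightarrow> 'a kernel \<Rightarrow> 'a kernel set \<Rightarrow> 'a kernel set" where
  "gns_left_mult M E a = (\<lambda>C\<in>vecs (gns_space M E). gns_class M E (kmult a (rep C)))"

definition gns_unit :: "'a measure \<Rightarrow> ('a \<times> 'a) set \<Rightarrow> 'a kernel set" where
  "gns_unit M E = gns_class M E (indicator {(x, x) | x. x \<in> space M})"

definition vN_algebra ::
  "'a measure \<Rightarrow> ('a \<times> 'a) set \<Rightarrow> ('a kernel set \<Rightarrow> 'a kernel set) tracial_algebra" where
  "vN_algebra M E = operator_algebra (gns_space M E)
     (weak_closure (gns_space M E) (gns_left_mult M E ` M0 M E)) (gns_unit M E)"

text \<open>The function on \<open>E\<close> that corresponds to an operator \<open>T\<close> is (the class) \<open>T\<close> applied to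
  the cyclic vector.\<close>

definition cartan_subalgebra ::
  "'a measure \<Rightarrow> ('a \<times> 'a) set \<Rightarrow> ('a kernel set \<Rightarrow> 'a kernel set) set" where
  "cartan_subalgebra M E = {T \<in> carrier (vN_algebra M E).
     \<exists>f\<in>T (gns_unit M E). \<forall>x y. f (x, y) \<noteq> 0 \<longrightarrow> x = y}"

definition sofic_relation :: "nat filter \<Rightarrow> 'a measure \<Rightarrow> ('a \<times> 'a) set \<Rightarrow> bool" where
  "sofic_relation \<omega> M E \<longleftrightarrow> (\<exists>n \<Theta>. (\<forall>k. n k > 0) \<and>
     tracial_embedding (vN_algebra M E) (ultraproduct \<omega> n) \<Theta> \<and>
     \<Theta> ` cartan_subalgebra M E \<subseteq> ultra_diag \<omega> n \<and>
     \<Theta> ` normalizer_group (vN_algebra M E) (cartan_subalgebra M E) \<subseteq>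
       \<Theta> ` (unitaries (vN_algebra M E) \<inter> cartan_subalgebra M E) <#>\<^bsub>ultraproduct \<omega> n\<^esub> ultra_perm \<omega> n)"


section \<open>The free group on countably many generators\<close>

text \<open>For \<open>j \<ge> 1\<close>, \<open>(j, True)\<close> stands for the \<open>j\<close>-th generator and \<open>(j, False)\<close> for its
  inverse.\<close>

type_synonym letter = "nat \<times> bool"

fun linv :: "letter \<Rightarrow> letter" where
  "linv (j, s) = (j, \<not> s)"

fun push :: "letter \<Rightarrow> letter list \<Rightarrow> letter list" where
  "push g [] = [g]"
| "push g (h # w) = (if h = linv g then w else g # h # w)"

definition reduced_word :: "letter list \<Rightarrow> bool" where
  "reduced_word w \<longleftrightarrow> successively (\<lambda>g h. h \<noteq> linv g) w"

definition free_group :: "letter list monoid" where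
  "free_group = \<lparr>
     carrier = {w. reduced_word w \<and> (\<forall>g\<in>set w. fst g \<ge> 1)},
     monoid.mult = (\<lambda>v w. foldr push v w),
     one = []\<rparr>"

lemma linv_linv [simp]: "linv (linv g) = g"
  by (cases g) simp

lemma linv_neq [simp]: "linv g \<noteq> g" "g \<noteq> linv g"
  by (cases g; simp)+

lemma fst_linv [simp]: "fst (linv g) = fst g"
  by (cases g) simp

lemma reduced_simps [simp]:
  "reduced_word []" "reduced_word (g # w) \<longleftrightarrow> (w = [] \<or> hd w \<noteq> linv g) \<and> reduced_word w"
  by (auto simp: reduced_word_def successively_Cons)

lemma reduced_push: "reduced_word w \<Longrightarrow> reduced_word (push g w)"
  by (cases w) auto

lemma push_linv_push: "reduced_word w \<Longrightarrow> push (linv g) (push g w) = w"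
  by (cases w; cases "tl w") (auto simp del: linv.simps)

lemma reduced_foldr_push: "reduced_word w \<Longrightarrow> reduced_word (foldr push v w)"
  by (induction v) (auto intro: reduced_push)

lemma set_push: "set (push g w) \<subseteq> insert g (set w)"
  by (cases w) auto

lemma set_foldr_push: "set (foldr push v w) \<subseteq> set v \<union> set w"
proof (induction v)
  case (Cons g v)
  then show ?case using set_push[of g "foldr push v w"] by auto
qed simp

lemma foldr_push_push:
  assumes "reduced_word u"
  shows "foldr push (push g w) u = push g (foldr push w u)"
proof (cases w)
  case (Cons h t)
  have "reduced_word (foldr push t u)" using assms by (rule reduced_foldr_push)
  then show ?thesis using Cons push_linv_push[of "foldr push t u" "linv g"] by auto
qed simp

lemma foldr_push_assoc:
  "reduced_word u \<Longrightarrow> foldr push (foldr push v w) u = foldr push v (foldr push w u)"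
  by (induction v) (auto simp: foldr_push_push)

lemma foldr_push_Nil: "reduced_word w \<Longrightarrow> foldr push w [] = w"
proof (induction w)
  case (Cons g w)
  then show ?case by (cases w) auto
qed simp

lemma foldr_push_inverse:
  "reduced_word u \<Longrightarrow> foldr push (rev (map linv w)) (foldr push w u) = u"
  by (induction w arbitrary: u) (auto simp: push_linv_push reduced_foldr_push)

lemma group_free_group: "group free_group"
proof (rule groupI)
  fix v w assume "v \<in> carrier free_group" "w \<in> carrier free_group"
  then show "v \<otimes>\<^bsub>free_group\<^esub> w \<in> carrier free_group"
    using set_foldr_push[of v w] by (auto simp: free_group_def reduced_foldr_push)
next
  fix w assume w: "w \<in> carrier free_group"
  let ?v = "foldr push (rev (map linv w)) []"
  have red: "reduced_word ?v" by (simp add: reduced_foldr_push)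
  have "foldr push ?v w = foldr push (rev (map linv w)) w"
    using w by (subst foldr_push_assoc) (auto simp: free_group_def)
  also have "\<dots> = []"
    using foldr_push_inverse[of "[]" w] w by (simp add: foldr_push_Nil free_group_def)
  finally have "?v \<otimes>\<^bsub>free_group\<^esub> w = \<one>\<^bsub>free_group\<^esub>" by (simp add: free_group_def)
  moreover have "?v \<in> carrier free_group"
    using w red set_foldr_push[of "rev (map linv w)" "[]"]
    by (force simp: free_group_def simp del: linv.simps)
  ultimately show "\<exists>v\<in>carrier free_group. v \<otimes>\<^bsub>free_group\<^esub> w = \<one>\<^bsub>free_group\<^esub>" by blast
qed (auto simp: free_group_def foldr_push_assoc)

definition letters :: "nat \<Rightarrow> letter set" where
  "letters r = {1..r} \<times> UNIV"

definition words :: "nat \<Rightarrow> letter list set" where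
  "words r = {w \<in> carrier free_group. length w \<le> r \<and> set w \<subseteq> letters r}"


section \<open>Elek-Lippner soficity\<close>

text \<open>The projection \<open>e\<^sub>i\<^sub>,\<^sub>m\<close> is \<open>e i m\<close>, a subset whose indicator function represents it.
  The summation relations are identities in \<open>L\<^sup>\<infinity>\<close>, hence hold almost everywhere; for a counting
  measure they hold pointwise.\<close>

definition summation_relations :: "'a measure \<Rightarrow> (nat \<Rightarrow> nat \<Rightarrow> 'a set) \<Rightarrow> bool" where
  "summation_relations M e \<longleftrightarrow> (\<forall>m\<ge>1. \<forall>i\<in>{1..2 ^ (m - 1)}. AE x in M.
     indicat_real (e (2 * i - 1) m) x + indicat_real (e (2 * i) m) x =
     indicat_real (e i (m - 1)) x)"

definition L2_functions :: "'a measure \<Rightarrow> ('a \<Rightarrow> complex) set" where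
  "L2_functions M = {f \<in> borel_measurable M. integrable M (\<lambda>x. (cmod (f x))\<^sup>2)}"

text \<open>Weak density refers to \<open>L\<^sup>\<infinity>\<close> acting by multiplication on \<open>L\<^sup>2\<close>.\<close>

definition span_weakly_dense :: "'a measure \<Rightarrow> (nat \<Rightarrow> nat \<Rightarrow> 'a set) \<Rightarrow> bool" where
  "span_weakly_dense M e \<longleftrightarrow>
     (\<forall>f\<in>borel_measurable M. (\<exists>K. AE x in M. cmod (f x) \<le> K) \<longrightarrow>
       (\<forall>F \<epsilon>. finite F \<and> F \<subseteq> L2_functions M \<times> L2_functions M \<and> \<epsilon> > 0 \<longrightarrow>
         (\<exists>J c. finite J \<and> J \<subseteq> {(i, m). 1 \<le> i \<and> i \<le> 2 ^ m} \<and>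
           (\<forall>(\<xi>, \<eta>)\<in>F. cmod (\<integral>x. (f x - (\<Sum>(i, m)\<in>J. c i m * indicator (e i m) x))
                                * \<xi> x * cnj (\<eta> x) \<partial>M) < \<epsilon>))))"

definition basic_sequence :: "'a measure \<Rightarrow> (nat \<Rightarrow> nat \<Rightarrow> 'a set) \<Rightarrow> bool" where
  "basic_sequence M e \<longleftrightarrow>
     (\<forall>m. \<forall>i\<in>{1..2 ^ m}. e i m \<in> sets M \<and> measure M (e i m) = 1 / 2 ^ m) \<and>
     summation_relations M e \<and> span_weakly_dense M e"

definition X_set :: "'b set \<Rightarrow> (nat \<Rightarrow> nat \<Rightarrow> 'b set) \<Rightarrow> bool" where
  "X_set Y e \<longleftrightarrow> finite Y \<and> Y \<noteq> {} \<and> (\<forall>m. \<forall>i\<in>{1..2 ^ m}. e i m \<subseteq> Y) \<and> e 1 0 = Y \<and>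
     summation_relations (uniform_count_measure Y) e"

text \<open>Edges are triples (source, color, target), so parallel edges of different colors are
  possible.\<close>

record 'v rooted_graph =
  verts :: "'v set"
  root_vertex :: 'v
  label :: "'v \<Rightarrow> nat"
  edges :: "('v \<times> letter \<times> 'v) set"

definition neighborhood :: "nat \<Rightarrow> 'v rooted_graph \<Rightarrow> bool" where
  "neighborhood r G \<longleftrightarrow> finite (verts G) \<and> root_vertex G \<in> verts G \<and>
     edges G \<subseteq> verts G \<times> letters r \<times> verts G \<and>
     (\<forall>v\<in>verts G. \<exists>k\<le>r. (root_vertex G, v) \<in> {(x, y). \<exists>g. (x, g, y) \<in> edges G} ^^ k) \<and>
     (\<forall>v\<in>verts G. label G v \<in> {1..2 ^ r}) \<and>
     (\<forall>x g y z. (x, g, y) \<in> edges G \<and> (x, g, z) \<in> edges G \<longrightarrow> y = z) \<and>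
     (\<forall>x g y. (x, g, y) \<in> edges G \<longrightarrow> (y, linv g, x) \<in> edges G)"

definition graph_iso :: "'v rooted_graph \<Rightarrow> 'w rooted_graph \<Rightarrow> bool" where
  "graph_iso G H \<longleftrightarrow> (\<exists>f. bij_betw f (verts G) (verts H) \<and> f (root_vertex G) = root_vertex H \<and>
     (\<forall>v\<in>verts G. label H (f v) = label G v) \<and>
     edges H = (\<lambda>(x, g, y). (f x, g, f y)) ` edges G)"

definition ball_graph ::
  "(nat \<Rightarrow> nat \<Rightarrow> 'a set) \<Rightarrow> (letter list \<Rightarrow> 'a \<Rightarrow> 'a) \<Rightarrow> nat \<Rightarrow> 'a \<Rightarrow> 'a rooted_graph" where
  "ball_graph e \<alpha> r x = \<lparr>
     verts = {\<alpha> w x | w. w \<in> words r},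
     root_vertex = x,
     label = (\<lambda>y. THE i. i \<in> {1..2 ^ r} \<and> y \<in> e i r),
     edges = {(\<alpha> w x, g, \<alpha> ([g] \<otimes>\<^bsub>free_group\<^esub> w) x) | w g.
       g \<in> letters r \<and> w \<in> words r \<and> [g] \<otimes>\<^bsub>free_group\<^esub> w \<in> words r}\<rparr>"

definition pattern_measure ::
  "'a measure \<Rightarrow> (nat \<Rightarrow> nat \<Rightarrow> 'a set) \<Rightarrow> (letter list \<Rightarrow> 'a \<Rightarrow> 'a) \<Rightarrow> nat \<Rightarrow>
   'v rooted_graph \<Rightarrow> real" where
  "pattern_measure M e \<alpha> r G = measure M {x \<in> space M. graph_iso (ball_graph e \<alpha> r x) G}"

definition pmp_action :: "'a measure \<Rightarrow> (letter list \<Rightarrow> 'a \<Rightarrow> 'a) \<Rightarrow> bool" where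
  "pmp_action M \<alpha> \<longleftrightarrow> group_action free_group (space M) \<alpha> \<and>
     (\<forall>w\<in>carrier free_group. \<alpha> w \<in> measurable M M \<and> distr M M (\<alpha> w) = M)"

text \<open>Every finite set is in bijection with a set of natural numbers, and every isomorphism
  class of finite graphs has a representative with vertices in the natural numbers.\<close>

definition EL_sofic_action ::
  "'a measure \<Rightarrow> (nat \<Rightarrow> nat \<Rightarrow> 'a set) \<Rightarrow> (letter list \<Rightarrow> 'a \<Rightarrow> 'a) \<Rightarrow> bool" where
  "EL_sofic_action M e \<alpha> \<longleftrightarrow>
     (\<exists>(Y :: nat \<Rightarrow> nat set) (d :: nat \<Rightarrow> nat \<Rightarrow> nat \<Rightarrow> nat set) \<beta>.
       (\<forall>k. X_set (Y k) (d k) \<and> group_action free_group (Y k) (\<beta> k)) \<and>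
       (\<forall>r\<ge>1. \<forall>G :: nat rooted_graph. neighborhood r G \<longrightarrow>
         (\<lambda>k. pattern_measure (uniform_count_measure (Y k)) (d k) (\<beta> k) r G)
           \<longlonglongrightarrow> pattern_measure M e \<alpha> r G))"

definition EL_sofic_relation ::
  "'a measure \<Rightarrow> (nat \<Rightarrow> nat \<Rightarrow> 'a set) \<Rightarrow> ('a \<times> 'a) set \<Rightarrow> bool" where
  "EL_sofic_relation M e E \<longleftrightarrow> (\<exists>\<alpha>. pmp_action M \<alpha> \<and>
     (AE x in M. E `` {x} = {\<alpha> w x | w. w \<in> carrier free_group}) \<and> EL_sofic_action M e \<alpha>)"

end

theory Submission
  imports Defs
begin

text \<open>By Feldman-Moore, \<open>E\<close> is generated by countably many measure-preserving Borel involutions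
  \<open>t\<^sub>n\<close>. The operator of \<open>t\<^sub>n\<close> normalizes the Cartan subalgebra, so soficity represents it as a
  diagonal times a permutation, while the indicator of a measurable set is represented by the
  indicator of a subset of \<open>{..<n\<^sub>k}\<close>. Forgetting the diagonal factors, the permutations and the
  subsets model the action of the free group on \<open>M\<close> up to proportions tending to zero
  along \<open>\<omega>\<close>: the operator of a word restricted to the set where the word acts trivially is a
  projection, so the permutation model of the word fixes almost all of the corresponding
  subset. The isomorphism class of a ball is determined by finitely many equalities of words and
  memberships in the basic sequence, all of which have the correct asymptotic frequency; a
  diagonal choice of indices replaces \<open>\<omega>\<close> by a sequence.\<close>

text \<open>The diagonal factors cannot be controlled, and their phases accumulate in products, so
  words are not compared as matrices. What survives is the support: matrices supported on the graphs
  of permutations multiply to one supported on the graph of the composition. This shows only that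
  almost all points in the model of a fixed-point set are fixed. Fixed points elsewhere are excluded
  by measurable sets that a word moves off themselves. Involutions are chosen because their
  operators are self-adjoint: a generator and its inverse are represented by one element of the
  ultraproduct. The permutations need not be involutions, so inverse letters get the inverse
  permutations, and the free group acts exactly on every finite set. Invariance of the measure makes
  right translations isometric; they commute with the algebra and show that the operators of the
  involutions normalize the Cartan subalgebra. The descriptive set theory serves to enumerate the
  countable classes by Borel maps.\<close>

section \<open>Analytic sets and the Lusin-Novikov theorem\<close>

text \<open>An analytic set is a continuous image of a closed subset of Baire space; closedness and
  continuity are both expressed through sequences.\<close>

definition pointwise_conv :: "(nat \<Rightarrow> nat \<Rightarrow> nat) \<Rightarrow> (nat \<Rightarrow> nat) \<Rightarrow> bool" where
  "pointwise_conv \<rho> \<sigma> \<longleftrightarrow> (\<forall>i. \<forall>\<^sub>F n in sequentially. \<rho> n i = \<sigma> i)"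

definition presents :: "(nat \<Rightarrow> nat) set \<Rightarrow> ((nat \<Rightarrow> nat) \<Rightarrow> 'z::metric_space) \<Rightarrow> bool" where
  "presents F f \<longleftrightarrow> (\<forall>\<rho> \<sigma>. (\<forall>n. \<rho> n \<in> F) \<longrightarrow> pointwise_conv \<rho> \<sigma> \<longrightarrow> \<sigma> \<in> F \<and> (\<lambda>n. f (\<rho> n)) \<longlonglongrightarrow> f \<sigma>)"

definition analytic :: "'z::metric_space set \<Rightarrow> bool" where
  "analytic A \<longleftrightarrow> (\<exists>F f. presents F f \<and> A = f ` F)"

lemma pointwise_conv_comp: "pointwise_conv \<rho> \<sigma> \<Longrightarrow> pointwise_conv (\<lambda>n. \<rho> n \<circ> h) (\<sigma> \<circ> h)"
  by (simp add: pointwise_conv_def)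

lemma pointwise_conv_shift: "pointwise_conv \<rho> \<sigma> \<Longrightarrow> pointwise_conv (\<lambda>n. \<rho> (n + N)) \<sigma>"
  unfolding pointwise_conv_def using eventually_sequentially_seg[of "\<lambda>n. \<rho> n i = \<sigma> i" N for i] by simp

lemma presentsD:
  assumes "presents F f" "\<And>n. \<rho> n \<in> F" "pointwise_conv \<rho> \<sigma>"
  shows "\<sigma> \<in> F" "(\<lambda>n. f (\<rho> n)) \<longlonglongrightarrow> f \<sigma>"
  using assms unfolding presents_def by blast+

lemma presentsI:
  assumes "\<And>\<rho> \<sigma>. (\<And>n. \<rho> n \<in> F) \<Longrightarrow> pointwise_conv \<rho> \<sigma> \<Longrightarrow> \<sigma> \<in> F \<and> (\<lambda>n. f (\<rho> n)) \<longlonglongrightarrow> f \<sigma>"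
  shows "presents F f"
  using assms unfolding presents_def by blast

lemma analyticI: "presents F f \<Longrightarrow> A = f ` F \<Longrightarrow> analytic A"
  unfolding analytic_def by blast

text \<open>A code lists, for every \<open>n\<close>, the index of a point of a countable dense set
  within \<open>(1/2)^n\<close> of the coded point. The inequalities are not strict, so they pass to
  limits; completeness provides the point coded by a limit of codes.\<close>

lemma analytic_UNIV: "analytic (UNIV :: 'z::{complete_space,second_countable_topology} set)"
proof -
  obtain D :: "'z set" where D: "countable D" "\<And>X. open X \<Longrightarrow> X \<noteq> {} \<Longrightarrow> \<exists>d\<in>D. d \<in> X"
    by (rule countable_dense_setE) blast
  define q where "q = from_nat_into D"
  have ex_q: "\<exists>j. dist x (q j) \<le> e" if "e > 0" for x e
  proof -
    have "ball x e \<noteq> {}" using that by simp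
    then obtain d where "d \<in> D" "d \<in> ball x e" using D(2)[of "ball x e"] by blast
    then show ?thesis using D(1) unfolding q_def
      by (metis from_nat_into_surj less_imp_le mem_ball)
  qed
  define good where "good \<sigma> x \<longleftrightarrow> (\<forall>n. dist x (q (\<sigma> n)) \<le> (1/2)^n)" for \<sigma> :: "nat \<Rightarrow> nat" and x
  have small: "\<exists>n. (1/2::real)^n < e" if "e > 0" for e
    using real_arch_pow_inv[OF that, of "1/2"] by auto
  have uniq: "x = y" if "good \<sigma> x" "good \<sigma> y" for \<sigma> x y
  proof (rule ccontr)
    assume "x \<noteq> y"
    then obtain n where n: "(1/2::real)^n < dist x y / 2" using small[of "dist x y / 2"] by auto
    have "dist x y \<le> dist x (q (\<sigma> n)) + dist y (q (\<sigma> n))" by (rule dist_triangle2)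
    also have "\<dots> \<le> (1/2)^n + (1/2)^n" using that unfolding good_def by (intro add_mono) auto
    finally show False using n by simp
  qed
  define F where "F = {\<sigma>. \<exists>x. good \<sigma> x}"
  define f where "f \<sigma> = (THE x. good \<sigma> x)" for \<sigma>
  have f: "f \<sigma> = x" if "good \<sigma> x" for \<sigma> x
    unfolding f_def using that uniq by blast
  have "presents F f"
  proof (rule presentsI)
    fix \<rho> \<sigma> assume \<rho>: "\<And>n. \<rho> n \<in> F" and c: "pointwise_conv \<rho> \<sigma>"
    have g: "good (\<rho> n) (f (\<rho> n))" for n using \<rho>[of n] f unfolding F_def by auto
    \<comment> \<open>Only two coordinates of \<open>\<sigma>\<close> are involved, so a single
      \<open>\<rho> n\<close> that agrees with \<open>\<sigma>\<close> at both gives the bound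
      through its own point \<open>f (\<rho> n)\<close>.\<close>
    have C: "dist (q (\<sigma> i)) (q (\<sigma> j)) \<le> (1/2)^i + (1/2)^j" for i j
    proof -
      have "\<forall>\<^sub>F n in sequentially. \<rho> n i = \<sigma> i \<and> \<rho> n j = \<sigma> j"
        using c unfolding pointwise_conv_def by (simp add: eventually_conj)
      then obtain n where "\<rho> n i = \<sigma> i" "\<rho> n j = \<sigma> j"
        using eventually_happens'[OF sequentially_bot] by blast
      then show ?thesis using g[of n] dist_triangle3[of "q (\<sigma> i)" "q (\<sigma> j)" "f (\<rho> n)"]
        unfolding good_def by (smt (verit, best))
    qed
    have "Cauchy (\<lambda>n. q (\<sigma> n))"
    proof (rule metric_CauchyI)
      fix e :: real assume "e > 0"
      then obtain N where N: "(1/2::real)^N < e/2" using small[of "e/2"] by auto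
      have "dist (q (\<sigma> m)) (q (\<sigma> n)) < e" if "m \<ge> N" "n \<ge> N" for m n
      proof -
        have "(1/2::real)^m \<le> (1/2)^N" "(1/2::real)^n \<le> (1/2)^N" using that by (auto intro: power_decreasing)
        then show ?thesis using C[of m n] N by linarith
      qed
      then show "\<exists>M. \<forall>m\<ge>M. \<forall>n\<ge>M. dist (q (\<sigma> m)) (q (\<sigma> n)) < e" by blast
    qed
    then obtain x where x: "(\<lambda>n. q (\<sigma> n)) \<longlonglongrightarrow> x" using Cauchy_convergent convergent_def by blast
    have "dist x (q (\<sigma> i)) \<le> (1/2)^i" for i
    proof -
      have "(\<lambda>j. dist (q (\<sigma> j)) (q (\<sigma> i))) \<longlonglongrightarrow> dist x (q (\<sigma> i))" by (intro tendsto_intros x)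
      moreover have "(\<lambda>j. (1/2)^j + (1/2::real)^i) \<longlonglongrightarrow> 0 + (1/2)^i"
        by (intro tendsto_intros LIMSEQ_realpow_zero) auto
      ultimately show ?thesis using C by (intro LIMSEQ_le[where X="\<lambda>j. dist (q (\<sigma> j)) (q (\<sigma> i))"]) auto
    qed
    then have gx: "good \<sigma> x" unfolding good_def by blast
    have "(\<lambda>n. f (\<rho> n)) \<longlonglongrightarrow> x"
    proof (rule metric_LIMSEQ_I)
      fix e :: real assume "e > 0"
      then obtain i where N: "(1/2::real)^i < e/2" using small[of "e/2"] by auto
      have "\<forall>\<^sub>F n in sequentially. \<rho> n i = \<sigma> i" using c unfolding pointwise_conv_def by blast
      then have "\<forall>\<^sub>F n in sequentially. dist (f (\<rho> n)) x < e"
      proof eventually_elim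
        case (elim n)
        have "dist (f (\<rho> n)) (q (\<sigma> i)) \<le> (1/2)^i" "dist x (q (\<sigma> i)) \<le> (1/2)^i"
          using g[of n] gx elim unfolding good_def by metis+
        then show ?case using dist_triangle2[of "f (\<rho> n)" x "q (\<sigma> i)"] N by linarith
      qed
      then show "\<exists>no. \<forall>n\<ge>no. dist (f (\<rho> n)) x < e" by (simp add: eventually_sequentially)
    qed
    then show "\<sigma> \<in> F \<and> (\<lambda>n. f (\<rho> n)) \<longlonglongrightarrow> f \<sigma>" using gx f F_def by auto
  qed
  moreover have "UNIV = f ` F"
  proof -
    have "x \<in> f ` F" for x
    proof -
      have "\<forall>n. \<exists>j. dist x (q j) \<le> (1/2)^n" by (intro allI ex_q) auto
      then obtain \<sigma> where "good \<sigma> x" unfolding good_def by metis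
      then show ?thesis using f unfolding F_def by (auto intro!: image_eqI[of _ _ \<sigma>])
    qed
    then show ?thesis by blast
  qed
  ultimately show ?thesis by (rule analyticI)
qed

lemma analytic_image:
  assumes "analytic A" "continuous_on UNIV h"
  shows "analytic (h ` A)"
proof -
  obtain F f where F: "presents F f" "A = f ` F" using assms(1) unfolding analytic_def by blast
  have "presents F (\<lambda>\<sigma>. h (f \<sigma>))"
    by (rule presentsI)
      (use F(1) assms(2) in \<open>auto dest: presentsD intro!: continuous_on_tendsto_compose[of UNIV h]\<close>)
  then show ?thesis by (rule analyticI) (auto simp: F)
qed

lemma analytic_Int_closed:
  assumes "analytic A" "closed C"
  shows "analytic (A \<inter> C)"
proof -
  obtain F f where F: "presents F f" "A = f ` F" using assms(1) unfolding analytic_def by blast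
  have "presents {\<sigma>\<in>F. f \<sigma> \<in> C} f"
  proof (rule presentsI)
    fix \<rho> \<sigma> assume \<rho>: "\<And>n. \<rho> n \<in> {\<sigma>\<in>F. f \<sigma> \<in> C}" and c: "pointwise_conv \<rho> \<sigma>"
    then have "\<sigma> \<in> F" "(\<lambda>n. f (\<rho> n)) \<longlonglongrightarrow> f \<sigma>" using presentsD[OF F(1) _ c] by auto
    moreover have "f \<sigma> \<in> C" using closed_sequentially[OF assms(2) _ calculation(2)] \<rho> by auto
    ultimately show "\<sigma> \<in> {\<sigma>\<in>F. f \<sigma> \<in> C} \<and> (\<lambda>n. f (\<rho> n)) \<longlonglongrightarrow> f \<sigma>" by auto
  qed
  then show ?thesis by (rule analyticI) (auto simp: F)
qed

text \<open>Coordinate 0 of a code selects the set, the remaining ones code a point of it. Along a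
  convergent sequence of codes the selected index is eventually constant, whence the shift by
  \<open>N\<close>.\<close>

lemma analytic_UN:
  assumes "\<And>i::nat. analytic (A i)"
  shows "analytic (\<Union>i. A i)"
proof -
  obtain F f where F: "\<And>i. presents (F i) (f i)" "\<And>i. A i = f i ` F i"
    using assms unfolding analytic_def by metis
  let ?F = "{\<sigma>. \<sigma> \<circ> Suc \<in> F (\<sigma> 0)}" and ?f = "\<lambda>\<sigma>. f (\<sigma> 0) (\<sigma> \<circ> Suc)"
  have "presents ?F ?f"
  proof (rule presentsI)
    fix \<rho> \<sigma> assume \<rho>: "\<And>n. \<rho> n \<in> ?F" and c: "pointwise_conv \<rho> \<sigma>"
    obtain N where N: "\<And>n. n \<ge> N \<Longrightarrow> \<rho> n 0 = \<sigma> 0"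
      using c unfolding pointwise_conv_def eventually_sequentially by blast
    have "\<rho> (n + N) \<circ> Suc \<in> F (\<sigma> 0)" for n using \<rho>[of "n+N"] N[of "n+N"] by auto
    note p = presentsD[OF F(1) this pointwise_conv_comp[OF pointwise_conv_shift[OF c]]]
    have "(\<lambda>n. ?f (\<rho> (n + N))) = (\<lambda>n. f (\<sigma> 0) (\<rho> (n + N) \<circ> Suc))" using N by auto
    then have "(\<lambda>n. ?f (\<rho> (n + N))) \<longlonglongrightarrow> ?f \<sigma>" using p(2) by simp
    then show "\<sigma> \<in> ?F \<and> (\<lambda>n. ?f (\<rho> n)) \<longlonglongrightarrow> ?f \<sigma>" using p(1) by (auto intro: LIMSEQ_offset)
  qed
  moreover have "(\<Union>i. A i) = ?f ` ?F"
  proof -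
    have "f i \<sigma> \<in> ?f ` ?F" if "\<sigma> \<in> F i" for i \<sigma>
      using that by (intro image_eqI[of _ _ "case_nat i \<sigma>"]) (auto simp: comp_def)
    then show ?thesis unfolding F(2) by auto
  qed
  ultimately show ?thesis by (rule analyticI)
qed

text \<open>Row \<open>i\<close> of a code, read through \<open>prod_encode\<close>, presents the
  same point as an element of \<open>A i\<close>. Agreement of all rows is a closed condition
  because limits are unique.\<close>

lemma analytic_INT:
  assumes "\<And>i::nat. analytic (A i)"
  shows "analytic (\<Inter>i. A i)"
proof -
  obtain F f where F: "\<And>i. presents (F i) (f i)" "\<And>i. A i = f i ` F i"
    using assms unfolding analytic_def by metis
  define c where "c i j = prod_encode (i, j)" for i j
  let ?F = "{\<sigma>. \<forall>i. \<sigma> \<circ> c i \<in> F i \<and> f i (\<sigma> \<circ> c i) = f 0 (\<sigma> \<circ> c 0)}" and ?f = "\<lambda>\<sigma>. f 0 (\<sigma> \<circ> c 0)"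
  have "presents ?F ?f"
  proof (rule presentsI)
    fix \<rho> \<sigma> assume \<rho>: "\<And>n. \<rho> n \<in> ?F" and cv: "pointwise_conv \<rho> \<sigma>"
    have p: "\<sigma> \<circ> c i \<in> F i" "(\<lambda>n. f i (\<rho> n \<circ> c i)) \<longlonglongrightarrow> f i (\<sigma> \<circ> c i)" for i
      using presentsD[OF F(1) _ pointwise_conv_comp[OF cv, of "c i"], of i] \<rho> by blast+
    have eq: "f i (\<sigma> \<circ> c i) = f 0 (\<sigma> \<circ> c 0)" for i
    proof -
      have "f i (\<rho> n \<circ> c i) = f 0 (\<rho> n \<circ> c 0)" for n using \<rho>[of n] by blast
      then show ?thesis using LIMSEQ_unique[OF p(2)[of i]] p(2)[of 0] by simp
    qed
    have "\<sigma> \<in> ?F" by (intro CollectI allI conjI p(1) eq)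
    then show "\<sigma> \<in> ?F \<and> (\<lambda>n. ?f (\<rho> n)) \<longlonglongrightarrow> ?f \<sigma>" by (rule conjI) (rule p(2))
  qed
  moreover have "(\<Inter>i. A i) = ?f ` ?F"
  proof (intro equalityI subsetI)
    fix x assume "x \<in> (\<Inter>i. A i)"
    then have "x \<in> f i ` F i" for i using F(2)[of i] by (metis INT_iff UNIV_I)
    then have "\<forall>i. \<exists>\<sigma>. \<sigma> \<in> F i \<and> f i \<sigma> = x" by (metis imageE)
    then obtain \<sigma> where \<sigma>: "\<And>i. \<sigma> i \<in> F i" "\<And>i. f i (\<sigma> i) = x" by metis
    define \<tau> where "\<tau> k = (case prod_decode k of (i, j) \<Rightarrow> \<sigma> i j)" for k
    have "\<tau> \<circ> c i = \<sigma> i" for i by (auto simp: \<tau>_def c_def)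
    then show "x \<in> ?f ` ?F" using \<sigma> by (intro image_eqI[of _ _ \<tau>]) simp_all
  next
    fix x assume "x \<in> ?f ` ?F"
    then obtain \<sigma> where s: "\<sigma> \<in> ?F" "x = ?f \<sigma>" by (elim imageE)
    have "x \<in> A i" for i
    proof -
      have "\<sigma> \<circ> c i \<in> F i" "f i (\<sigma> \<circ> c i) = x" using s(1) unfolding s(2) by blast+
      then show ?thesis unfolding F(2) by (metis imageI)
    qed
    then show "x \<in> (\<Inter>i. A i)" by blast
  qed
  ultimately show ?thesis by (rule analyticI)
qed

text \<open>A fibre product of the two presentations. With \<open>h = fst\<close> and
  \<open>Q\<close> a projection, it keeps the points of \<open>A\<close> over which another analytic
  set has a point, as required in the splitting step of \<open>lusin_novikov\<close>.\<close>

lemma analytic_Int_vimage: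
  assumes "analytic A" "analytic Q" "continuous_on UNIV h"
  shows "analytic (A \<inter> h -` Q)"
proof -
  obtain F f where F: "presents F f" "A = f ` F" using assms(1) unfolding analytic_def by blast
  obtain G g where G: "presents G g" "Q = g ` G" using assms(2) unfolding analytic_def by blast
  define c where "c i j = prod_encode (i, j)" for i j
  let ?F = "{\<sigma>. \<sigma> \<circ> c 0 \<in> F \<and> \<sigma> \<circ> c 1 \<in> G \<and> h (f (\<sigma> \<circ> c 0)) = g (\<sigma> \<circ> c 1)}" and ?f = "\<lambda>\<sigma>. f (\<sigma> \<circ> c 0)"
  have "presents ?F ?f"
  proof (rule presentsI)
    fix \<rho> \<sigma> assume \<rho>: "\<And>n. \<rho> n \<in> ?F" and cv: "pointwise_conv \<rho> \<sigma>"
    have p: "\<sigma> \<circ> c 0 \<in> F" "(\<lambda>n. f (\<rho> n \<circ> c 0)) \<longlonglongrightarrow> f (\<sigma> \<circ> c 0)"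
      using presentsD[OF F(1) _ pointwise_conv_comp[OF cv, of "c 0"]] \<rho> by blast+
    have p': "\<sigma> \<circ> c 1 \<in> G" "(\<lambda>n. g (\<rho> n \<circ> c 1)) \<longlonglongrightarrow> g (\<sigma> \<circ> c 1)"
      using presentsD[OF G(1) _ pointwise_conv_comp[OF cv, of "c 1"]] \<rho> by blast+
    have "(\<lambda>n. h (f (\<rho> n \<circ> c 0))) \<longlonglongrightarrow> h (f (\<sigma> \<circ> c 0))"
      using p(2) assms(3) by (auto intro!: continuous_on_tendsto_compose[of UNIV h])
    moreover have "h (f (\<rho> n \<circ> c 0)) = g (\<rho> n \<circ> c 1)" for n using \<rho>[of n] by blast
    ultimately have "h (f (\<sigma> \<circ> c 0)) = g (\<sigma> \<circ> c 1)" using LIMSEQ_unique[OF p'(2)] by simp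
    then show "\<sigma> \<in> ?F \<and> (\<lambda>n. ?f (\<rho> n)) \<longlonglongrightarrow> ?f \<sigma>" using p p' by auto
  qed
  moreover have "A \<inter> h -` Q = ?f ` ?F"
  proof (intro equalityI subsetI)
    fix x assume "x \<in> A \<inter> h -` Q"
    then obtain \<sigma> \<sigma>' where \<sigma>: "\<sigma> \<in> F" "f \<sigma> = x" "\<sigma>' \<in> G" "g \<sigma>' = h x" unfolding F(2) G(2) by auto
    define \<tau> where "\<tau> k = (case prod_decode k of (i, j) \<Rightarrow> if i = 0 then \<sigma> j else \<sigma>' j)" for k
    have "\<tau> \<circ> c 0 = \<sigma>" "\<tau> \<circ> c 1 = \<sigma>'" by (auto simp: \<tau>_def c_def)
    then show "x \<in> ?f ` ?F" using \<sigma> by (intro image_eqI[of _ _ \<tau>]) auto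
  qed (auto simp: F(2) G(2))
  ultimately show ?thesis by (rule analyticI)
qed

lemma analytic_Int: "analytic A \<Longrightarrow> analytic B \<Longrightarrow> analytic (A \<inter> B)"
  using analytic_Int_vimage[of A B id] by simp

lemma analytic_closed:
  "closed C \<Longrightarrow> analytic (C :: 'z::{complete_space,second_countable_topology} set)"
  using analytic_Int_closed[OF analytic_UNIV, of C] by simp

lemma analytic_open:
  assumes "open (U :: 'z::{complete_space,second_countable_topology} set)"
  shows "analytic U"
\<comment> \<open>The distance to the empty set is 0 by convention, so the exhaustion by closed sets
  below fails for the whole space.\<close>
proof (cases "U = UNIV")
  case False
  have "U = (\<Union>n. {x. 1 / real (Suc n) \<le> infdist x (- U)})"
  proof (intro equalityI subsetI)
    fix x assume "x \<in> U"
    then have "infdist x (- U) \<noteq> 0"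
      using in_closed_iff_infdist_zero[of "- U" x] assms False by auto
    then have "infdist x (- U) > 0" using infdist_nonneg[of x "-U"] by linarith
    then obtain n where "inverse (real (Suc n)) < infdist x (- U)" using reals_Archimedean by blast
    then show "x \<in> (\<Union>n. {x. 1 / real (Suc n) \<le> infdist x (- U)})"
      by (auto simp: inverse_eq_divide intro!: exI[of _ n] less_imp_le)
  next
    fix x assume "x \<in> (\<Union>n. {x. 1 / real (Suc n) \<le> infdist x (- U)})"
    then obtain n where "1 / real (Suc n) \<le> infdist x (- U)" by blast
    moreover have "0 < 1 / real (Suc n)" by simp
    ultimately have "infdist x (- U) \<noteq> 0" by linarith
    then show "x \<in> U" using infdist_zero[of x "-U"] by blast
  qed
  moreover have "closed {x. 1 / real (Suc n) \<le> infdist x (- U)}" for n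
    by (intro closed_Collect_le continuous_intros)
  ultimately show ?thesis using analytic_UN analytic_closed by (metis (no_types, lifting))
qed (simp add: analytic_UNIV)

text \<open>Complements of analytic sets need not be analytic, so the induction carries a set
  together with its complement.\<close>

lemma analytic_borel:
  assumes "B \<in> sets (borel :: 'z::{complete_space,second_countable_topology} measure)"
  shows "analytic B"
proof -
  have "B \<in> sigma_sets UNIV {S. open S}" using assms by (simp add: sets_borel)
  then have "analytic B \<and> analytic (- B)"
  proof induction
    case (Basic a)
    then show ?case by (auto intro: analytic_open analytic_closed)
  next
    case Empty
    then show ?case using analytic_UNIV analytic_closed[of "{}"] by auto
  next
    case (Compl a)
    then show ?case by (simp add: Compl_eq_Diff_UNIV double_diff)
  next
    case (Union a)
    then show ?case using analytic_UN[of a] analytic_INT[of "\<lambda>i. - a i"] by auto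
  qed
  then show ?thesis by blast
qed

section \<open>Basic open sets of Baire space and Lusin separation\<close>

definition cyl :: "nat list \<Rightarrow> (nat \<Rightarrow> nat) set" where
  "cyl s = {\<sigma>. map \<sigma> [0..<length s] = s}"

lemma cyl_prefix: "\<sigma> \<in> cyl (map \<sigma> [0..<n])"
  by (simp add: cyl_def)

lemma cyl_Nil [simp]: "cyl [] = UNIV"
  by (simp add: cyl_def)

lemma cyl_UN: "cyl s = (\<Union>j. cyl (s @ [j]))"
  by (auto simp: cyl_def)

lemma pointwise_conv_cyl:
  assumes "\<And>n. \<rho> n \<in> cyl (map \<sigma> [0..<h n])" "strict_mono h"
  shows "pointwise_conv \<rho> \<sigma>"
proof -
  have "\<rho> n i = \<sigma> i" if "n > i" for n i
  proof -
    have "i < h n" using seq_suble[OF assms(2), of n] that by linarith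
    then show ?thesis using assms(1)[of n] by (auto simp: cyl_def map_eq_conv)
  qed
  then show ?thesis unfolding pointwise_conv_def eventually_sequentially by (meson Suc_le_eq)
qed

text \<open>Otherwise points of ever longer cylinders around \<open>\<sigma>\<close> would converge
  to \<open>\<sigma>\<close> while their images avoid \<open>U\<close>.\<close>

lemma presents_nhds:
  assumes "presents F f" "\<sigma> \<in> F" "open U" "f \<sigma> \<in> U"
  shows "\<exists>N. \<forall>n\<ge>N. f ` (F \<inter> cyl (map \<sigma> [0..<n])) \<subseteq> U"
proof (rule ccontr)
  assume "\<not> ?thesis"
  then have "\<forall>N. \<exists>n \<rho>. n \<ge> N \<and> \<rho> \<in> F \<inter> cyl (map \<sigma> [0..<n]) \<and> f \<rho> \<notin> U" by (meson image_subsetI)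
  then obtain n \<rho> where n: "\<And>N. n N \<ge> N" and \<rho>: "\<And>N. \<rho> N \<in> F \<inter> cyl (map \<sigma> [0..<n N])" "\<And>N. f (\<rho> N) \<notin> U"
    by metis
  have "pointwise_conv \<rho> \<sigma>" unfolding pointwise_conv_def eventually_sequentially
  proof (intro allI exI impI)
    fix i N assume "Suc i \<le> N"
    then have "i < n N" using n[of N] by linarith
    then show "\<rho> N i = \<sigma> i" using \<rho>(1)[of N] by (auto simp: cyl_def map_eq_conv)
  qed
  then have "(\<lambda>N. f (\<rho> N)) \<longlonglongrightarrow> f \<sigma>" using presentsD(2)[OF assms(1)] \<rho>(1) by blast
  then have "\<forall>\<^sub>F N in sequentially. f (\<rho> N) \<in> U" using topological_tendstoD assms(3,4) by blast
  then show False using \<rho>(2) by (simp add: eventually_sequentially)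
qed

lemma analytic_presents_cyl: "presents F f \<Longrightarrow> analytic (f ` (F \<inter> cyl s))"
proof (rule analyticI[OF _ refl], rule presentsI)
  fix \<rho> \<sigma> assume F: "presents F f" and \<rho>: "\<And>n. \<rho> n \<in> F \<inter> cyl s" and c: "pointwise_conv \<rho> \<sigma>"
  have "\<sigma> i = s ! i" if "i < length s" for i
  proof -
    have "\<forall>\<^sub>F n in sequentially. \<rho> n i = \<sigma> i" using c pointwise_conv_def by blast
    then obtain n where "\<rho> n i = \<sigma> i" using eventually_happens'[OF sequentially_bot] by blast
    moreover have "map (\<rho> n) [0..<length s] ! i = s ! i" using \<rho>[of n] by (simp add: cyl_def)
    ultimately show ?thesis using that by simp
  qed
  then have "\<sigma> \<in> cyl s" unfolding cyl_def by (auto intro!: nth_equalityI)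
  then show "\<sigma> \<in> F \<inter> cyl s \<and> (\<lambda>n. f (\<rho> n)) \<longlonglongrightarrow> f \<sigma>" using presentsD[OF F _ c] \<rho> by blast
qed

lemma branch_exists:
  assumes "\<And>n. s (Suc n) = s n @ [j n]" "s 0 = []"
  shows "s n = map j [0..<n]"
  by (induction n) (use assms in auto)

definition separable :: "'z::metric_space set \<Rightarrow> 'z set \<Rightarrow> bool" where
  "separable A B \<longleftrightarrow> (\<exists>C\<in>sets borel. A \<subseteq> C \<and> B \<inter> C = {})"

text \<open>Used contrapositively: when two unions cannot be separated, some pair of their pieces
  cannot be either.\<close>

lemma separable_UN:
  assumes "\<And>i j. separable (A i) (B j)"
  shows "separable (\<Union>i::nat. A i) (\<Union>j::nat. B j)"
proof -
  obtain C where C: "\<And>i j. C i j \<in> sets borel" "\<And>i j. A i \<subseteq> C i j" "\<And>i j. B j \<inter> C i j = {}"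
    using assms unfolding separable_def by metis
  have "(\<Union>i. \<Inter>j. C i j) \<in> sets borel" using C(1) by auto
  moreover have "(\<Union>i. A i) \<subseteq> (\<Union>i. \<Inter>j. C i j)" using C(2) by blast
  moreover have "(\<Union>j. B j) \<inter> (\<Union>i. \<Inter>j. C i j) = {}" using C(3) by blast
  ultimately show ?thesis unfolding separable_def by blast
qed

text \<open>If \<open>A\<close> and \<open>B\<close> were inseparable, repeated refinement would
  give branches \<open>i\<close> and \<open>j\<close> all of whose cylinders have inseparable
  images. The points \<open>f i\<close> and \<open>g j\<close> differ by disjointness, and
  neighbourhoods separating them contain the images of long cylinders.\<close>

theorem lusin_separation:
  assumes "analytic A" "analytic B" "A \<inter> B = {}"
  shows "separable A B"
proof (rule ccontr)
  assume nsep: "\<not> separable A B"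
  obtain F f where F: "presents F f" "A = f ` F" using assms(1) unfolding analytic_def by blast
  obtain G g where G: "presents G g" "B = g ` G" using assms(2) unfolding analytic_def by blast
  let ?N = "\<lambda>(s, t). \<not> separable (f ` (F \<inter> cyl s)) (g ` (G \<inter> cyl t))"
  have step: "\<exists>i j. ?N (s @ [i], t @ [j])" if "?N (s, t)" for s t
  proof (rule ccontr)
    assume "\<not> ?thesis"
    then have "separable (\<Union>i. f ` (F \<inter> cyl (s @ [i]))) (\<Union>j. g ` (G \<inter> cyl (t @ [j])))"
      by (intro separable_UN) auto
    moreover have "(\<Union>i. f ` (F \<inter> cyl (s @ [i]))) = f ` (F \<inter> cyl s)"
      "(\<Union>j. g ` (G \<inter> cyl (t @ [j]))) = g ` (G \<inter> cyl t)"
      by (auto simp: cyl_UN[of s] cyl_UN[of t])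
    ultimately show False using that by simp
  qed
  have "\<exists>st. \<forall>n. (?N (st n) \<and> (n = 0 \<longrightarrow> st n = ([], []))) \<and>
      (\<exists>i j. st (Suc n) = (fst (st n) @ [i], snd (st n) @ [j]))"
  proof (rule dependent_nat_choice)
    show "\<exists>st. ?N st \<and> ((0::nat) = 0 \<longrightarrow> st = ([], []))" using nsep F(2) G(2) by auto
  next
    fix st and n :: nat assume "?N st \<and> (n = 0 \<longrightarrow> st = ([], []))"
    then have "?N (fst st, snd st)" by simp
    from step[OF this] show "\<exists>st'. (?N st' \<and> (Suc n = 0 \<longrightarrow> st' = ([], []))) \<and>
      (\<exists>i j. st' = (fst st @ [i], snd st @ [j]))" by blast
  qed
  then obtain st where st': "\<forall>n. (?N (st n) \<and> (n = 0 \<longrightarrow> st n = ([], []))) \<and>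
      (\<exists>i j. st (Suc n) = (fst (st n) @ [i], snd (st n) @ [j]))" by (elim exE)
  have st: "?N (st n)" "st 0 = ([], [])" "\<exists>i j. st (Suc n) = (fst (st n) @ [i], snd (st n) @ [j])" for n
    using spec[OF st', of n] spec[OF st', of 0] by (simp_all only: simp_thms)
  then obtain i j where ij: "\<And>n. st (Suc n) = (fst (st n) @ [i n], snd (st n) @ [j n])" by metis
  have fs: "fst (st n) = map i [0..<n]" for n
    by (rule branch_exists[of "\<lambda>n. fst (st n)"]) (use ij st(2) in auto)
  have sn: "snd (st n) = map j [0..<n]" for n
    by (rule branch_exists[of "\<lambda>n. snd (st n)"]) (use ij st(2) in auto)
  have N: "\<not> separable (f ` (F \<inter> cyl (map i [0..<n]))) (g ` (G \<inter> cyl (map j [0..<n])))" for n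
    using st(1)[of n] by (simp add: fs[symmetric] sn[symmetric] case_prod_beta)
  \<comment> \<open>Empty images are separable, so every cylinder along the branch meets
    \<open>F\<close>, and closedness puts the branch itself into \<open>F\<close>.\<close>
  have "\<exists>\<rho>. \<rho> \<in> F \<inter> cyl (map i [0..<n])" for n
    using N[of n] unfolding separable_def by (metis empty_subsetI equals0I image_empty inf_bot_right sets.empty_sets)
  then obtain \<rho> where \<rho>: "\<And>n. \<rho> n \<in> F \<inter> cyl (map i [0..<n])" by metis
  have "pointwise_conv \<rho> i" by (rule pointwise_conv_cyl[of _ _ id]) (use \<rho> in \<open>auto simp: strict_mono_def\<close>)
  then have iF: "i \<in> F" using presentsD(1)[OF F(1), of \<rho>] \<rho> by blast
  have "\<exists>\<rho>. \<rho> \<in> G \<inter> cyl (map j [0..<n])" for n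
    using N[of n] unfolding separable_def by (metis equals0I image_empty inf_bot_left subset_UNIV sets.top space_borel)
  then obtain \<rho>' where \<rho>': "\<And>n. \<rho>' n \<in> G \<inter> cyl (map j [0..<n])" by metis
  have "pointwise_conv \<rho>' j" by (rule pointwise_conv_cyl[of _ _ id]) (use \<rho>' in \<open>auto simp: strict_mono_def\<close>)
  then have jG: "j \<in> G" using presentsD(1)[OF G(1), of \<rho>'] \<rho>' by blast
  have "f i \<noteq> g j" using iF jG F G assms(3) by blast
  then obtain U V where UV: "open U" "open V" "f i \<in> U" "g j \<in> V" "U \<inter> V = {}" using hausdorff by metis
  obtain N1 where N1: "\<And>n. n \<ge> N1 \<Longrightarrow> f ` (F \<inter> cyl (map i [0..<n])) \<subseteq> U"
    using presents_nhds[OF F(1) iF UV(1,3)] by blast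
  obtain N2 where N2: "\<And>n. n \<ge> N2 \<Longrightarrow> g ` (G \<inter> cyl (map j [0..<n])) \<subseteq> V"
    using presents_nhds[OF G(1) jG UV(2,4)] by blast
  have "separable (f ` (F \<inter> cyl (map i [0..<max N1 N2]))) (g ` (G \<inter> cyl (map j [0..<max N1 N2])))"
    unfolding separable_def using N1[of "max N1 N2"] N2[of "max N1 N2"] UV
    by (intro bexI[of _ U]) auto
  then show False using N by blast
qed

section \<open>Covering analytic sets by countably many Borel graphs\<close>

definition graph_of :: "('x \<Rightarrow> 'y) \<Rightarrow> ('x \<times> 'y) set" where
  "graph_of g = {(x, y). y = g x}"

text \<open>The maps are total: a cover may exceed the set covered, so a section over part of the
  space can be extended arbitrarily. Values in \<open>nat \<Rightarrow> real\<close> suffice because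
  standard Borel spaces are coded there by \<open>standard_borel_coding\<close>.\<close>

definition borel_graphs ::
    "('x::{complete_space,second_countable_topology} \<times> (nat \<Rightarrow> real)) set \<Rightarrow> bool" where
  "borel_graphs S \<longleftrightarrow> (\<exists>\<G>. countable \<G> \<and> \<G> \<subseteq> borel_measurable borel \<and> S = (\<Union>g\<in>\<G>. graph_of g))"

lemma borel_graphs_empty: "borel_graphs {}"
  unfolding borel_graphs_def by (rule exI[of _ "{}"]) auto

lemma borel_graphs_UN:
  assumes "countable I" "\<And>i. i \<in> I \<Longrightarrow> borel_graphs (S i)"
  shows "borel_graphs (\<Union>i\<in>I. S i)"
proof -
  have "\<forall>i\<in>I. \<exists>\<G>. countable \<G> \<and> \<G> \<subseteq> borel_measurable borel \<and> S i = (\<Union>g\<in>\<G>. graph_of g)"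
    using assms(2) unfolding borel_graphs_def by blast
  then obtain \<G> where \<G>: "\<And>i. i \<in> I \<Longrightarrow> countable (\<G> i)" "\<And>i. i \<in> I \<Longrightarrow> \<G> i \<subseteq> borel_measurable borel"
    "\<And>i. i \<in> I \<Longrightarrow> S i = (\<Union>g\<in>\<G> i. graph_of g)" by metis
  have "(\<Union>i\<in>I. S i) = (\<Union>g\<in>(\<Union>i\<in>I. \<G> i). graph_of g)" using \<G>(3) by auto
  moreover have "(\<Union>i\<in>I. \<G> i) \<subseteq> borel_measurable borel" using \<G>(2) by blast
  ultimately show ?thesis using \<G>(1) assms(1) unfolding borel_graphs_def
    by (intro exI[of _ "\<Union>i\<in>I. \<G> i"]) auto
qed

lemma borel_graphs_Un: "borel_graphs S \<Longrightarrow> borel_graphs T \<Longrightarrow> borel_graphs (S \<union> T)"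
  using borel_graphs_UN[of "UNIV :: bool set" "\<lambda>b. if b then S else T"] by (auto simp: UNIV_bool Un_commute)

lemma borel_graphs_sets: "borel_graphs S \<Longrightarrow> S \<in> sets borel"
proof -
  assume "borel_graphs S"
  then obtain \<G> where \<G>: "countable \<G>" "\<G> \<subseteq> borel_measurable borel" "S = (\<Union>g\<in>\<G>. graph_of g)"
    unfolding borel_graphs_def by blast
  have "graph_of g \<in> sets borel" if "g \<in> borel_measurable borel" for g :: "'a \<Rightarrow> nat \<Rightarrow> real"
  proof -
    have [measurable]: "g \<in> borel_measurable borel" by fact
    have "closed {z :: (nat \<Rightarrow> real) \<times> (nat \<Rightarrow> real). fst z = snd z}"
      by (intro closed_Collect_eq continuous_intros)
    then have [measurable]: "{z :: (nat \<Rightarrow> real) \<times> (nat \<Rightarrow> real). fst z = snd z} \<in> sets (borel \<Otimes>\<^sub>M borel)"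
      unfolding borel_prod by simp
    have "(\<lambda>p. (snd p, g (fst p))) \<in> measurable (borel \<Otimes>\<^sub>M borel) (borel \<Otimes>\<^sub>M borel)" by measurable
    from measurable_sets[OF this, of "{z. fst z = snd z}"]
    have "{p. snd p = g (fst p)} \<in> sets (borel :: ('a \<times> (nat \<Rightarrow> real)) measure)"
      by (simp add: borel_prod[symmetric] space_pair_measure vimage_def)
    moreover have "graph_of g = {p. snd p = g (fst p)}" by (auto simp: graph_of_def)
    ultimately show ?thesis by simp
  qed
  then show ?thesis unfolding \<G>(3) using \<G>(1,2) by (intro sets.countable_UN') auto
qed

text \<open>Uniqueness of \<open>y\<close> over \<open>x\<close> makes the projections of the parts
  with \<open>y i < q\<close> and with \<open>q \<le> y i\<close> disjoint. They are analytic, so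
  Borel sets \<open>C i q\<close> separate them, and \<open>y i\<close> is recovered as the supremum
  of the rationals \<open>q\<close> with \<open>x\<close> outside \<open>C i q\<close>.\<close>

lemma analytic_uniform:
  fixes A :: "('x::{complete_space,second_countable_topology} \<times> (nat \<Rightarrow> real)) set"
  assumes A: "analytic A" and u: "\<And>x y y'. (x, y) \<in> A \<Longrightarrow> (x, y') \<in> A \<Longrightarrow> y = y'"
  shows "\<exists>S. borel_graphs S \<and> A \<subseteq> S"
proof -
  have fst: "continuous_on UNIV (fst :: 'x \<times> (nat \<Rightarrow> real) \<Rightarrow> 'x)" by (intro continuous_intros)
  have ci: "continuous_on UNIV (\<lambda>p :: 'x \<times> (nat \<Rightarrow> real). snd p i)" for i
    by (rule continuous_on_product_then_coordinatewise) (intro continuous_intros)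
  have "separable (fst ` (A \<inter> {p. snd p i < q})) (fst ` (A \<inter> {p. q \<le> snd p i}))" for i and q :: real
  proof (rule lusin_separation)
    have "open {p :: 'x \<times> (nat \<Rightarrow> real). snd p i < q}" by (intro open_Collect_less ci continuous_intros)
    then show "analytic (fst ` (A \<inter> {p. snd p i < q}))"
      by (intro analytic_image analytic_Int A analytic_open fst)
    have "closed {p :: 'x \<times> (nat \<Rightarrow> real). q \<le> snd p i}" by (intro closed_Collect_le ci continuous_intros)
    then show "analytic (fst ` (A \<inter> {p. q \<le> snd p i}))"
      by (intro analytic_image analytic_Int_closed A fst)
    show "fst ` (A \<inter> {p. snd p i < q}) \<inter> fst ` (A \<inter> {p. q \<le> snd p i}) = {}"
      using u by fastforce
  qed
  then have "\<forall>i q. \<exists>C\<in>sets borel. fst ` (A \<inter> {p. snd p i < q}) \<subseteq> C \<and> fst ` (A \<inter> {p. q \<le> snd p i}) \<inter> C = {}"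
    unfolding separable_def by blast
  then obtain C where C: "\<And>i q. C i q \<in> sets borel" "\<And>i q. fst ` (A \<inter> {p. snd p i < q}) \<subseteq> C i q"
    "\<And>i q. fst ` (A \<inter> {p. q \<le> snd p i}) \<inter> C i q = {}" by metis
  \<comment> \<open>The value \<open>-\<infinity>\<close> drops \<open>q\<close> from the supremum.
    Away from the projection of \<open>A\<close> the values of \<open>g\<close> are arbitrary, and
    infinite suprema become 0.\<close>
  define g where "g x i = real_of_ereal (SUP q\<in>\<rat>. if x \<in> C i q then -\<infinity> else ereal q)" for x i
  have "g \<in> borel_measurable borel"
  proof (rule measurable_coordinatewise_then_product)
    fix i
    have [measurable]: "C i q \<in> sets borel" for q by (rule C(1))
    show "(\<lambda>x. g x i) \<in> borel_measurable borel" unfolding g_def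
      by (intro borel_measurable_real_of_ereal borel_measurable_SUP countable_rat) measurable
  qed
  moreover have "A \<subseteq> graph_of g"
  proof
    fix p assume "p \<in> A"
    then obtain x y where p: "p = (x, y)" "(x, y) \<in> A" by (cases p) auto
    have "g x i = y i" for i
    proof -
      have c: "x \<in> C i q \<longleftrightarrow> y i < q" for q :: real
      proof
        assume "x \<in> C i q"
        then show "y i < q" using C(3)[of q i] p(2) by force
      next
        assume "y i < q"
        then show "x \<in> C i q" using C(2)[of i q] p(2) by force
      qed
      have "(SUP q\<in>\<rat>. if x \<in> C i q then -\<infinity> else ereal q) = ereal (y i)"
      proof (rule antisym)
        show "(SUP q\<in>\<rat>. if x \<in> C i q then -\<infinity> else ereal q) \<le> ereal (y i)"
          by (rule SUP_least) (auto simp: c)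
        show "ereal (y i) \<le> (SUP q\<in>\<rat>. if x \<in> C i q then -\<infinity> else ereal q)"
        proof (rule ccontr)
          assume "\<not> ?thesis"
          then have "(SUP q\<in>\<rat>. if x \<in> C i q then -\<infinity> else ereal q) < ereal (y i)" by simp
          from ereal_dense2[OF this]
          obtain z where z: "(SUP q\<in>\<rat>. if x \<in> C i q then -\<infinity> else ereal q) < ereal z" "z < y i"
            by auto
          obtain q :: real where q: "q \<in> \<rat>" "z < q" "q < y i" using Rats_dense_in_real[OF z(2)] by blast
          have "ereal q \<le> (SUP q\<in>\<rat>. if x \<in> C i q then -\<infinity> else ereal q)"
            using q(1,3) c[of q] by (intro SUP_upper2[of q]) auto
          with z(1) have "ereal q < ereal z" by (rule le_less_trans[rotated])
          then show False using q(2) by simp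
        qed
      qed
      then show ?thesis by (simp add: g_def)
    qed
    then have "y = g x" by (intro ext) simp
    then show "p \<in> graph_of g" by (simp add: graph_of_def p)
  qed
  ultimately show ?thesis unfolding borel_graphs_def
    by (intro exI[of _ "graph_of g"] conjI exI[of _ "{g}"]) auto
qed

text \<open>If no countable union of Borel graphs covered the set, a Cantor scheme of pieces with
  pairwise disjoint second coordinates over a common \<open>x\<close> would produce an uncountable section.\<close>

theorem lusin_novikov:
  fixes P :: "('x::{complete_space,second_countable_topology} \<times> (nat \<Rightarrow> real)) set"
  assumes P: "analytic P" and c: "\<And>x. countable {y. (x, y) \<in> P}"
  shows "\<exists>S. borel_graphs S \<and> P \<subseteq> S"
proof (rule ccontr)
  assume big: "\<not> ?thesis"
  obtain F f where F: "presents F f" "P = f ` F" using P unfolding analytic_def by blast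
  define piece where "piece s = f ` (F \<inter> cyl s)" for s
  \<comment> \<open>All pieces must keep a point outside \<open>S\<close> over one common
    \<open>x\<close>. Asking this of each piece separately would not hold the Cantor scheme inside a
    single vertical section.\<close>
  define NS where "NS N \<longleftrightarrow> (\<forall>S. borel_graphs S \<longrightarrow> (\<exists>x. \<forall>s\<in>N. \<exists>y. (x, y) \<in> piece s - S))" for N
  define ysep where "ysep s t \<longleftrightarrow> (\<forall>p\<in>piece s. \<forall>q\<in>piece t. snd p \<noteq> snd q)" for s t
  define ext where "ext s t \<longleftrightarrow> (\<exists>u. u \<noteq> [] \<and> t = s @ u)" for s t :: "nat list"
  \<comment> \<open>If no separated pair of extensions works, each pair has an exceptional set;
    there are countably many pairs, so the union \<open>T\<close> is still a union of Borel graphs.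
    Outside \<open>T\<close>, over those \<open>x\<close> at which the pieces of \<open>N\<close>
    survive, \<open>piece s\<close> has at most one point, as two points would lie in separated
    extensions. \<open>analytic_uniform\<close> covers this remainder, and the enlarged set
    contradicts the largeness of \<open>insert s N\<close>.\<close>
  have split: "\<exists>s0 s1. ext s s0 \<and> ext s s1 \<and> ysep s0 s1 \<and> NS (insert s0 (insert s1 N))"
    if N: "finite N" "NS (insert s N)" for s N
  proof (rule ccontr)
    assume no: "\<not> ?thesis"
    define I where "I = {(s0, s1). ext s s0 \<and> ext s s1 \<and> ysep s0 s1}"
    have "\<forall>i\<in>I. \<exists>S. borel_graphs S \<and> \<not> (\<exists>x. \<forall>t\<in>insert (fst i) (insert (snd i) N). \<exists>y. (x, y) \<in> piece t - S)"
      using no unfolding I_def NS_def by auto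
    then obtain S where S: "\<And>i. i \<in> I \<Longrightarrow> borel_graphs (S i)"
      "\<And>i. i \<in> I \<Longrightarrow> \<not> (\<exists>x. \<forall>t\<in>insert (fst i) (insert (snd i) N). \<exists>y. (x, y) \<in> piece t - S i)" by metis
    define T where "T = (\<Union>i\<in>I. S i)"
    have T: "borel_graphs T" unfolding T_def by (rule borel_graphs_UN) (auto simp: S(1))
    have an: "analytic (piece t - T)" for t
    proof -
      have "- T \<in> sets borel" using borel_graphs_sets[OF T] by (simp add: sets.compl_sets[of _ borel, simplified] Compl_eq_Diff_UNIV)
      then show ?thesis unfolding piece_def Diff_eq
        by (intro analytic_Int analytic_borel analytic_presents_cyl F)
    qed
    have an': "analytic ((piece s - T) \<inter> {p. \<forall>t\<in>N. fst p \<in> fst ` (piece t - T)})" using N(1)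
    proof induction
      case empty
      then show ?case using an by simp
    next
      case (insert t N)
      have "(piece s - T) \<inter> {p. \<forall>t\<in>insert t N. fst p \<in> fst ` (piece t - T)} =
        ((piece s - T) \<inter> {p. \<forall>t\<in>N. fst p \<in> fst ` (piece t - T)}) \<inter> fst -` (fst ` (piece t - T))" by auto
      then show ?case using insert.IH an
        by (auto intro!: analytic_Int_vimage analytic_image continuous_intros)
    qed
    have un: "y = y'" if xy: "(x, y) \<in> (piece s - T) \<inter> {p. \<forall>t\<in>N. fst p \<in> fst ` (piece t - T)}"
      "(x, y') \<in> (piece s - T) \<inter> {p. \<forall>t\<in>N. fst p \<in> fst ` (piece t - T)}" for x y y'
    proof (rule ccontr)
      assume "y \<noteq> y'"
      then obtain U V where UV: "open U" "open V" "y \<in> U" "y' \<in> V" "U \<inter> V = {}" using hausdorff by metis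
      have o: "open (UNIV \<times> U)" "open (UNIV \<times> V)" using UV by (auto intro: open_Times)
      obtain \<rho> where \<rho>: "\<rho> \<in> F" "\<rho> \<in> cyl s" "f \<rho> = (x, y)" using xy(1) unfolding piece_def by auto
      obtain \<rho>' where \<rho>': "\<rho>' \<in> F" "\<rho>' \<in> cyl s" "f \<rho>' = (x, y')" using xy(2) unfolding piece_def by auto
      obtain N1 where N1: "\<And>n. n \<ge> N1 \<Longrightarrow> f ` (F \<inter> cyl (map \<rho> [0..<n])) \<subseteq> UNIV \<times> U"
        using presents_nhds[OF F(1) \<rho>(1) o(1)] \<rho>(3) UV by auto
      obtain N2 where N2: "\<And>n. n \<ge> N2 \<Longrightarrow> f ` (F \<inter> cyl (map \<rho>' [0..<n])) \<subseteq> UNIV \<times> V"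
        using presents_nhds[OF F(1) \<rho>'(1) o(2)] \<rho>'(3) UV by auto
      define n where "n = Suc (length s) + N1 + N2"
      define s0 s1 where "s0 = map \<rho> [0..<n]" and "s1 = map \<rho>' [0..<n]"
      have e: "ext s (map \<sigma> [0..<n])" if "\<sigma> \<in> cyl s" for \<sigma>
      proof -
        have "[0..<n] = [0..<length s] @ [length s..<n]"
          using upt_add_eq_append[of 0 "length s" "n - length s"] by (simp add: n_def add.assoc)
        then show ?thesis unfolding ext_def using that
          by (intro exI[of _ "map \<sigma> [length s..<n]"]) (auto simp: cyl_def n_def)
      qed
      have sub: "piece s0 \<subseteq> UNIV \<times> U" "piece s1 \<subseteq> UNIV \<times> V"
        unfolding piece_def s0_def s1_def by (rule N1 N2; simp add: n_def)+
      then have "ysep s0 s1" unfolding ysep_def using UV(5) by fastforce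
      then have i: "(s0, s1) \<in> I" unfolding I_def using e[OF \<rho>(2)] e[OF \<rho>'(2)] by (auto simp: s0_def s1_def)
      have "S (s0, s1) \<subseteq> T" unfolding T_def using i by blast
      moreover have "(x, y) \<in> piece s0" "(x, y') \<in> piece s1"
        unfolding piece_def s0_def s1_def using \<rho> \<rho>' cyl_prefix by (metis IntI imageI)+
      ultimately have "\<forall>t\<in>insert s0 (insert s1 N). \<exists>y. (x, y) \<in> piece t - S (s0, s1)" using xy by fastforce
      then show False using S(2)[OF i] unfolding fst_conv snd_conv by blast
    qed
    have "\<exists>S'. borel_graphs S' \<and> (piece s - T) \<inter> {p. \<forall>t\<in>N. fst p \<in> fst ` (piece t - T)} \<subseteq> S'"
      by (rule analytic_uniform[OF an']) (rule un)
    then obtain S' where S': "borel_graphs S'"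
      "(piece s - T) \<inter> {p. \<forall>t\<in>N. fst p \<in> fst ` (piece t - T)} \<subseteq> S'" by (elim exE conjE)
    obtain x where x: "\<And>t. t \<in> insert s N \<Longrightarrow> \<exists>y. (x, y) \<in> piece t - (T \<union> S')"
      using N(2) borel_graphs_Un[OF T S'(1)] unfolding NS_def by meson
    obtain y where y: "(x, y) \<in> piece s - (T \<union> S')" using x by blast
    have "fst (x, y) \<in> fst ` (piece t - T)" if "t \<in> N" for t using x[of t] that by force
    then have "(x, y) \<in> S'" using S'(2) y by blast
    then show False using y by blast
  qed
  \<comment> \<open>The nodes of a level are split one after the other; \<open>N'\<close> collects
    the descendants of nodes already split.\<close>
  have split_all: "\<exists>e. (\<forall>s\<in>N. ext s (e True s) \<and> ext s (e False s) \<and> ysep (e True s) (e False s)) \<and>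
      NS (N' \<union> e True ` N \<union> e False ` N)" if "finite N" "finite N'" "NS (N' \<union> N)" for N N'
    using that
  proof (induction N arbitrary: N')
    case empty
    then show ?case by simp
  next
    case (insert s N)
    obtain s0 s1 where s: "ext s s0" "ext s s1" "ysep s0 s1" "NS (insert s0 (insert s1 (N' \<union> N)))"
      using split[of "N' \<union> N" s] insert.prems insert.hyps by auto
    then have "NS ((insert s0 (insert s1 N')) \<union> N)" by (simp add: Un_commute)
    from insert.IH[OF _ this] insert.prems obtain e where
      e: "\<forall>s\<in>N. ext s (e True s) \<and> ext s (e False s) \<and> ysep (e True s) (e False s)"
      "NS ((insert s0 (insert s1 N')) \<union> e True ` N \<union> e False ` N)" by auto
    define e' where "e' b = (e b)(s := if b then s0 else s1)" for b
    have im: "e' b ` N = e b ` N" for b using insert.hyps(2) by (auto simp: e'_def)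
    have hd: "e' True s = s0" "e' False s = s1" by (auto simp: e'_def)
    have "N' \<union> e' True ` insert s N \<union> e' False ` insert s N = (insert s0 (insert s1 N')) \<union> e True ` N \<union> e False ` N"
      unfolding image_insert im hd by blast
    moreover have "\<forall>s\<in>insert s N. ext s (e' True s) \<and> ext s (e' False s) \<and> ysep (e' True s) (e' False s)"
      using e(1) s by (auto simp: e'_def)
    ultimately show ?case using e(2) by metis
  qed
  let ?Q = "\<lambda>N N' e. (\<forall>s\<in>N. ext s (e True s) \<and> ext s (e False s) \<and> ysep (e True s) (e False s)) \<and>
      N' = e True ` N \<union> e False ` N"
  have "\<exists>NN. \<forall>n. ((finite (NN n) \<and> NS (NN n)) \<and> (n = 0 \<longrightarrow> NN n = {[]})) \<and> (\<exists>e. ?Q (NN n) (NN (Suc n)) e)"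
  proof (rule dependent_nat_choice)
    have "NS {[]}" unfolding NS_def
    proof (intro allI impI)
      fix S :: "('x \<times> (nat \<Rightarrow> real)) set" assume "borel_graphs S"
      then have "\<not> P \<subseteq> S" using big by blast
      then show "\<exists>x. \<forall>s\<in>{[]}. \<exists>y. (x, y) \<in> piece s - S" unfolding piece_def F(2) by auto
    qed
    then show "\<exists>N. (finite N \<and> NS N) \<and> ((0::nat) = 0 \<longrightarrow> N = {[]})" by blast
  next
    fix N and n :: nat assume N: "(finite N \<and> NS N) \<and> (n = 0 \<longrightarrow> N = {[]})"
    then obtain e where "\<forall>s\<in>N. ext s (e True s) \<and> ext s (e False s) \<and> ysep (e True s) (e False s)"
      "NS (e True ` N \<union> e False ` N)" using split_all[of N "{}"] by auto
    then show "\<exists>N'. ((finite N' \<and> NS N') \<and> (Suc n = 0 \<longrightarrow> N' = {[]})) \<and> (\<exists>e. ?Q N N' e)"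
      using N by (intro exI[of _ "e True ` N \<union> e False ` N"] conjI exI[of _ e]) auto
  qed
  then obtain NN where NN: "\<forall>n. ((finite (NN n) \<and> NS (NN n)) \<and> (n = 0 \<longrightarrow> NN n = {[]})) \<and> (\<exists>e. ?Q (NN n) (NN (Suc n)) e)"
    by (elim exE)
  then have "\<forall>n. \<exists>e. ?Q (NN n) (NN (Suc n)) e" by (intro allI) (drule spec, erule conjunct2)
  then obtain e where "\<forall>n. ?Q (NN n) (NN (Suc n)) (e n)" by (drule_tac choice) (elim exE)
  then have Q: "?Q (NN n) (NN (Suc n)) (e n)" for n by (rule spec)
  have e: "ext s (e n b s)" "ysep (e n True s) (e n False s)" "e n b s \<in> NN (Suc n)" if "s \<in> NN n" for n s b
    using Q[of n] that by (cases b; simp)+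
  have NS: "NS (NN n)" for n using NN by blast
  have NN0: "NN 0 = {[]}" using NN by blast
  define node where "node \<beta> n = rec_nat [] (\<lambda>n s. e n (\<beta> n) s) n" for \<beta> :: "nat \<Rightarrow> bool" and n
  have node_Suc: "node \<beta> (Suc n) = e n (\<beta> n) (node \<beta> n)" "node \<beta> 0 = []" for \<beta> n by (auto simp: node_def)
  have nodeN: "node \<beta> n \<in> NN n" for \<beta> n by (induction n) (auto simp: node_Suc NN0 e(3))
  have ext_node: "\<exists>u. u \<noteq> [] \<and> node \<beta> (Suc n) = node \<beta> n @ u" for \<beta> n
    using e(1)[OF nodeN] unfolding ext_def node_Suc by blast
  have "\<exists>x. \<forall>s\<in>NN n. \<exists>y. (x, y) \<in> piece s" for n
    using NS[of n] borel_graphs_empty unfolding NS_def by fastforce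
  then obtain x where x: "\<And>n s. s \<in> NN n \<Longrightarrow> \<exists>y. (x n, y) \<in> piece s" by metis
  \<comment> \<open>The nodes along a branch grow strictly and hence determine a limit
    \<open>\<sigma>\<close>. Codes of points of the pieces over \<open>x n\<close> converge to it,
    so closedness of \<open>F\<close> and continuity of \<open>f\<close> apply.\<close>
  have lim: "\<exists>\<sigma>. \<sigma> \<in> F \<and> (\<forall>n. \<sigma> \<in> cyl (node \<beta> n)) \<and> x \<longlonglongrightarrow> fst (f \<sigma>)" for \<beta>
  proof -
    have len: "length (node \<beta> n) < length (node \<beta> (Suc n))" for n
      using ext_node[of \<beta> n] by auto
    then have sm: "strict_mono (\<lambda>n. length (node \<beta> n))" by (simp add: strict_mono_Suc_iff)
    then have ge: "n \<le> length (node \<beta> n)" for n using seq_suble by blast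
    have pre: "\<exists>u. node \<beta> m = node \<beta> n @ u" if "n \<le> m" for n m
      using that by (induction m rule: dec_induct) (use ext_node in \<open>auto, metis append.assoc\<close>)
    define \<sigma> where "\<sigma> i = node \<beta> (Suc i) ! i" for i
    have nth: "node \<beta> n ! i = \<sigma> i" if "i < length (node \<beta> n)" for n i
    proof (cases "n \<le> Suc i")
      case True
      then obtain u where "node \<beta> (Suc i) = node \<beta> n @ u" using pre by blast
      then show ?thesis using that by (simp add: \<sigma>_def nth_append)
    next
      case False
      then obtain u where "node \<beta> n = node \<beta> (Suc i) @ u" using pre[of "Suc i" n] by auto
      moreover have "i < length (node \<beta> (Suc i))" using ge[of "Suc i"] by linarith
      ultimately show ?thesis by (simp add: \<sigma>_def nth_append)
    qed
    then have cyl: "map \<sigma> [0..<length (node \<beta> n)] = node \<beta> n" for n by (intro nth_equalityI) auto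
    have "\<exists>\<rho>. \<rho> \<in> F \<inter> cyl (node \<beta> n) \<and> fst (f \<rho>) = x n" for n
      using x[OF nodeN[of \<beta> n]] unfolding piece_def by (metis fst_conv imageE)
    then obtain \<rho> where \<rho>: "\<And>n. \<rho> n \<in> F \<inter> cyl (node \<beta> n)" "\<And>n. fst (f (\<rho> n)) = x n" by metis
    have cv: "pointwise_conv \<rho> \<sigma>" by (rule pointwise_conv_cyl[OF _ sm]) (use \<rho>(1) cyl in auto)
    have "\<sigma> \<in> F" "(\<lambda>n. f (\<rho> n)) \<longlonglongrightarrow> f \<sigma>" using presentsD[OF F(1) _ cv] \<rho>(1) by auto
    moreover have "\<sigma> \<in> cyl (node \<beta> n)" for n using cyl by (simp add: cyl_def)
    ultimately show ?thesis using \<rho>(2) tendsto_fst[of "\<lambda>n. f (\<rho> n)" "f \<sigma>" sequentially] by (intro exI[of _ \<sigma>]) auto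
  qed
  then obtain \<sigma> where \<sigma>: "\<And>\<beta>. \<sigma> \<beta> \<in> F" "\<And>\<beta> n. \<sigma> \<beta> \<in> cyl (node \<beta> n)" "\<And>\<beta>. x \<longlonglongrightarrow> fst (f (\<sigma> \<beta>))" by metis
  \<comment> \<open>The points \<open>x n\<close> depend on the level only, so all branches have the
    same limit in the first coordinate.\<close>
  define x0 where "x0 = fst (f (\<sigma> (\<lambda>_. True)))"
  have x0: "fst (f (\<sigma> \<beta>)) = x0" for \<beta> unfolding x0_def using \<sigma>(3) LIMSEQ_unique by blast
  have inP: "f (\<sigma> \<beta>) \<in> piece (node \<beta> n)" for \<beta> n unfolding piece_def using \<sigma>(1,2) by blast
  have "inj (\<lambda>\<beta>. snd (f (\<sigma> \<beta>)))"
  proof (rule injI, rule ccontr)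
    fix \<beta> \<beta>' assume eq: "snd (f (\<sigma> \<beta>)) = snd (f (\<sigma> \<beta>'))" and ne: "\<beta> \<noteq> \<beta>'"
    then have ex: "\<exists>n. \<beta> n \<noteq> \<beta>' n" by auto
    define n where "n = (LEAST n. \<beta> n \<noteq> \<beta>' n)"
    have n: "\<beta> n \<noteq> \<beta>' n" unfolding n_def using LeastI_ex[OF ex] .
    have "\<beta> i = \<beta>' i" if "i < n" for i using not_less_Least that unfolding n_def by blast
    then have same: "node \<beta> i = node \<beta>' i" if "i \<le> n" for i using that by (induction i) (auto simp: node_Suc)
    have "ysep (e n True (node \<beta> n)) (e n False (node \<beta> n))" using e(2)[OF nodeN] .
    moreover have "f (\<sigma> \<beta>) \<in> piece (e n (\<beta> n) (node \<beta> n))" "f (\<sigma> \<beta>') \<in> piece (e n (\<beta>' n) (node \<beta> n))"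
      using inP[of \<beta> "Suc n"] inP[of \<beta>' "Suc n"] same[of n] by (auto simp: node_Suc)
    ultimately show False using eq n unfolding ysep_def by (metis (full_types))
  qed
  moreover have "range (\<lambda>\<beta>. snd (f (\<sigma> \<beta>))) \<subseteq> {y. (x0, y) \<in> P}"
    using \<sigma>(1) x0 unfolding F(2) by (metis (mono_tags, lifting) image_eqI image_subsetI mem_Collect_eq prod.collapse)
  ultimately have "countable (UNIV :: (nat \<Rightarrow> bool) set)"
    using c countable_subset countable_image_inj_eq by metis
  then obtain h :: "nat \<Rightarrow> (nat \<Rightarrow> bool)" where h: "range h = UNIV" using range_from_nat_into[of UNIV] by auto
  then obtain n where "h n = (\<lambda>k. \<not> h k k)" by (metis rangeE UNIV_I)
  then show False by (metis)
qed

section \<open>Standard Borel spaces and the Feldman-Moore theorem\<close>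

text \<open>The code of a point consists of its distances to a dense sequence. By completeness, the
  codes are exactly the sequences that can be approximated uniformly by the codes of dense points.
  This is a countable condition, so the set \<open>Z\<close> of codes is Borel, and decoding is
  measurable.\<close>

lemma standard_borel_coding:
  fixes M :: "'a measure"
  assumes "standard_borel M" "space M \<noteq> {}"
  shows "\<exists>(\<iota> :: 'a \<Rightarrow> nat \<Rightarrow> real) r. \<iota> \<in> borel_measurable M \<and> r \<in> measurable borel M \<and> (\<forall>x\<in>space M. r (\<iota> x) = x)"
proof -
  obtain T where T: "completely_metrizable_space T" "second_countable T" "topspace T = space M"
    "sets M = sigma_sets (topspace T) {U. openin T U}"
    using assms(1) unfolding standard_borel_def by blast
  obtain X d where X: "Metric_space X d" "Metric_space.mcomplete X d" "T = Metric_space.mtopology X d"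
    using T(1) unfolding completely_metrizable_space_def by blast
  interpret Metric_space X d by fact
  have X_eq: "X = space M" using T(3) X(3) by simp
  obtain \<B> where \<B>: "countable \<B>" "\<And>V. V \<in> \<B> \<Longrightarrow> openin T V"
    "\<And>U x. openin T U \<Longrightarrow> x \<in> U \<Longrightarrow> \<exists>V\<in>\<B>. x \<in> V \<and> V \<subseteq> U"
    using T(2) unfolding second_countable_def by metis
  define Q where "Q = (\<lambda>V. SOME x. x \<in> V) ` (\<B> - {{}})"
  have Q: "Q \<subseteq> X"
  proof
    fix x assume "x \<in> Q"
    then obtain V where V: "V \<in> \<B>" "V \<noteq> {}" "x = (SOME x. x \<in> V)" unfolding Q_def by blast
    then have "x \<in> V" by (simp add: some_in_eq)
    then show "x \<in> X" using \<B>(2)[OF V(1)] openin_subset T(3) X_eq by blast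
  qed
  have dense: "\<exists>y\<in>Q. d x y < e" if "x \<in> X" "e > 0" for x e
  proof -
    have "openin T (mball x e)" unfolding X(3) by simp
    moreover have "x \<in> mball x e" using that by simp
    ultimately obtain V where V: "V \<in> \<B>" "x \<in> V" "V \<subseteq> mball x e" using \<B>(3) by blast
    have "(SOME x. x \<in> V) \<in> V" using V(2) by (metis someI)
    then have "(SOME x. x \<in> V) \<in> mball x e" using V(3) by blast
    then show ?thesis using V unfolding Q_def by (intro bexI[of _ "SOME x. x \<in> V"]) auto
  qed
  obtain x0 where x0: "x0 \<in> X" using assms(2) X_eq by blast
  have "Q \<noteq> {}" "countable Q" using dense[OF x0, of 1] \<B>(1) by (auto simp: Q_def)
  define q where "q = from_nat_into Q"
  have qX: "q i \<in> X" for i using from_nat_into[OF \<open>Q \<noteq> {}\<close>] Q unfolding q_def by blast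
  have q: "\<exists>i. d x (q i) < e" if "x \<in> X" "e > 0" for x e
    using dense[OF that] from_nat_into_surj[OF \<open>countable Q\<close>] unfolding q_def by metis
  have arch: "\<exists>k. 1 / real (Suc k) < e" if "e > 0" for e
    using reals_Archimedean[OF that] by (simp add: inverse_eq_divide)
  define \<iota> where "\<iota> x i = d x (q i)" for x i
  have tri: "\<bar>d x z - d y z\<bar> \<le> d x y" if "x \<in> X" "y \<in> X" "z \<in> X" for x y z
    using triangle[OF that] triangle[OF that(2,1,3)] commute[of x y] by linarith
  have inj: "x = y" if xy: "x \<in> X" "y \<in> X" "\<iota> x = \<iota> y" for x y
  proof (rule ccontr)
    assume "x \<noteq> y"
    then have "d x y > 0" using xy mdist_pos_less by simp
    then obtain i where "d x (q i) < d x y / 2" using q[OF xy(1), of "d x y / 2"] by auto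
    moreover have "d x (q i) = d y (q i)" using fun_cong[OF xy(3), of i] by (simp add: \<iota>_def)
    ultimately show False using triangle[OF xy(1) qX xy(2), of i] commute[of "q i" y] by linarith
  qed
  have "\<iota> \<in> borel_measurable M"
  proof (rule measurable_coordinatewise_then_product)
    fix i
    have "{x \<in> space M. \<iota> x i < e} \<in> sets M" for e
    proof -
      have "{x \<in> space M. \<iota> x i < e} = mball (q i) e" using qX by (auto simp: \<iota>_def X_eq[symmetric] commute)
      moreover have "openin T (mball (q i) e)" unfolding X(3) by simp
      ultimately show ?thesis unfolding T(4) by (auto intro: sigma_sets.Basic)
    qed
    then show "(\<lambda>x. \<iota> x i) \<in> borel_measurable M" by (simp add: borel_measurable_iff_less)
  qed
  define Z where "Z = {c :: nat \<Rightarrow> real. \<forall>m. \<exists>j. \<forall>i. \<bar>c i - d (q j) (q i)\<bar> \<le> 1 / real (Suc m)}"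
  have Z[measurable]: "Z \<in> sets borel"
  proof -
    have [measurable]: "(\<lambda>c :: nat \<Rightarrow> real. c i) \<in> borel_measurable borel" for i
      by (intro borel_measurable_continuous_onI continuous_on_product_coordinates)
    have "Z = {c \<in> space borel. \<forall>m. \<exists>j. \<forall>i. \<bar>c i - d (q j) (q i)\<bar> \<le> 1 / real (Suc m)}"
      by (simp add: Z_def)
    also have "\<dots> \<in> sets borel" by measurable
    finally show ?thesis .
  qed
  have \<iota>Z: "\<iota> x \<in> Z" if xX: "x \<in> X" for x
    unfolding Z_def
  proof (intro CollectI allI)
    fix m
    obtain j where "d x (q j) < 1 / real (Suc m)" using q[OF xX, of "1 / real (Suc m)"] by auto
    then show "\<exists>j. \<forall>i. \<bar>\<iota> x i - d (q j) (q i)\<bar> \<le> 1 / real (Suc m)"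
      using tri[OF xX qX qX] unfolding \<iota>_def by (meson less_imp_le order_trans)
  qed
  have Z\<iota>: "\<exists>x\<in>X. \<iota> x = c" if cZ: "c \<in> Z" for c
  proof -
    obtain j where j: "\<And>m i. \<bar>c i - d (q (j m)) (q i)\<bar> \<le> 1 / real (Suc m)"
      using cZ unfolding Z_def mem_Collect_eq by metis
    define \<sigma> where "\<sigma> m = q (j m)" for m
    have \<sigma>X: "\<sigma> m \<in> X" for m by (simp add: \<sigma>_def qX)
    \<comment> \<open>At coordinate \<open>j l\<close> the code of \<open>q (j l)\<close> vanishes,
      so the two approximations of \<open>c (j l)\<close> compare the points
      \<open>\<sigma> m\<close> and \<open>\<sigma> l\<close>.\<close>
    have dd: "d (\<sigma> m) (\<sigma> l) \<le> 1 / real (Suc m) + 1 / real (Suc l)" for m l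
    proof -
      have "\<bar>c (j l) - d (\<sigma> m) (\<sigma> l)\<bar> \<le> 1 / real (Suc m)" using j[of "j l" m] by (simp add: \<sigma>_def)
      moreover have "\<bar>c (j l)\<bar> \<le> 1 / real (Suc l)" using j[of "j l" l] qX by simp
      ultimately show ?thesis by linarith
    qed
    have "MCauchy \<sigma>" unfolding MCauchy_def
    proof (intro conjI allI impI)
      show "range \<sigma> \<subseteq> X" using \<sigma>X by blast
      fix e :: real assume "e > 0"
      then obtain N where N: "1 / real (Suc N) < e / 2" using arch[of "e/2"] by auto
      have "d (\<sigma> n) (\<sigma> n') < e" if "N \<le> n" "N \<le> n'" for n n'
      proof -
        have "1 / real (Suc n) \<le> 1 / real (Suc N)" "1 / real (Suc n') \<le> 1 / real (Suc N)"
          using that by (auto intro!: divide_left_mono)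
        then show ?thesis using dd[of n n'] N by linarith
      qed
      then show "\<exists>N. \<forall>n n'. N \<le> n \<longrightarrow> N \<le> n' \<longrightarrow> d (\<sigma> n) (\<sigma> n') < e" by blast
    qed
    then obtain x where x: "limitin mtopology \<sigma> x sequentially" using X(2) unfolding mcomplete_def by blast
    then have xX: "x \<in> X" and xl: "\<And>e. e > 0 \<Longrightarrow> \<forall>\<^sub>F n in sequentially. \<sigma> n \<in> X \<and> d (\<sigma> n) x < e"
      by (auto simp: limitin_metric)
    have "\<iota> x i = c i" for i
    proof (rule ccontr)
      assume "\<iota> x i \<noteq> c i"
      define e where "e = \<bar>\<iota> x i - c i\<bar> / 2"
      have "e > 0" using \<open>\<iota> x i \<noteq> c i\<close> by (simp add: e_def)
      obtain N where N: "1 / real (Suc N) < e" using arch[OF \<open>e > 0\<close>] by blast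
      obtain n where n: "n \<ge> N" "d (\<sigma> n) x < e"
        using xl[OF \<open>e > 0\<close>] unfolding eventually_sequentially by (meson nat_le_linear)
      have "1 / real (Suc n) \<le> 1 / real (Suc N)" using n(1) by (auto intro!: divide_left_mono)
      moreover have "\<bar>c i - d (\<sigma> n) (q i)\<bar> \<le> 1 / real (Suc n)" using j by (simp add: \<sigma>_def)
      moreover have "\<bar>d (\<sigma> n) (q i) - d x (q i)\<bar> \<le> d (\<sigma> n) x" by (rule tri[OF \<sigma>X xX qX])
      ultimately have "\<bar>\<iota> x i - c i\<bar> < 2 * e" using N n(2) unfolding \<iota>_def by linarith
      then show False by (simp add: e_def)
    qed
    then show ?thesis using xX by blast
  qed
  define r where "r c = (if c \<in> Z then (SOME x. x \<in> X \<and> \<iota> x = c) else x0)" for c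
  have r: "r c \<in> X \<and> \<iota> (r c) = c" if "c \<in> Z" for c
    using someI_ex[of "\<lambda>x. x \<in> X \<and> \<iota> x = c"] Z\<iota>[OF that] that unfolding r_def by auto
  have r\<iota>: "r (\<iota> x) = x" if "x \<in> X" for x using r[OF \<iota>Z[OF that]] inj that by blast
  have "r \<in> measurable borel M"
  proof (rule measurable_sigma_sets[OF T(4)])
    show "{U. openin T U} \<subseteq> Pow (topspace T)" using openin_subset by blast
    show "r \<in> space borel \<rightarrow> topspace T" using r x0 T(3) X_eq by (auto simp: r_def)
    fix U assume "U \<in> {U. openin T U}"
    then have U: "U \<subseteq> X" "\<And>x. x \<in> U \<Longrightarrow> \<exists>e>0. mball x e \<subseteq> U" unfolding X(3) by (auto simp: openin_mtopology)
    \<comment> \<open>For a code, \<open>c i\<close> is the distance of the decoded point from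
      \<open>q i\<close>; membership in the open set is thus tested by countably many balls.\<close>
    define P where "P = {c \<in> space borel. c \<in> Z \<and> (\<exists>i k. mball (q i) (1 / real (Suc k)) \<subseteq> U \<and> c i < 1 / real (Suc k))}"
    have [measurable]: "(\<lambda>c :: nat \<Rightarrow> real. c i) \<in> borel_measurable borel" for i
      by (intro borel_measurable_continuous_onI continuous_on_product_coordinates)
    have P: "P \<in> sets borel" unfolding P_def by measurable
    have "r c \<in> U \<longleftrightarrow> c \<in> P" if cZ: "c \<in> Z" for c
    proof -
      have x: "r c \<in> X" "\<And>i. d (r c) (q i) = c i" using r[OF cZ] unfolding \<iota>_def by (auto dest: fun_cong)
      show ?thesis
      proof
        assume "r c \<in> U"
        then obtain e where e: "e > 0" "mball (r c) e \<subseteq> U" using U(2) by blast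
        obtain k where k: "1 / real (Suc k) < e / 2" using arch[of "e/2"] e(1) by auto
        obtain i where i: "d (r c) (q i) < 1 / real (Suc k)" using q[OF x(1), of "1 / real (Suc k)"] by auto
        have "mball (q i) (1 / real (Suc k)) \<subseteq> mball (r c) e"
        proof
          fix y assume "y \<in> mball (q i) (1 / real (Suc k))"
          then have "y \<in> X" "d (q i) y < 1 / real (Suc k)" by auto
          then show "y \<in> mball (r c) e" using triangle[OF x(1) qX \<open>y \<in> X\<close>, of i] i k x(1) by simp
        qed
        then show "c \<in> P" using e(2) i x(2)[of i] cZ unfolding P_def by auto
      next
        assume "c \<in> P"
        then obtain i k where ik: "mball (q i) (1 / real (Suc k)) \<subseteq> U" "c i < 1 / real (Suc k)" unfolding P_def by blast
        then have "r c \<in> mball (q i) (1 / real (Suc k))" using x qX[of i] commute by auto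
        then show "r c \<in> U" using ik(1) by blast
      qed
    qed
    then have "c \<in> r -` U \<inter> space borel \<longleftrightarrow> c \<in> P \<union> (if x0 \<in> U then - Z else {})" for c
      by (cases "c \<in> Z") (simp_all add: r_def P_def)
    then have "r -` U \<inter> space borel = P \<union> (if x0 \<in> U then - Z else {})" by blast
    moreover have "- Z \<in> sets borel" using Z by (simp add: borel_comp)
    ultimately show "r -` U \<inter> space borel \<in> sets borel" using P by simp
  qed
  then show ?thesis using \<open>\<iota> \<in> borel_measurable M\<close> r\<iota> X_eq by blast
qed

text \<open>Rational half-spaces of the coordinates are listed together with their complements, so
  that the separating set can be chosen around the first of the two points.\<close>

lemma standard_borel_separating:
  fixes M :: "'a measure"
  assumes "standard_borel M" "space M \<noteq> {}"
  shows "\<exists>B :: nat \<Rightarrow> 'a set. (\<forall>l. B l \<in> sets M) \<and> (\<forall>x\<in>space M. \<forall>y\<in>space M. x \<noteq> y \<longrightarrow> (\<exists>l. x \<in> B l \<and> y \<notin> B l))"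
proof -
  obtain \<iota> :: "'a \<Rightarrow> nat \<Rightarrow> real" and r where c: "\<iota> \<in> borel_measurable M" "\<And>x. x \<in> space M \<Longrightarrow> r (\<iota> x) = x"
    using standard_borel_coding[OF assms] by blast
  have [measurable]: "(\<lambda>x. \<iota> x i) \<in> borel_measurable M" for i
    by (rule measurable_compose[OF c(1)]) (intro borel_measurable_continuous_onI continuous_on_product_coordinates)
  define S where "S = (\<lambda>(i, q, b). {x \<in> space M. (\<iota> x i < q) = b}) ` (UNIV \<times> \<rat> \<times> (UNIV :: bool set))"
  have "countable S" unfolding S_def by (intro countable_image countable_SIGMA countable_rat) auto
  moreover have "S \<noteq> {}" unfolding S_def using Rats_0 by blast
  ultimately have S: "range (from_nat_into S) = S" by (rule range_from_nat_into[rotated])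
  have "S \<subseteq> sets M" unfolding S_def by auto
  moreover have "\<exists>C\<in>S. x \<in> C \<and> y \<notin> C" if xy: "x \<in> space M" "y \<in> space M" "x \<noteq> y" for x y
  proof -
    have "\<iota> x \<noteq> \<iota> y" using xy c(2) by metis
    then obtain i where i: "\<iota> x i \<noteq> \<iota> y i" by auto
    then have "min (\<iota> x i) (\<iota> y i) < max (\<iota> x i) (\<iota> y i)" by auto
    then obtain q where q: "q \<in> \<rat>" "min (\<iota> x i) (\<iota> y i) < q" "q < max (\<iota> x i) (\<iota> y i)"
      using Rats_dense_in_real by blast
    then have "(\<iota> x i < q) \<noteq> (\<iota> y i < q)" by (auto simp: min_def max_def split: if_splits)
    then show ?thesis using q(1) xy unfolding S_def
      by (intro bexI[of _ "{z \<in> space M. (\<iota> z i < q) = (\<iota> x i < q)}"]) auto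
  qed
  moreover have "(\<exists>C\<in>S. P C) \<longleftrightarrow> (\<exists>l. P (from_nat_into S l))" for P
    by (subst S[symmetric]) simp
  moreover have "from_nat_into S l \<in> S" for l using rangeI[of "from_nat_into S" l] unfolding S .
  ultimately show ?thesis by (intro exI[of _ "from_nat_into S"] conjI allI ballI impI) auto
qed

lemma lusin_novikov_standard:
  fixes M :: "'a measure"
  assumes M: "standard_borel M" "space M \<noteq> {}"
    and E: "E \<in> sets (M \<Otimes>\<^sub>M M)" "\<And>x. x \<in> space M \<Longrightarrow> countable (E `` {x})"
  shows "\<exists>f :: nat \<Rightarrow> 'a \<Rightarrow> 'a. (\<forall>n. f n \<in> measurable M M) \<and> (\<forall>x y. (x, y) \<in> E \<longrightarrow> (\<exists>n. y = f n x))"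
proof -
  obtain \<iota> :: "'a \<Rightarrow> nat \<Rightarrow> real" and r where c[measurable]: "\<iota> \<in> borel_measurable M" "r \<in> measurable borel M"
    and r: "\<And>x. x \<in> space M \<Longrightarrow> r (\<iota> x) = x"
    using standard_borel_coding[OF M] by blast
  \<comment> \<open>Restricted to the fixed points of \<open>\<iota>\<close> after \<open>r\<close>,
    which are the actual codes, \<open>P\<close> is a faithful Borel copy of \<open>E\<close>;
    without this its sections could be uncountable.\<close>
  define P where "P = {p. (r (fst p), r (snd p)) \<in> E \<and> \<iota> (r (fst p)) = fst p \<and> \<iota> (r (snd p)) = snd p}"
  have co: "closed {z :: (nat \<Rightarrow> real) \<times> (nat \<Rightarrow> real). fst z = snd z}"
    by (intro closed_Collect_eq continuous_intros)
  have [measurable]: "{c. \<iota> (r c) = c} \<in> sets borel"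
  proof -
    have "(\<lambda>c. (\<iota> (r c), c)) \<in> measurable borel (borel \<Otimes>\<^sub>M borel)" by measurable
    moreover have "{z :: (nat \<Rightarrow> real) \<times> (nat \<Rightarrow> real). fst z = snd z} \<in> sets (borel \<Otimes>\<^sub>M borel)"
      using co unfolding borel_prod by (rule borel_closed)
    ultimately show ?thesis using measurable_sets[of "\<lambda>c. (\<iota> (r c), c)" borel "borel \<Otimes>\<^sub>M borel" "{z. fst z = snd z}"]
      by (simp add: vimage_def)
  qed
  have "P \<in> sets (borel \<Otimes>\<^sub>M borel)"
  proof -
    have "P = {p \<in> space (borel \<Otimes>\<^sub>M borel). (r (fst p), r (snd p)) \<in> E \<and> fst p \<in> {c. \<iota> (r c) = c} \<and> snd p \<in> {c. \<iota> (r c) = c}}"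
      by (auto simp: P_def space_pair_measure)
    also have "\<dots> \<in> sets (borel \<Otimes>\<^sub>M borel)" using E(1) by measurable
    finally show ?thesis .
  qed
  then have "analytic P" unfolding borel_prod by (rule analytic_borel)
  moreover have "countable {y. (x, y) \<in> P}" for x
  proof -
    have "{y. (x, y) \<in> P} \<subseteq> \<iota> ` (E `` {r x})" unfolding P_def by (auto intro!: image_eqI[of _ \<iota>])
    moreover have "r x \<in> space M" using measurable_space[OF c(2)] by simp
    ultimately show ?thesis using countable_subset countable_image[OF E(2)] by metis
  qed
  ultimately obtain S where S: "borel_graphs S" "P \<subseteq> S" using lusin_novikov by blast
  then obtain \<G> where \<G>: "countable \<G>" "\<G> \<subseteq> borel_measurable borel" "P \<subseteq> (\<Union>g\<in>\<G>. graph_of g)"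
    unfolding borel_graphs_def by blast
  \<comment> \<open>The identity makes the family nonempty, so that \<open>nat\<close> can enumerate
    it.\<close>
  define \<G>' where "\<G>' = insert (\<lambda>x. x) \<G>"
  have rg: "range (from_nat_into \<G>') = \<G>'" using \<G>(1) by (intro range_from_nat_into) (auto simp: \<G>'_def)
  have m: "from_nat_into \<G>' n \<in> borel_measurable borel" for n
  proof -
    have "from_nat_into \<G>' n \<in> \<G>'" using rg by blast
    then show ?thesis using \<G>(2) by (auto simp: \<G>'_def)
  qed
  define f where "f n x = r (from_nat_into \<G>' n (\<iota> x))" for n x
  have "f n \<in> measurable M M" for n unfolding f_def using m[of n] by measurable
  moreover have "\<exists>n. y = f n x" if xy: "(x, y) \<in> E" for x y
  proof -
    have sp: "x \<in> space M" "y \<in> space M" using sets.sets_into_space[OF E(1)] xy by (auto simp: space_pair_measure)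
    then have "(\<iota> x, \<iota> y) \<in> P" using xy r by (auto simp: P_def)
    then obtain g where "g \<in> \<G>'" "\<iota> y = g (\<iota> x)" using \<G>(3) by (auto simp: graph_of_def \<G>'_def)
    then obtain n where "\<iota> y = from_nat_into \<G>' n (\<iota> x)" using rg by (metis imageE)
    then have "y = f n x" using r[OF sp(2)] by (simp add: f_def)
    then show ?thesis by blast
  qed
  ultimately show ?thesis by blast
qed

text \<open>On \<open>A i j l\<close> the map \<open>f i\<close> has the inverse \<open>f j\<close>
  and moves every point out of \<open>B l\<close>. The image \<open>A' i j l\<close> is therefore
  disjoint from it; exchanging the two sets and fixing all other points is an involution within
  \<open>E\<close>. A pair of distinct related points is exchanged for suitable \<open>i\<close>,
  \<open>j\<close> and \<open>l\<close>.\<close>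

lemma feldman_moore:
  fixes M :: "'a measure"
  assumes M: "standard_borel M" "space M \<noteq> {}"
    and E: "E \<in> sets (M \<Otimes>\<^sub>M M)" "\<And>x. x \<in> space M \<Longrightarrow> countable (E `` {x})" "equiv (space M) E"
  shows "\<exists>t :: nat \<Rightarrow> 'a \<Rightarrow> 'a. (\<forall>n. t n \<in> measurable M M) \<and>
    (\<forall>n. \<forall>x\<in>space M. (x, t n x) \<in> E \<and> t n (t n x) = x) \<and> (\<forall>x\<in>space M. E `` {x} = range (\<lambda>n. t n x))"
proof -
  have "\<exists>f :: nat \<Rightarrow> 'a \<Rightarrow> 'a. (\<forall>n. f n \<in> measurable M M) \<and> (\<forall>x y. (x, y) \<in> E \<longrightarrow> (\<exists>n. y = f n x))"
    by (rule lusin_novikov_standard[OF M E(1)]) (rule E(2))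
  then obtain f :: "nat \<Rightarrow> 'a \<Rightarrow> 'a" where ff: "(\<forall>n. f n \<in> measurable M M) \<and> (\<forall>x y. (x, y) \<in> E \<longrightarrow> (\<exists>n. y = f n x))"
    by (elim exE)
  have f[measurable]: "f n \<in> measurable M M" for n using ff by simp
  have fE: "\<exists>n. y = f n x" if "(x, y) \<in> E" for x y using ff that by simp
  obtain B :: "nat \<Rightarrow> 'a set" where B[measurable]: "\<And>l. B l \<in> sets M"
    and sep: "\<And>x y. x \<in> space M \<Longrightarrow> y \<in> space M \<Longrightarrow> x \<noteq> y \<Longrightarrow> \<exists>l. x \<in> B l \<and> y \<notin> B l"
    using standard_borel_separating[OF M] by blast
  have [measurable]: "E \<in> sets (M \<Otimes>\<^sub>M M)" by fact
  have eqm[measurable]: "{x \<in> space M. g x = h x} \<in> sets M"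
    if gh[measurable]: "g \<in> measurable M M" "h \<in> measurable M M" for g h
  proof -
    have "g x = h x \<longleftrightarrow> (\<forall>l. g x \<in> B l \<longrightarrow> h x \<in> B l)" if x: "x \<in> space M" for x
      using sep[of "g x" "h x"] measurable_space[OF gh(1) x] measurable_space[OF gh(2) x] by metis
    then have "{x \<in> space M. g x = h x} = {x \<in> space M. \<forall>l. g x \<in> B l \<longrightarrow> h x \<in> B l}"
      by (intro Collect_cong conj_cong refl)
    also have "\<dots> \<in> sets M" by measurable
    finally show ?thesis .
  qed
  have sp: "x \<in> space M" "y \<in> space M" if "(x, y) \<in> E" for x y
    using sets.sets_into_space[OF E(1)] that by (auto simp: space_pair_measure)
  have fsp: "f n x \<in> space M" if "x \<in> space M" for n x using measurable_space[OF f] that .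
  define A where "A i j l = {x \<in> space M. (x, f i x) \<in> E \<and> f j (f i x) = x \<and> x \<in> B l \<and> f i x \<notin> B l}" for i j l
  have A[measurable]: "A i j l \<in> sets M" for i j l
  proof -
    have "A i j l = {x \<in> space M. (x, f i x) \<in> E} \<inter> {x \<in> space M. f j (f i x) = x} \<inter> {x \<in> space M. x \<in> B l \<and> f i x \<notin> B l}"
      by (auto simp: A_def)
    moreover have "{x \<in> space M. f j (f i x) = x} \<in> sets M" by (rule eqm) measurable
    moreover have "{x \<in> space M. (x, f i x) \<in> E} \<in> sets M" "{x \<in> space M. x \<in> B l \<and> f i x \<notin> B l} \<in> sets M" by measurable
    ultimately show ?thesis by (simp only: sets.Int)
  qed
  define A' where "A' i j l = {y \<in> space M. f j y \<in> A i j l \<and> f i (f j y) = y}" for i j l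
  have A'[measurable]: "A' i j l \<in> sets M" for i j l
  proof -
    have "A' i j l = {y \<in> space M. f j y \<in> A i j l} \<inter> {y \<in> space M. f i (f j y) = y}" by (auto simp: A'_def)
    moreover have "{y \<in> space M. f i (f j y) = y} \<in> sets M" by (rule eqm) measurable
    moreover have "{y \<in> space M. f j y \<in> A i j l} \<in> sets M" by measurable
    ultimately show ?thesis by (simp only: sets.Int)
  qed
  define t where "t = (\<lambda>(i, j, l) x. if x \<in> A i j l then f i x else if x \<in> A' i j l then f j x else x)"
  have t_meas: "t p \<in> measurable M M" for p
    by (cases p) (simp add: t_def, measurable)
  have disj: "A i j l \<inter> A' i j l = {}" for i j l by (auto simp: A_def A'_def)
  have AA': "f i x \<in> A' i j l" "f j (f i x) = x" if "x \<in> A i j l" for x i j l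
    using that fsp by (auto simp: A_def A'_def)
  have A'A: "f j x \<in> A i j l" "f i (f j x) = x" if "x \<in> A' i j l" for x i j l
    using that fsp by (auto simp: A'_def)
  have t_E: "(x, t p x) \<in> E" and t_inv: "t p (t p x) = x" if x: "x \<in> space M" for p x
  proof -
    obtain i j l where p: "p = (i, j, l)" by (cases p)
    have refl: "(x, x) \<in> E" using E(3) x unfolding equiv_def refl_on_def by blast
    have "(x, f j x) \<in> E" if "x \<in> A' i j l"
    proof -
      have "(f j x, f i (f j x)) \<in> E" using A'A(1)[OF that] by (simp add: A_def)
      then show ?thesis using A'A(2)[OF that] E(3) unfolding equiv_def sym_def by metis
    qed
    then show "(x, t p x) \<in> E" using refl by (auto simp: t_def p A_def)
    consider "x \<in> A i j l" | "x \<in> A' i j l" "x \<notin> A i j l" | "x \<notin> A i j l" "x \<notin> A' i j l" by blast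
    then show "t p (t p x) = x"
    proof cases
      case 1
      then have "f i x \<notin> A i j l" using AA'(1) disj by blast
      then show ?thesis using 1 AA' by (simp add: t_def p)
    next
      case 2
      then show ?thesis using A'A by (simp add: t_def p)
    qed (simp add: t_def p)
  qed
  have cover: "\<exists>p. y = t p x" if xy: "(x, y) \<in> E" "x \<noteq> y" for x y
  proof -
    obtain i where i: "f i x = y" using fE[OF xy(1)] by metis
    have yx: "(y, x) \<in> E" using xy(1) E(3) unfolding equiv_def sym_def by blast
    obtain j where j: "f j y = x" using fE[OF yx] by metis
    obtain l where l: "x \<in> B l" "y \<notin> B l" using sep[OF sp[OF xy(1)] xy(2)] by blast
    have "x \<in> A i j l" using xy sp[OF xy(1)] i j l by (simp add: A_def)
    then have "t (i, j, l) x = y" using i by (simp add: t_def)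
    then show ?thesis by metis
  qed
  \<comment> \<open>The identity at index 0 accounts for the pair of a point with itself.\<close>
  define u where "u n = (case n of 0 \<Rightarrow> (\<lambda>x. x) | Suc k \<Rightarrow> t (from_nat k))" for n
  have um: "u n \<in> measurable M M" for n using t_meas by (cases n) (auto simp: u_def)
  have uE: "(x, u n x) \<in> E \<and> u n (u n x) = x" if "x \<in> space M" for n x
    using t_E[OF that] t_inv[OF that] that E(3) by (cases n) (auto simp: u_def equiv_def refl_on_def)
  have "E `` {x} = range (\<lambda>n. u n x)" if x: "x \<in> space M" for x
  proof (intro equalityI subsetI)
    fix y assume "y \<in> E `` {x}"
    then have xy: "(x, y) \<in> E" by blast
    show "y \<in> range (\<lambda>n. u n x)"
    proof (cases "x = y")
      case True
      then show ?thesis by (auto simp: u_def intro!: rev_image_eqI[of 0])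
    next
      case False
      then obtain p where "y = t p x" using cover[OF xy] by blast
      then have "y = u (Suc (to_nat p)) x" by (simp add: u_def)
      then show ?thesis by blast
    qed
  next
    fix y assume "y \<in> range (\<lambda>n. u n x)"
    then show "y \<in> E `` {x}" using uE[OF x] by blast
  qed
  then show ?thesis using um uE by (intro exI[of _ u] conjI allI ballI) simp_all
qed

section \<open>Operators of graphs in the von Neumann algebra of a relation\<close>

text \<open>Complex summability is absolute, and both sides are 0 otherwise. Sums over classes
  thereby inherit the measurability and Fubini theorems of the Lebesgue integral.\<close>

lemma infsum_eq_integral_count_space:
  fixes h :: "'i \<Rightarrow> complex"
  shows "(\<Sum>\<^sub>\<infinity>i\<in>A. h i) = (LINT i|count_space A. h i)"
proof (cases "Infinite_Set_Sum.abs_summable_on h A")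
  case True
  then show ?thesis by (simp add: infsetsum_infsum[symmetric] infsetsum_def)
next
  case False
  then have "\<not> h summable_on A"
    unfolding abs_summable_equivalent summable_on_iff_abs_summable_on_complex[of h] .
  moreover have "\<not> integrable (count_space A) h" using False by (simp add: Infinite_Set_Sum.abs_summable_on_def)
  ultimately show ?thesis by (simp add: infsum_not_exists not_integrable_integral_eq)
qed

lemma infsum_delta: "(\<Sum>\<^sub>\<infinity>y. if y = a then h y else (0::complex)) = h a"
proof -
  have "(\<Sum>\<^sub>\<infinity>y. if y = a then h y else 0) = (\<Sum>\<^sub>\<infinity>y\<in>{a}. h y)"
    by (rule infsum_cong_neutral) auto
  then show ?thesis by simp
qed

lemma measurable_pair_measure_countable2:
  assumes "\<And>i :: nat. (\<lambda>x. f (x, i)) \<in> measurable N K"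
  shows "f \<in> measurable (N \<Otimes>\<^sub>M count_space UNIV) K"
proof -
  have "(\<lambda>p. (\<lambda>i p. f (fst p, i)) (snd p) p) \<in> measurable (N \<Otimes>\<^sub>M count_space UNIV) K"
    by (rule measurable_compose_countable[OF measurable_compose[OF measurable_fst assms] measurable_snd])
  then show ?thesis by simp
qed

lemma borel_measurable_cnj[measurable (raw)]:
  "f \<in> borel_measurable N \<Longrightarrow> (\<lambda>x. cnj (f x)) \<in> borel_measurable N"
  by (rule measurable_compose[OF _ borel_measurable_continuous_onI]) (auto intro!: continuous_intros)

text \<open>Measurability of the diagonal is what makes coincidence sets of measurable maps
  measurable; it comes from a separating family (\<open>standard_borel_diagonal\<close>).\<close>

locale involution_relation = prob_space M for M :: "'a measure" +
  fixes E :: "('a \<times> 'a) set" and t :: "nat \<Rightarrow> 'a \<Rightarrow> 'a"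
  assumes E_sets[measurable]: "E \<in> sets (M \<Otimes>\<^sub>M M)" and E_equiv: "equiv (space M) E"
    and t_meas[measurable]: "\<And>n. t n \<in> measurable M M"
    and t_E: "\<And>n x. x \<in> space M \<Longrightarrow> (x, t n x) \<in> E"
    and t_inv: "\<And>n x. x \<in> space M \<Longrightarrow> t n (t n x) = x"
    and E_t: "\<And>x. x \<in> space M \<Longrightarrow> E `` {x} = range (\<lambda>n. t n x)"
    and t_distr: "\<And>n. distr M M (t n) = M"
    and diag: "{p \<in> space (M \<Otimes>\<^sub>M M). fst p = snd p} \<in> sets (M \<Otimes>\<^sub>M M)"
begin

lemma pred_eq:
  assumes "g \<in> measurable N M" "h \<in> measurable N M"
  shows "Measurable.pred N (\<lambda>x. g x = h x)"
proof -
  have "(\<lambda>x. (g x, h x)) \<in> measurable N (M \<Otimes>\<^sub>M M)" using assms by measurable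
  note m = measurable_sets[OF this diag]
  have "(\<lambda>x. (g x, h x)) -` {p \<in> space (M \<Otimes>\<^sub>M M). fst p = snd p} \<inter> space N = {x \<in> space N. g x = h x}"
    using measurable_space[OF assms(1)] measurable_space[OF assms(2)] by (auto simp: space_pair_measure)
  with m show ?thesis by (simp add: pred_def)
qed

lemma E_space: "(x, y) \<in> E \<Longrightarrow> x \<in> space M" "(x, y) \<in> E \<Longrightarrow> y \<in> space M"
  using sets.sets_into_space[OF E_sets] by (auto simp: space_pair_measure)

lemma E_refl: "x \<in> space M \<Longrightarrow> (x, x) \<in> E"
  using E_equiv by (auto simp: equiv_def refl_on_def)

lemma E_sym: "(x, y) \<in> E \<Longrightarrow> (y, x) \<in> E"
  using E_equiv by (auto simp: equiv_def sym_def)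

lemma E_trans: "(x, y) \<in> E \<Longrightarrow> (y, z) \<in> E \<Longrightarrow> (x, z) \<in> E"
  using E_equiv unfolding equiv_def trans_def by blast

lemma t_space: "x \<in> space M \<Longrightarrow> t n x \<in> space M"
  using measurable_space[OF t_meas] .

text \<open>The indices \<open>i\<close> with \<open>fresh x i\<close> enumerate the class of \<open>x\<close> without repetition.\<close>

definition fresh :: "'a \<Rightarrow> nat \<Rightarrow> bool" where
  "fresh x i \<longleftrightarrow> (\<forall>l<i. t l x \<noteq> t i x)"

lemma fresh_measurable[measurable (raw)]:
  assumes [measurable]: "g \<in> measurable N M"
  shows "Measurable.pred N (\<lambda>x. fresh (g x) i)"
proof -
  have [measurable]: "Measurable.pred N (\<lambda>x. t l (g x) = t i (g x))" for l by (rule pred_eq) measurable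
  show ?thesis unfolding fresh_def by measurable
qed

lemma bij_fresh:
  assumes x: "x \<in> space M"
  shows "bij_betw (\<lambda>i. t i x) {i. fresh x i} (E `` {x})"
proof (rule bij_betw_imageI)
  show "inj_on (\<lambda>i. t i x) {i. fresh x i}"
  proof (rule inj_onI)
    fix i j assume "i \<in> {i. fresh x i}" "j \<in> {i. fresh x i}" "t i x = t j x"
    then show "i = j" unfolding fresh_def mem_Collect_eq by (cases i j rule: linorder_cases) auto
  qed
  have "t n x \<in> (\<lambda>i. t i x) ` {i. fresh x i}" for n
  proof -
    define i where "i = (LEAST i. t i x = t n x)"
    have "t i x = t n x" unfolding i_def by (rule LeastI[of _ n]) simp
    moreover have "fresh x i" unfolding fresh_def
      using not_less_Least[of _ "\<lambda>i. t i x = t n x"] calculation unfolding i_def by metis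
    ultimately show ?thesis by (intro image_eqI[of _ _ i]) auto
  qed
  then show "(\<lambda>i. t i x) ` {i. fresh x i} = E `` {x}" unfolding E_t[OF x] by blast
qed

text \<open>Sums over a class range over an uncountable type. Listing the class by its fresh indices
  turns them into sums over \<open>nat\<close> with a measurable condition, to which the theory of
  product measures applies.\<close>

lemma nn_col:
  fixes h :: "'a \<Rightarrow> ennreal"
  assumes x: "x \<in> space M" and h: "\<And>y. (x, y) \<notin> E \<Longrightarrow> h y = 0"
  shows "(\<integral>\<^sup>+y. h y \<partial>count_space UNIV) = (\<integral>\<^sup>+i. (if fresh x i then h (t i x) else 0) \<partial>count_space UNIV)"
proof -
  have "(\<integral>\<^sup>+y. h y \<partial>count_space UNIV) = (\<integral>\<^sup>+y. h y \<partial>count_space (E `` {x}))"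
    by (subst nn_integral_count_space_indicator[of "E `` {x}"])
      (use h in \<open>auto intro!: nn_integral_cong simp: indicator_def\<close>)
  also have "\<dots> = (\<integral>\<^sup>+i. h (t i x) \<partial>count_space {i. fresh x i})"
    using nn_integral_bij_count_space[OF bij_fresh[OF x], of h] by simp
  also have "\<dots> = (\<integral>\<^sup>+i. (if fresh x i then h (t i x) else 0) \<partial>count_space UNIV)"
    by (subst nn_integral_count_space_indicator[of "{i. fresh x i}"]) (auto intro!: nn_integral_cong simp: indicator_def)
  finally show ?thesis .
qed

lemma infsum_col:
  fixes h :: "'a \<Rightarrow> complex"
  assumes x: "x \<in> space M" and h: "\<And>y. (x, y) \<notin> E \<Longrightarrow> h y = 0"
  shows "(\<Sum>\<^sub>\<infinity>y. h y) = (LINT i|count_space UNIV. (if fresh x i then h (t i x) else 0))"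
proof -
  have "(\<Sum>\<^sub>\<infinity>y. h y) = (\<Sum>\<^sub>\<infinity>y\<in>E `` {x}. h y)"
    by (rule infsum_cong_neutral) (use h in auto)
  also have "\<dots> = (\<Sum>\<^sub>\<infinity>i\<in>{i. fresh x i}. h (t i x))"
    using infsum_reindex_bij_betw[OF bij_fresh[OF x], of h] by simp
  also have "\<dots> = (\<Sum>\<^sub>\<infinity>i. (if fresh x i then h (t i x) else 0))"
    by (rule infsum_cong_neutral) auto
  finally show ?thesis by (simp add: infsum_eq_integral_count_space)
qed

sublocale N: pair_sigma_finite M "count_space (UNIV :: nat set)"
  by (intro pair_sigma_finite.intro sigma_finite_measure_axioms sigma_finite_measure_count_space)

text \<open>The Feldman-Moore counting measure on pairs: each point \<open>x\<close> carries the
  counting measure of its column, every entry being reached once through a fresh index. It turns the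
  kernels of finite \<open>gns_sq\<close> into an ordinary L2 space.\<close>

definition nu :: "('a \<times> 'a) measure" where
  "nu = distr (density (M \<Otimes>\<^sub>M count_space UNIV) (\<lambda>(x, i). ennreal (if fresh x i then 1 else 0)))
     (M \<Otimes>\<^sub>M M) (\<lambda>(x, i). (t i x, x))"

lemma sets_nu[measurable_cong]: "sets nu = sets (M \<Otimes>\<^sub>M M)"
  by (simp add: nu_def)

lemma fresh_pair[measurable]: "(\<lambda>(x, i). if fresh x i then 1 else (0::real)) \<in> borel_measurable (M \<Otimes>\<^sub>M count_space UNIV)"
  by (rule measurable_pair_measure_countable2) (simp only: prod.case, measurable)

lemma t_pair[measurable]: "(\<lambda>(x, i). (t i x, x)) \<in> measurable (M \<Otimes>\<^sub>M count_space UNIV) (M \<Otimes>\<^sub>M M)"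
  by (rule measurable_pair_measure_countable2) (simp only: prod.case, measurable)

lemma nn_integral_nu:
  assumes [measurable]: "F \<in> borel_measurable (M \<Otimes>\<^sub>M M)" and F: "\<And>p. p \<notin> E \<Longrightarrow> F p = 0"
  shows "(\<integral>\<^sup>+p. F p \<partial>nu) = (\<integral>\<^sup>+x. (\<integral>\<^sup>+y. F (y, x) \<partial>count_space UNIV) \<partial>M)"
    "(\<lambda>x. \<integral>\<^sup>+y. F (y, x) \<partial>count_space UNIV) \<in> borel_measurable M"
proof -
  have c: "(\<integral>\<^sup>+y. F (y, x) \<partial>count_space UNIV) = (\<integral>\<^sup>+i. (if fresh x i then F (t i x, x) else 0) \<partial>count_space UNIV)"
    if "x \<in> space M" for x by (rule nn_col[OF that]) (use F E_sym in blast)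
  have m[measurable]: "(\<lambda>(x, i). if fresh x i then F (t i x, x) else 0) \<in> borel_measurable (M \<Otimes>\<^sub>M count_space UNIV)"
    by (rule measurable_pair_measure_countable2) (simp only: prod.case, measurable)
  let ?w = "\<lambda>(x, i). ennreal (if fresh x i then 1 else 0)"
  have w: "?w \<in> borel_measurable (M \<Otimes>\<^sub>M count_space UNIV)"
    using measurable_compose[OF fresh_pair measurable_ennreal] by (simp add: split_beta')
  have Ft: "(\<lambda>p. F (case p of (x, i) \<Rightarrow> (t i x, x))) \<in> borel_measurable (M \<Otimes>\<^sub>M count_space UNIV)"
    by (rule measurable_compose[OF t_pair assms(1)])
  have "(\<integral>\<^sup>+p. F p \<partial>nu) = (\<integral>\<^sup>+p. F (case p of (x, i) \<Rightarrow> (t i x, x)) \<partial>density (M \<Otimes>\<^sub>M count_space UNIV) ?w)"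
    unfolding nu_def
    by (rule nn_integral_distr)
      (simp_all only: measurable_cong_sets[OF sets_density refl] measurable_cong_sets[OF sets_distr refl] t_pair assms(1))
  also have "\<dots> = (\<integral>\<^sup>+p. ?w p * F (case p of (x, i) \<Rightarrow> (t i x, x)) \<partial>(M \<Otimes>\<^sub>M count_space UNIV))"
    by (rule nn_integral_density[OF w Ft])
  also have "\<dots> = (\<integral>\<^sup>+p. (case p of (x, i) \<Rightarrow> if fresh x i then F (t i x, x) else 0) \<partial>(M \<Otimes>\<^sub>M count_space UNIV))"
    by (rule nn_integral_cong) (simp add: split_beta')
  also have "\<dots> = (\<integral>\<^sup>+x. (\<integral>\<^sup>+i. (if fresh x i then F (t i x, x) else 0) \<partial>count_space UNIV) \<partial>M)"
    using N.M2.nn_integral_fst[OF m] by (simp only: prod.case)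
  also have "\<dots> = (\<integral>\<^sup>+x. (\<integral>\<^sup>+y. F (y, x) \<partial>count_space UNIV) \<partial>M)"
    by (intro nn_integral_cong) (simp add: c)
  finally show "(\<integral>\<^sup>+p. F p \<partial>nu) = (\<integral>\<^sup>+x. (\<integral>\<^sup>+y. F (y, x) \<partial>count_space UNIV) \<partial>M)" .
  have "(\<lambda>x. \<integral>\<^sup>+i. (if fresh x i then F (t i x, x) else 0) \<partial>count_space UNIV) \<in> borel_measurable M"
    using N.M2.borel_measurable_nn_integral_fst[OF m] by (simp only: prod.case)
  moreover have "(\<lambda>x. \<integral>\<^sup>+y. F (y, x) \<partial>count_space UNIV) \<in> borel_measurable M \<longleftrightarrow>
      (\<lambda>x. \<integral>\<^sup>+i. (if fresh x i then F (t i x, x) else 0) \<partial>count_space UNIV) \<in> borel_measurable M"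
    by (rule measurable_cong) (rule c)
  ultimately show "(\<lambda>x. \<integral>\<^sup>+y. F (y, x) \<partial>count_space UNIV) \<in> borel_measurable M" by (simp only:)
qed

lemma infsum_measurable:
  assumes [measurable]: "F \<in> borel_measurable (M \<Otimes>\<^sub>M M)" and F: "\<And>p. p \<notin> E \<Longrightarrow> F p = (0::complex)"
  shows "(\<lambda>x. \<Sum>\<^sub>\<infinity>y. F (y, x)) \<in> borel_measurable M"
proof -
  have c: "(\<Sum>\<^sub>\<infinity>y. F (y, x)) = (LINT i|count_space UNIV. (if fresh x i then F (t i x, x) else 0))"
    if "x \<in> space M" for x by (rule infsum_col[OF that]) (use F E_sym in blast)
  have m[measurable]: "(\<lambda>(x, i). if fresh x i then F (t i x, x) else 0) \<in> borel_measurable (M \<Otimes>\<^sub>M count_space UNIV)"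
    by (rule measurable_pair_measure_countable2) (simp only: prod.case, measurable)
  have "(\<lambda>x. LINT i|count_space UNIV. (if fresh x i then F (t i x, x) else 0)) \<in> borel_measurable M"
    by (rule N.M2.borel_measurable_lebesgue_integral[OF m])
  moreover have "(\<lambda>x. \<Sum>\<^sub>\<infinity>y. F (y, x)) \<in> borel_measurable M \<longleftrightarrow>
      (\<lambda>x. LINT i|count_space UNIV. (if fresh x i then F (t i x, x) else 0)) \<in> borel_measurable M"
    by (rule measurable_cong) (rule c)
  ultimately show ?thesis by (simp only:)
qed

lemma integral_nu:
  assumes F: "\<And>p. p \<notin> E \<Longrightarrow> F p = (0::complex)" and i: "integrable nu F"
  shows "(LINT x|M. (\<Sum>\<^sub>\<infinity>y. F (y, x))) = (LINT p|nu. F p)"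
proof -
  have [measurable]: "F \<in> borel_measurable (M \<Otimes>\<^sub>M M)" using borel_measurable_integrable[OF i] by (simp only: measurable_cong_sets[OF sets_nu refl])
  have c: "(\<Sum>\<^sub>\<infinity>y. F (y, x)) = (LINT i|count_space UNIV. (if fresh x i then F (t i x, x) else 0))"
    if "x \<in> space M" for x by (rule infsum_col[OF that]) (use F E_sym in blast)
  let ?G = "\<lambda>p. case p of (x, i) \<Rightarrow> (if fresh x i then 1 else (0::real)) *\<^sub>R F (t i x, x)"
  have F': "(\<lambda>p. F (case p of (x, i) \<Rightarrow> (t i x, x))) \<in> borel_measurable (M \<Otimes>\<^sub>M count_space UNIV)" by (rule measurable_compose[OF t_pair]) fact
  have nu': "nu = distr (density (M \<Otimes>\<^sub>M count_space UNIV) (\<lambda>p. ennreal (case p of (x, i) \<Rightarrow> if fresh x i then 1 else 0)))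
      (M \<Otimes>\<^sub>M M) (\<lambda>(x, i). (t i x, x))"
    by (simp add: nu_def split_beta')
  have t': "(\<lambda>(x, i). (t i x, x)) \<in> measurable (density (M \<Otimes>\<^sub>M count_space UNIV) (\<lambda>p. ennreal (case p of (x, i) \<Rightarrow> if fresh x i then 1 else 0))) (M \<Otimes>\<^sub>M M)"
    unfolding measurable_cong_sets[OF sets_density refl] by (rule t_pair)
  have F'': "F \<in> borel_measurable (M \<Otimes>\<^sub>M M)" by fact
  have pos: "AE p in M \<Otimes>\<^sub>M count_space UNIV. 0 \<le> (case p of (x, i) \<Rightarrow> if fresh x i then 1 else (0::real))"
    by (rule AE_I2) (simp add: split_beta')
  have iD: "integrable (density (M \<Otimes>\<^sub>M count_space UNIV) (\<lambda>p. ennreal (case p of (x, i) \<Rightarrow> if fresh x i then 1 else 0)))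
      (\<lambda>p. F (case p of (x, i) \<Rightarrow> (t i x, x)))"
    using i unfolding nu' by (subst (asm) integrable_distr_eq[OF t' F''])
  have Geq: "(\<lambda>p. (case p of (x, i) \<Rightarrow> if fresh x i then 1 else (0::real)) *\<^sub>R F (case p of (x, i) \<Rightarrow> (t i x, x))) = ?G"
    by (simp add: split_beta')
  have iG: "integrable (M \<Otimes>\<^sub>M count_space UNIV) ?G"
    using iD unfolding integrable_density[OF F' fresh_pair pos] Geq .
  have "(LINT p|nu. F p) = (LINT p|(M \<Otimes>\<^sub>M count_space UNIV). ?G p)"
    unfolding nu' integral_distr[OF t' F''] integral_density[OF F' fresh_pair pos] Geq ..
  also have "\<dots> = (LINT x|M. (LINT i|count_space UNIV. ?G (x, i)))"
    by (rule N.integral_fst'[OF iG, symmetric])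
  also have "\<dots> = (LINT x|M. (\<Sum>\<^sub>\<infinity>y. F (y, x)))"
    by (intro Bochner_Integration.integral_cong refl) (auto simp: c intro!: Bochner_Integration.integral_cong)
  finally show ?thesis by simp
qed

section \<open>The GNS Hilbert space as a space of square-integrable kernels\<close>

abbreviation "kern \<equiv> kernels M E"

definition L2 :: "'a kernel set" where
  "L2 = {f \<in> kern. gns_sq M f < \<infinity>}"

lemma kern_meas[measurable_dest]: "f \<in> kern \<Longrightarrow> f \<in> borel_measurable (M \<Otimes>\<^sub>M M)"
  by (simp add: kernels_def)

lemma kern_meas_nu: "f \<in> kern \<Longrightarrow> f \<in> borel_measurable nu"
  using kern_meas by (simp add: measurable_cong_sets[OF sets_nu refl])

lemma kern_zero: "f \<in> kern \<Longrightarrow> p \<notin> E \<Longrightarrow> f p = 0"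
  unfolding kernels_def by blast

lemma kernI: "f \<in> borel_measurable (M \<Otimes>\<^sub>M M) \<Longrightarrow> (\<And>p. p \<notin> E \<Longrightarrow> f p = 0) \<Longrightarrow> f \<in> kern"
  by (simp add: kernels_def)

lemma L2_kern: "f \<in> L2 \<Longrightarrow> f \<in> kern"
  by (simp add: L2_def)

lemma kern_add: "f \<in> kern \<Longrightarrow> g \<in> kern \<Longrightarrow> (\<lambda>p. f p + g p) \<in> kern"
  and kern_diff: "f \<in> kern \<Longrightarrow> g \<in> kern \<Longrightarrow> (\<lambda>p. f p - g p) \<in> kern"
  and kern_scale: "f \<in> kern \<Longrightarrow> (\<lambda>p. c * f p) \<in> kern"
  by (auto simp: kernels_def)

lemma gns_sq_nu:
  assumes "f \<in> kern"
  shows "gns_sq M f = (\<integral>\<^sup>+p. ennreal ((cmod (f p))\<^sup>2) \<partial>nu)"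
  unfolding gns_sq_def by (rule nn_integral_nu(1)[symmetric]) (use assms in \<open>auto simp: kernels_def\<close>)

text \<open>Equality modulo null vectors (\<open>gns_sq_diff_zero_iff\<close>), in a form that
  \<open>kmult a\<close> visibly preserves, since it acts on each column separately.\<close>

definition col_eq :: "'a kernel \<Rightarrow> 'a kernel \<Rightarrow> bool" where
  "col_eq f g \<longleftrightarrow> (AE z in M. \<forall>y. f (y, z) = g (y, z))"

lemma col_eq_refl[simp]: "col_eq f f" by (simp add: col_eq_def)

lemma col_eq_sym: "col_eq f g \<Longrightarrow> col_eq g f"
  unfolding col_eq_def by (erule AE_mp) simp

lemma col_eq_trans: "col_eq f g \<Longrightarrow> col_eq g h \<Longrightarrow> col_eq f h"
  unfolding col_eq_def by (erule (1) eventually_elim2) simp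

lemma gns_sq_diff_zero_iff:
  assumes "f \<in> kern" "g \<in> kern"
  shows "gns_sq M (\<lambda>p. f p - g p) = 0 \<longleftrightarrow> col_eq f g"
proof -
  have k: "(\<lambda>p. f p - g p) \<in> kern" using assms by (rule kern_diff)
  have "gns_sq M (\<lambda>p. f p - g p) = 0 \<longleftrightarrow>
      (AE x in M. (\<integral>\<^sup>+y. ennreal ((cmod (f (y, x) - g (y, x)))\<^sup>2) \<partial>count_space UNIV) = 0)"
    unfolding gns_sq_def
    by (rule nn_integral_0_iff_AE, rule nn_integral_nu(2)[where F = "\<lambda>p. ennreal ((cmod (f p - g p))\<^sup>2)"])
      (use k in \<open>auto simp: kernels_def\<close>)
  also have "\<dots> \<longleftrightarrow> col_eq f g" unfolding col_eq_def
    by (intro AE_cong) (subst nn_integral_0_iff_AE, auto simp: AE_count_space)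
  finally show ?thesis .
qed

lemma gns_sq_cong:
  assumes "col_eq f g" shows "gns_sq M f = gns_sq M g"
  unfolding gns_sq_def using assms unfolding col_eq_def
  by (intro nn_integral_cong_AE) (auto elim!: AE_mp)

abbreviation "cl \<equiv> gns_class M E"

lemma mem_cl: "f \<in> kern \<Longrightarrow> g \<in> cl f \<longleftrightarrow> g \<in> kern \<and> col_eq g f"
  unfolding gns_class_def using gns_sq_diff_zero_iff by auto

lemma rep_cl:
  assumes "f \<in> kern"
  shows "rep (cl f) \<in> kern" "col_eq (rep (cl f)) f"
proof -
  have "f \<in> cl f" using assms by (simp add: mem_cl)
  then have "rep (cl f) \<in> cl f" unfolding rep_def by (rule someI[of "\<lambda>x. x \<in> cl f"])
  then show "rep (cl f) \<in> kern" "col_eq (rep (cl f)) f" using assms by (auto simp: mem_cl)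
qed

lemma cl_eq_iff:
  assumes "f \<in> kern" "g \<in> kern"
  shows "cl f = cl g \<longleftrightarrow> col_eq f g"
proof
  assume "cl f = cl g"
  moreover have "f \<in> cl f" using assms by (simp add: mem_cl)
  ultimately show "col_eq f g" using assms by (simp add: mem_cl)
next
  assume "col_eq f g"
  then have "col_eq h f \<longleftrightarrow> col_eq h g" for h using col_eq_trans col_eq_sym by blast
  then show "cl f = cl g" using assms by (simp add: set_eq_iff mem_cl)
qed

lemma gns_sq_add:
  assumes "f \<in> kern" "g \<in> kern"
  shows "gns_sq M (\<lambda>p. f p + g p) \<le> 2 * gns_sq M f + 2 * gns_sq M g"
proof -
  have [measurable]: "f \<in> borel_measurable nu" "g \<in> borel_measurable nu" using assms[THEN kern_meas_nu] by simp_all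
  have "(cmod (a + b))\<^sup>2 \<le> 2 * (cmod a)\<^sup>2 + 2 * (cmod b)\<^sup>2" for a b
  proof -
    have "(cmod (a + b))\<^sup>2 \<le> (cmod a + cmod b)\<^sup>2" by (intro power_mono norm_triangle_ineq) auto
    also have "\<dots> \<le> 2 * (cmod a)\<^sup>2 + 2 * (cmod b)\<^sup>2"
      using zero_le_power2[of "cmod a - cmod b"] by (simp add: power2_eq_square algebra_simps)
    finally show ?thesis .
  qed
  then have "ennreal ((cmod (a + b))\<^sup>2) \<le> 2 * ennreal ((cmod a)\<^sup>2) + 2 * ennreal ((cmod b)\<^sup>2)" for a b
    using ennreal_leI[of "(cmod (a + b))\<^sup>2" "2 * (cmod a)\<^sup>2 + 2 * (cmod b)\<^sup>2"]
    by (simp add: ennreal_plus ennreal_mult')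
  then have "gns_sq M (\<lambda>p. f p + g p) \<le> (\<integral>\<^sup>+p. 2 * ennreal ((cmod (f p))\<^sup>2) + 2 * ennreal ((cmod (g p))\<^sup>2) \<partial>nu)"
    unfolding gns_sq_nu[OF kern_add[OF assms]] by (intro nn_integral_mono)
  also have "\<dots> = 2 * gns_sq M f + 2 * gns_sq M g"
    unfolding gns_sq_nu[OF assms(1)] gns_sq_nu[OF assms(2)]
    by (subst nn_integral_add) (auto simp: nn_integral_cmult)
  finally show ?thesis .
qed

lemma L2_add: "f \<in> L2 \<Longrightarrow> g \<in> L2 \<Longrightarrow> (\<lambda>p. f p + g p) \<in> L2"
  using gns_sq_add[of f g] kern_add[of f g] unfolding L2_def
  by (auto intro: le_less_trans simp: ennreal_mult_less_top)

lemma L2_scale: "f \<in> L2 \<Longrightarrow> (\<lambda>p. c * f p) \<in> L2"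
proof -
  assume f: "f \<in> L2"
  have [measurable]: "f \<in> borel_measurable nu" using L2_kern[OF f, THEN kern_meas_nu] by simp
  have "gns_sq M (\<lambda>p. c * f p) = ennreal ((cmod c)\<^sup>2) * gns_sq M f"
    unfolding gns_sq_nu[OF kern_scale[OF L2_kern[OF f]]] gns_sq_nu[OF L2_kern[OF f]]
    by (subst nn_integral_cmult[symmetric]) (auto simp: norm_mult power_mult_distrib ennreal_mult'[symmetric])
  then show ?thesis using f kern_scale[of f c] by (auto simp: L2_def ennreal_mult_less_top)
qed

lemma L2_diff: "f \<in> L2 \<Longrightarrow> g \<in> L2 \<Longrightarrow> (\<lambda>p. f p - g p) \<in> L2"
  using L2_add[of f "\<lambda>p. (-1) * g p"] L2_scale[of g "-1"] by simp

lemma M0_kern: "a \<in> M0 M E \<Longrightarrow> a \<in> kern"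
  by (simp add: M0_def)

lemma M0_L2: "a \<in> M0 M E \<Longrightarrow> a \<in> L2"
proof -
  assume a: "a \<in> M0 M E"
  obtain K where K: "\<And>p. cmod (a p) \<le> K" using a by (auto simp: M0_def)
  obtain n where n: "\<And>x. finite {y. a (y, x) \<noteq> 0}" "\<And>x. card {y. a (y, x) \<noteq> 0} \<le> n"
    using a unfolding M0_def by blast
  have "(\<integral>\<^sup>+y. ennreal ((cmod (a (y, x)))\<^sup>2) \<partial>count_space UNIV) \<le> ennreal (K\<^sup>2) * of_nat n" for x
  proof -
    have "(\<integral>\<^sup>+y. ennreal ((cmod (a (y, x)))\<^sup>2) \<partial>count_space UNIV) \<le>
        (\<integral>\<^sup>+y. ennreal (K\<^sup>2) * indicator {y. a (y, x) \<noteq> 0} y \<partial>count_space UNIV)"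
      using K by (intro nn_integral_mono) (auto simp: indicator_def intro!: ennreal_leI power_mono)
    also have "\<dots> = ennreal (K\<^sup>2) * of_nat (card {y. a (y, x) \<noteq> 0})"
      using n(1) by (simp add: nn_integral_cmult_indicator emeasure_count_space)
    also have "\<dots> \<le> ennreal (K\<^sup>2) * of_nat n" using n(2) by (intro mult_left_mono) auto
    finally show ?thesis .
  qed
  then have "gns_sq M a \<le> (\<integral>\<^sup>+x. ennreal (K\<^sup>2) * of_nat n \<partial>M)" unfolding gns_sq_def by (rule nn_integral_mono)
  also have "\<dots> < \<infinity>" by (simp add: emeasure_space_1 ennreal_mult_less_top of_nat_less_top)
  finally show ?thesis using a by (simp add: L2_def M0_kern)
qed

text \<open>Density of \<open>M0\<close>: cut a kernel off at height \<open>k\<close> and restrict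
  it to the graphs of the first \<open>k\<close> involutions. The graph of an involution has at most
  one entry in each row and in each column, so both counts stay bounded by \<open>k\<close>.\<close>

lemma gns_kernels_eq: "gns_kernels M E = L2"
proof (intro equalityI subsetI)
  fix f assume "f \<in> gns_kernels M E"
  then obtain a where f: "f \<in> kern" and a: "\<And>k. a k \<in> M0 M E" "(\<lambda>k. gns_sq M (\<lambda>p. a k p - f p)) \<longlonglongrightarrow> 0"
    unfolding gns_kernels_def by blast
  have "\<forall>\<^sub>F k in sequentially. gns_sq M (\<lambda>p. a k p - f p) < 1" using a(2) by (rule order_tendstoD) simp
  then obtain k where k: "gns_sq M (\<lambda>p. a k p - f p) < 1" by (auto simp: eventually_sequentially)
  have "(\<lambda>p. a k p - f p) \<in> L2" using k kern_diff[OF M0_kern[OF a(1)] f] unfolding L2_def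
    by (auto intro: less_trans)
  from L2_diff[OF M0_L2[OF a(1)[of k]] this] show "f \<in> L2" by simp
next
  fix f assume f: "f \<in> L2"
  note [measurable] = L2_kern[OF f, THEN kern_meas]
  define a where "a k = (\<lambda>p. if snd p \<in> space M \<and> cmod (f p) \<le> real k \<and> (\<exists>i<k. fst p = t i (snd p)) then f p else 0)" for k :: nat
  have [measurable]: "Measurable.pred (M \<Otimes>\<^sub>M M) (\<lambda>p. fst p = t i (snd p))" for i by (rule pred_eq) measurable
  have am[measurable]: "a k \<in> borel_measurable (M \<Otimes>\<^sub>M M)" for k
  proof -
    have "(\<lambda>p. if cmod (f p) \<le> real k \<and> (\<exists>i<k. fst p = t i (snd p)) then f p else 0) \<in> borel_measurable (M \<Otimes>\<^sub>M M)"
      by measurable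
    then show ?thesis unfolding a_def by (subst measurable_cong) (auto simp: space_pair_measure)
  qed
  have ak: "a k \<in> kern" for k
    by (rule kernI) (use am L2_kern[OF f] kern_zero in \<open>auto simp: a_def\<close>)
  have "a k \<in> M0 M E" for k
  proof -
    have c1: "{y. a k (x, y) \<noteq> 0} \<subseteq> (\<lambda>i. t i x) ` {..<k}" for x
    proof
      fix y assume "y \<in> {y. a k (x, y) \<noteq> 0}"
      then obtain i where i: "i < k" "x = t i y" "y \<in> space M" by (auto simp: a_def split: if_splits)
      then have "y = t i x" using t_inv by simp
      then show "y \<in> (\<lambda>i. t i x) ` {..<k}" using i by blast
    qed
    have c2: "{y. a k (y, x) \<noteq> 0} \<subseteq> (\<lambda>i. t i x) ` {..<k}" for x
      by (auto simp: a_def split: if_splits)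
    have "card ((\<lambda>i. t i x) ` {..<k}) \<le> k" for x using card_image_le[of "{..<k}" "\<lambda>i. t i x"] by simp
    then have "finite {y. a k (x, y) \<noteq> 0} \<and> card {y. a k (x, y) \<noteq> 0} \<le> k \<and>
        finite {y. a k (y, x) \<noteq> 0} \<and> card {y. a k (y, x) \<noteq> 0} \<le> k" for x
      using card_mono[OF _ c1[of x]] card_mono[OF _ c2[of x]] finite_subset[OF c1[of x]] finite_subset[OF c2[of x]]
      by (meson finite_imageI finite_lessThan order_trans)
    moreover have "cmod (a k p) \<le> real k" for p by (simp add: a_def)
    ultimately show ?thesis using ak unfolding M0_def by blast
  qed
  moreover have "(\<lambda>k. gns_sq M (\<lambda>p. a k p - f p)) \<longlonglongrightarrow> 0"
  proof -
    have "(\<lambda>k. \<integral>\<^sup>+p. ennreal ((cmod (a k p - f p))\<^sup>2) \<partial>nu) \<longlonglongrightarrow> (\<integral>\<^sup>+p. 0 \<partial>nu)"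
    proof (rule nn_integral_dominated_convergence[where w = "\<lambda>p. ennreal ((cmod (f p))\<^sup>2)"])
      show "(\<integral>\<^sup>+p. ennreal ((cmod (f p))\<^sup>2) \<partial>nu) < \<infinity>"
        using f gns_sq_nu[OF L2_kern[OF f]] by (simp add: L2_def)
      show "AE p in nu. ennreal ((cmod (a k p - f p))\<^sup>2) \<le> ennreal ((cmod (f p))\<^sup>2)" for k
        by (auto simp: a_def)
      have "\<exists>N. \<forall>k\<ge>N. a k p = f p" for p
      proof (cases "p \<in> E")
        case True
        obtain y x where p: "p = (y, x)" by (cases p)
        have x: "x \<in> space M" "y \<in> E `` {x}" using True p E_space E_sym by auto
        then obtain i where i: "y = t i x" using E_t by auto
        obtain m where m: "cmod (f p) \<le> real m" using real_arch_simple by blast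
        have "a k p = f p" if k: "k \<ge> max m (Suc i)" for k
        proof -
          have "\<exists>i<k. y = t i x" using k i by (intro exI[of _ i]) auto
          then show ?thesis using k m x by (simp add: a_def p)
        qed
        then show ?thesis by blast
      qed (use kern_zero[OF L2_kern[OF f]] in \<open>auto simp: a_def\<close>)
      have "\<And>p. (\<lambda>k. ennreal ((cmod (a k p - f p))\<^sup>2)) \<longlonglongrightarrow> 0"
      proof -
        fix p
        obtain N where "\<forall>k\<ge>N. a k p = f p" using \<open>\<And>p. \<exists>N. \<forall>k\<ge>N. a k p = f p\<close> by blast
        then show "(\<lambda>k. ennreal ((cmod (a k p - f p))\<^sup>2)) \<longlonglongrightarrow> 0"
          by (intro tendsto_eventually eventually_sequentiallyI[of N]) simp
      qed
      then show "AE p in nu. (\<lambda>k. ennreal ((cmod (a k p - f p))\<^sup>2)) \<longlonglongrightarrow> 0" by simp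
    qed measurable
    then show ?thesis using gns_sq_nu[OF kern_diff[OF ak L2_kern[OF f]]] by simp
  qed
  ultimately show "f \<in> gns_kernels M E" unfolding gns_kernels_def using L2_kern[OF f] by blast
qed

definition kernel_inner :: "'a kernel \<Rightarrow> 'a kernel \<Rightarrow> complex" where
  "kernel_inner f g = (LINT x|M. (\<Sum>\<^sub>\<infinity>y. cnj (g (y, x)) * f (y, x)))"

lemma kernel_inner_measurable:
  assumes "f \<in> kern" "g \<in> kern"
  shows "(\<lambda>x. \<Sum>\<^sub>\<infinity>y. cnj (g (y, x)) * f (y, x)) \<in> borel_measurable M"
proof (rule infsum_measurable[where F = "\<lambda>p. cnj (g p) * f p"])
  note [measurable] = assms[THEN kern_meas]
  show "(\<lambda>p. cnj (g p) * f p) \<in> borel_measurable (M \<Otimes>\<^sub>M M)" by measurable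
qed (simp add: kern_zero assms)

lemma kernel_inner_cong:
  assumes k: "f \<in> kern" "g \<in> kern" "f' \<in> kern" "g' \<in> kern" and c: "col_eq f f'" "col_eq g g'"
  shows "kernel_inner f g = kernel_inner f' g'"
  unfolding kernel_inner_def
proof (rule integral_cong_AE)
  show "AE x in M. (\<Sum>\<^sub>\<infinity>y. cnj (g (y, x)) * f (y, x)) = (\<Sum>\<^sub>\<infinity>y. cnj (g' (y, x)) * f' (y, x))"
    using c[unfolded col_eq_def] by eventually_elim simp
qed (rule kernel_inner_measurable; fact)+

lemma kernel_inner_nu:
  assumes "f \<in> L2" "g \<in> L2"
  shows "integrable nu (\<lambda>p. cnj (g p) * f p)" "kernel_inner f g = (LINT p|nu. cnj (g p) * f p)"
proof -
  have [measurable]: "f \<in> borel_measurable nu" "g \<in> borel_measurable nu"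
    using assms[THEN L2_kern, THEN kern_meas_nu] by simp_all
  have sq: "integrable nu (\<lambda>p. (cmod (h p))\<^sup>2)" if "h \<in> L2" for h
  proof -
    have [measurable]: "h \<in> borel_measurable nu" using that[THEN L2_kern, THEN kern_meas_nu] by simp_all
    show ?thesis using that by (intro integrableI_bounded) (auto simp: L2_def gns_sq_nu)
  qed
  show i: "integrable nu (\<lambda>p. cnj (g p) * f p)"
  proof (rule Bochner_Integration.integrable_bound)
    show "integrable nu (\<lambda>p. (cmod (f p))\<^sup>2 + (cmod (g p))\<^sup>2)" using sq assms by auto
    have "norm (cnj b * a) \<le> norm ((cmod a)\<^sup>2 + (cmod b)\<^sup>2)" for a b
    proof -
      have "2 * (cmod a * cmod b) \<le> (cmod a)\<^sup>2 + (cmod b)\<^sup>2"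
        using zero_le_power2[of "cmod a - cmod b"] by (simp add: power2_eq_square algebra_simps)
      moreover have "cmod a * cmod b \<ge> 0" by simp
      ultimately have "cmod a * cmod b \<le> (cmod a)\<^sup>2 + (cmod b)\<^sup>2" by linarith
      then show ?thesis by (simp add: norm_mult mult.commute)
    qed
    then show "AE p in nu. norm (cnj (g p) * f p) \<le> norm ((cmod (f p))\<^sup>2 + (cmod (g p))\<^sup>2)" by simp
  qed measurable
  show "kernel_inner f g = (LINT p|nu. cnj (g p) * f p)" unfolding kernel_inner_def
    by (rule integral_nu[where F = "\<lambda>p. cnj (g p) * f p"]) (use i assms L2_kern kern_zero in auto)
qed

lemma kernel_inner_self:
  assumes f: "f \<in> L2"
  shows "kernel_inner f f = complex_of_real (enn2real (gns_sq M f))"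
proof -
  have [measurable]: "f \<in> borel_measurable nu" using f[THEN L2_kern, THEN kern_meas_nu] by simp_all
  have "kernel_inner f f = (LINT p|nu. complex_of_real ((cmod (f p))\<^sup>2))"
    unfolding kernel_inner_nu(2)[OF f f] by (intro Bochner_Integration.integral_cong refl) (metis complex_norm_square mult.commute)
  also have "\<dots> = complex_of_real (LINT p|nu. (cmod (f p))\<^sup>2)" by (rule integral_complex_of_real)
  also have "(LINT p|nu. (cmod (f p))\<^sup>2) = enn2real (gns_sq M f)"
    unfolding gns_sq_nu[OF L2_kern[OF f]] by (rule integral_eq_nn_integral) auto
  finally show ?thesis .
qed

lemma kernel_inner_diff:
  assumes "f \<in> L2" "g \<in> L2" "h \<in> L2"
  shows "kernel_inner (\<lambda>p. f p - g p) h = kernel_inner f h - kernel_inner g h" "kernel_inner h (\<lambda>p. f p - g p) = kernel_inner h f - kernel_inner h g"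
proof -
  note i = kernel_inner_nu(1)[OF assms(1,3)] kernel_inner_nu(1)[OF assms(2,3)] kernel_inner_nu(1)[OF assms(3,1)] kernel_inner_nu(1)[OF assms(3,2)]
  note v = kernel_inner_nu(2)[OF assms(1,3)] kernel_inner_nu(2)[OF assms(2,3)] kernel_inner_nu(2)[OF assms(3,1)] kernel_inner_nu(2)[OF assms(3,2)]
    kernel_inner_nu(2)[OF L2_diff[OF assms(1,2)] assms(3)] kernel_inner_nu(2)[OF assms(3) L2_diff[OF assms(1,2)]]
  show "kernel_inner (\<lambda>p. f p - g p) h = kernel_inner f h - kernel_inner g h"
    unfolding v Bochner_Integration.integral_diff[OF i(1,2), symmetric] by (simp add: ring_distribs)
  show "kernel_inner h (\<lambda>p. f p - g p) = kernel_inner h f - kernel_inner h g"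
    unfolding v Bochner_Integration.integral_diff[OF i(3,4), symmetric] by (simp add: ring_distribs)
qed

text \<open>The test vector is \<open>f - g\<close> itself; the two alternatives serve equations in
  the first and in the second argument.\<close>

lemma kernel_inner_nondegenerate:
  assumes "f \<in> L2" "g \<in> L2" "(\<forall>h\<in>L2. kernel_inner f h = kernel_inner g h) \<or> (\<forall>h\<in>L2. kernel_inner h f = kernel_inner h g)"
  shows "col_eq f g"
proof -
  let ?h = "\<lambda>p. f p - g p"
  have h: "?h \<in> L2" using assms(1,2) by (rule L2_diff)
  have "kernel_inner ?h ?h = 0" using assms(3)
  proof
    assume "\<forall>h\<in>L2. kernel_inner f h = kernel_inner g h"
    then show ?thesis using kernel_inner_diff(1)[OF assms(1,2) h] h by simp
  next
    assume "\<forall>h\<in>L2. kernel_inner h f = kernel_inner h g"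
    then show ?thesis using kernel_inner_diff(2)[OF assms(1,2) h] h by simp
  qed
  then have "gns_sq M ?h = 0" using kernel_inner_self[OF h] h by (auto simp: L2_def enn2real_eq_0_iff)
  then show ?thesis using gns_sq_diff_zero_iff assms(1,2) L2_kern by blast
qed

section \<open>Operators of partial maps whose graph lies in the relation\<close>

abbreviation "H \<equiv> gns_space M E"
abbreviation "vN \<equiv> vN_algebra M E"

definition aut :: "('a \<Rightarrow> 'a) \<Rightarrow> bool" where
  "aut \<phi> \<longleftrightarrow> \<phi> \<in> measurable M M \<and> bij_betw \<phi> (space M) (space M) \<and> (\<forall>x\<in>space M. (x, \<phi> x) \<in> E)"

definition translate :: "('a \<Rightarrow> 'a) \<Rightarrow> 'a set \<Rightarrow> 'a kernel \<Rightarrow> 'a kernel" where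
  "translate \<phi> C f = (\<lambda>(x, z). if x \<in> C then f (\<phi> x, z) else 0)"

definition graph_kernel :: "('a \<Rightarrow> 'a) \<Rightarrow> 'a set \<Rightarrow> 'a kernel" where
  "graph_kernel \<phi> C = (\<lambda>(x, y). if x \<in> C \<and> y = \<phi> x then 1 else 0)"

text \<open>The partial isometry of \<open>\<phi>\<close> on \<open>C\<close>. It substitutes
  \<open>\<phi> x\<close> for the row index, so products correspond to compositions in the reverse
  order (\<open>W_mult\<close>); this is why words later act through
  \<open>act_opposite\<close>.\<close>

definition W :: "('a \<Rightarrow> 'a) \<Rightarrow> 'a set \<Rightarrow> 'a kernel set \<Rightarrow> 'a kernel set" where
  "W \<phi> C = gns_left_mult M E (graph_kernel \<phi> C)"

text \<open>Right translation by the involution \<open>t n\<close>. It commutes with all left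
  multiplications (\<open>kmult_right_shift\<close>) and thus represents the commutant.\<close>

definition right_shift :: "nat \<Rightarrow> 'a kernel \<Rightarrow> 'a kernel" where
  "right_shift n f = (\<lambda>(y, z). if z \<in> space M then f (y, t n z) else 0)"

abbreviation "one_kernel \<equiv> (indicator {(x, x) | x. x \<in> space M} :: 'a kernel)"

lemma aut_meas: "aut \<phi> \<Longrightarrow> \<phi> \<in> measurable M M" unfolding aut_def by blast
lemma aut_E: "aut \<phi> \<Longrightarrow> x \<in> space M \<Longrightarrow> (x, \<phi> x) \<in> E" unfolding aut_def by blast
lemma aut_space: "aut \<phi> \<Longrightarrow> x \<in> space M \<Longrightarrow> \<phi> x \<in> space M" using measurable_space[OF aut_meas] .
lemma aut_bij: "aut \<phi> \<Longrightarrow> bij_betw \<phi> (space M) (space M)" unfolding aut_def by blast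

lemma bij_t: "bij_betw (t n) (space M) (space M)"
  by (rule bij_betw_byWitness[where f' = "t n"]) (use t_inv t_space in auto)

lemma aut_t: "aut (t n)" unfolding aut_def using bij_t t_E t_meas by blast

lemma aut_id: "aut (\<lambda>x. x)" unfolding aut_def using E_refl bij_betw_id[of "space M"] measurable_ident_sets[OF refl, of M]
  by (simp add: id_def)

lemma aut_comp: "aut \<phi> \<Longrightarrow> aut \<psi> \<Longrightarrow> aut (\<lambda>x. \<psi> (\<phi> x))"
proof -
  assume a: "aut \<phi>" "aut \<psi>"
  have "(x, \<psi> (\<phi> x)) \<in> E" if "x \<in> space M" for x
    using E_trans[OF aut_E[OF a(1) that] aut_E[OF a(2) aut_space[OF a(1) that]]] .
  moreover have "(\<lambda>x. \<psi> (\<phi> x)) \<in> measurable M M" by (rule measurable_compose[OF aut_meas[OF a(1)] aut_meas[OF a(2)]])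
  moreover have "bij_betw (\<lambda>x. \<psi> (\<phi> x)) (space M) (space M)"
    using bij_betw_trans[OF aut_bij[OF a(1)] aut_bij[OF a(2)]] by (simp add: comp_def)
  ultimately show ?thesis unfolding aut_def by blast
qed

lemma kmult_graph_kernel: "kmult (graph_kernel \<phi> C) f = translate \<phi> C f"
proof (rule ext, clarify)
  fix x z
  have "(\<Sum>\<^sub>\<infinity>y. graph_kernel \<phi> C (x, y) * f (y, z)) = (\<Sum>\<^sub>\<infinity>y. if y = \<phi> x then (if x \<in> C then f (y, z) else 0) else 0)"
    by (rule infsum_cong) (simp add: graph_kernel_def)
  then show "kmult (graph_kernel \<phi> C) f (x, z) = translate \<phi> C f (x, z)"
    by (simp add: kmult_def translate_def infsum_delta)
qed

lemma graph_kernel_M0: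
  assumes "aut \<phi>" "C \<in> sets M"
  shows "graph_kernel \<phi> C \<in> M0 M E"
proof -
  have CM: "C \<subseteq> space M" using sets.sets_into_space[OF assms(2)] .
  have [measurable]: "\<phi> \<in> measurable M M" "C \<in> sets M" by (rule aut_meas[OF assms(1)] assms(2))+
  have p2: "Measurable.pred (M \<Otimes>\<^sub>M M) (\<lambda>p. snd p = \<phi> (fst p))"
    by (rule pred_eq[OF measurable_snd measurable_compose[OF measurable_fst aut_meas[OF assms(1)]]])
  have "graph_kernel \<phi> C = (\<lambda>p. if fst p \<in> C \<and> snd p = \<phi> (fst p) then 1 else 0)"
    by (auto simp: graph_kernel_def)
  moreover have "(\<lambda>p. if fst p \<in> C \<and> snd p = \<phi> (fst p) then 1 else (0::complex)) \<in> borel_measurable (M \<Otimes>\<^sub>M M)"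
  proof (rule measurable_If[OF borel_measurable_const borel_measurable_const])
    have p1: "Measurable.pred (M \<Otimes>\<^sub>M M) (\<lambda>p. fst p \<in> C)" by (rule pred_sets2[OF assms(2) measurable_fst])
    have "{p \<in> space (M \<Otimes>\<^sub>M M). fst p \<in> C \<and> snd p = \<phi> (fst p)} =
        {p \<in> space (M \<Otimes>\<^sub>M M). fst p \<in> C} \<inter> {p \<in> space (M \<Otimes>\<^sub>M M). snd p = \<phi> (fst p)}" by blast
    then show "{p \<in> space (M \<Otimes>\<^sub>M M). fst p \<in> C \<and> snd p = \<phi> (fst p)} \<in> sets (M \<Otimes>\<^sub>M M)"
      using sets.Int[OF p1[unfolded pred_def] p2[unfolded pred_def]] by (simp only:)
  qed
  ultimately have m: "graph_kernel \<phi> C \<in> borel_measurable (M \<Otimes>\<^sub>M M)" by (simp only:)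
  have "graph_kernel \<phi> C p = 0" if "p \<notin> E" for p
    using that aut_E[OF assms(1), of "fst p"] CM by (cases p) (auto simp: graph_kernel_def)
  with m have "graph_kernel \<phi> C \<in> kern" by (rule kernI)
  moreover have "cmod (graph_kernel \<phi> C p) \<le> 1" for p by (auto simp: graph_kernel_def split: prod.splits)
  moreover have "finite {y. graph_kernel \<phi> C (x, y) \<noteq> 0} \<and> card {y. graph_kernel \<phi> C (x, y) \<noteq> 0} \<le> 1 \<and>
      finite {y. graph_kernel \<phi> C (y, x) \<noteq> 0} \<and> card {y. graph_kernel \<phi> C (y, x) \<noteq> 0} \<le> 1" for x
  proof -
    have "{y. graph_kernel \<phi> C (x, y) \<noteq> 0} \<subseteq> {\<phi> x}" by (auto simp: graph_kernel_def)
    moreover have "{y. graph_kernel \<phi> C (y, x) \<noteq> 0} \<subseteq> {inv_into (space M) \<phi> x}"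
      using CM aut_bij[OF assms(1)] by (auto simp: graph_kernel_def bij_betw_def split: if_splits)
    ultimately show ?thesis using card_mono[of "{_}"] finite_subset[of _ "{_}"] by (metis card.empty card.insert empty_iff finite.emptyI finite.insertI One_nat_def)
  qed
  ultimately show ?thesis unfolding M0_def by blast
qed

text \<open>The row of \<open>a\<close> at \<open>x\<close> lives on the class of \<open>x\<close>,
  so the fresh indices turn the inner sum into an integral over \<open>nat\<close> that depends
  measurably on the pair.\<close>

lemma kmult_kern:
  assumes "a \<in> kern" "f \<in> kern"
  shows "kmult a f \<in> kern"
proof (rule kernI)
  note [measurable] = assms[THEN kern_meas]
  have m: "(\<lambda>(p, i). if fresh (fst p) i then a (fst p, t i (fst p)) * f (t i (fst p), snd p) else 0)
      \<in> borel_measurable ((M \<Otimes>\<^sub>M M) \<Otimes>\<^sub>M count_space UNIV)"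
    by (rule measurable_pair_measure_countable2) (simp only: prod.case, measurable)
  have "(\<lambda>p. LINT i|count_space UNIV. (if fresh (fst p) i then a (fst p, t i (fst p)) * f (t i (fst p), snd p) else 0))
      \<in> borel_measurable (M \<Otimes>\<^sub>M M)"
    by (rule N.M2.borel_measurable_lebesgue_integral[OF m])
  moreover have "kmult a f \<in> borel_measurable (M \<Otimes>\<^sub>M M) \<longleftrightarrow>
      (\<lambda>p. LINT i|count_space UNIV. (if fresh (fst p) i then a (fst p, t i (fst p)) * f (t i (fst p), snd p) else 0))
      \<in> borel_measurable (M \<Otimes>\<^sub>M M)"
  proof (rule measurable_cong)
    fix p assume "p \<in> space (M \<Otimes>\<^sub>M M)"
    then obtain x z where p: "p = (x, z)" "x \<in> space M" by (auto simp: space_pair_measure)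
    have "(\<Sum>\<^sub>\<infinity>y. a (x, y) * f (y, z)) =
        (LINT i|count_space UNIV. (if fresh x i then a (x, t i x) * f (t i x, z) else 0))"
      by (rule infsum_col[OF p(2)]) (simp add: kern_zero[OF assms(1)])
    then show "kmult a f p = (LINT i|count_space UNIV. (if fresh (fst p) i then a (fst p, t i (fst p)) * f (t i (fst p), snd p) else 0))"
      unfolding kmult_def p(1) prod.case fst_conv snd_conv .
  qed
  ultimately show "kmult a f \<in> borel_measurable (M \<Otimes>\<^sub>M M)" by (simp only:)
  fix p assume pE: "p \<notin> E"
  obtain x z where p: "p = (x, z)" by (cases p)
  have "a (x, y) * f (y, z) = 0" for y
    using kern_zero[OF assms(1), of "(x, y)"] kern_zero[OF assms(2), of "(y, z)"] E_trans[of x y z] pE p by auto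
  then have "(\<Sum>\<^sub>\<infinity>y. a (x, y) * f (y, z)) = 0" by (intro infsum_0)
  then show "kmult a f p = 0" by (simp add: kmult_def p)
qed

lemma kmult_col_eq: "col_eq f g \<Longrightarrow> col_eq (kmult a f) (kmult a g)"
  unfolding col_eq_def kmult_def by (erule eventually_mono) simp

lemma translate_kern: "aut \<phi> \<Longrightarrow> C \<in> sets M \<Longrightarrow> f \<in> kern \<Longrightarrow> translate \<phi> C f \<in> kern"
  using kmult_kern[OF M0_kern[OF graph_kernel_M0]] by (simp add: kmult_graph_kernel)

lemma gns_sq_translate:
  assumes "aut \<phi>" "C \<in> sets M"
  shows "gns_sq M (translate \<phi> C f) \<le> gns_sq M f"
  unfolding gns_sq_def
proof (rule nn_integral_mono)
  fix x
  let ?h = "\<lambda>y. ennreal ((cmod (f (y, x)))\<^sup>2)"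
  have CM: "C \<subseteq> space M" using sets.sets_into_space[OF assms(2)] .
  have "(\<integral>\<^sup>+y. ennreal ((cmod (translate \<phi> C f (y, x)))\<^sup>2) \<partial>count_space UNIV) \<le>
      (\<integral>\<^sup>+y. ?h (\<phi> y) * indicator (space M) y \<partial>count_space UNIV)"
    using CM by (intro nn_integral_mono) (auto simp: translate_def indicator_def)
  also have "\<dots> = (\<integral>\<^sup>+y. ?h (\<phi> y) \<partial>count_space (space M))"
    by (rule nn_integral_count_space_indicator[symmetric]) simp
  also have "\<dots> = (\<integral>\<^sup>+y. ?h y \<partial>count_space (space M))"
    by (rule nn_integral_bij_count_space[OF aut_bij[OF assms(1)]])
  also have "\<dots> = (\<integral>\<^sup>+y. ?h y * indicator (space M) y \<partial>count_space UNIV)"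
    by (rule nn_integral_count_space_indicator) simp
  also have "\<dots> \<le> (\<integral>\<^sup>+y. ?h y \<partial>count_space UNIV)"
    by (intro nn_integral_mono) (auto simp: indicator_def)
  finally show "(\<integral>\<^sup>+y. ennreal ((cmod (translate \<phi> C f (y, x)))\<^sup>2) \<partial>count_space UNIV) \<le> (\<integral>\<^sup>+y. ?h y \<partial>count_space UNIV)" .
qed

lemma translate_L2: "aut \<phi> \<Longrightarrow> C \<in> sets M \<Longrightarrow> f \<in> L2 \<Longrightarrow> translate \<phi> C f \<in> L2"
  using translate_kern gns_sq_translate le_less_trans unfolding L2_def by blast

lemma vecs_eq: "vecs H = cl ` L2"
  by (simp add: gns_space_def gns_kernels_eq)

lemma cl_vecs: "f \<in> L2 \<Longrightarrow> cl f \<in> vecs H"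
  by (simp add: vecs_eq)

text \<open>The operations of the GNS space are computed on representatives chosen by
  \<open>rep\<close>. Here and below their independence of the choice is settled once, so that later
  proofs work with arbitrary kernels.\<close>

lemma vadd_cl:
  assumes "f \<in> kern" "g \<in> kern"
  shows "vadd H (cl f) (cl g) = cl (\<lambda>p. f p + g p)"
proof -
  have "col_eq (\<lambda>p. rep (cl f) p + rep (cl g) p) (\<lambda>p. f p + g p)"
    using rep_cl(2)[OF assms(1)] rep_cl(2)[OF assms(2)] unfolding col_eq_def by eventually_elim simp
  then show ?thesis using cl_eq_iff[OF kern_add[OF rep_cl(1) rep_cl(1)] kern_add] assms by (simp add: gns_space_def)
qed

lemma vscale_cl:
  assumes "f \<in> kern"
  shows "vscale H c (cl f) = cl (\<lambda>p. c * f p)"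
proof -
  have "col_eq (\<lambda>p. c * rep (cl f) p) (\<lambda>p. c * f p)"
    using rep_cl(2)[OF assms(1)] unfolding col_eq_def by eventually_elim simp
  then show ?thesis using cl_eq_iff[OF kern_scale[OF rep_cl(1)] kern_scale] assms by (simp add: gns_space_def)
qed

lemma vinner_cl:
  assumes "f \<in> kern" "g \<in> kern"
  shows "vinner H (cl f) (cl g) = kernel_inner f g"
proof -
  have "vinner H (cl f) (cl g) = kernel_inner (rep (cl f)) (rep (cl g))"
    by (simp add: gns_space_def ktrace_def kmult_def kadj_def kernel_inner_def)
  also have "\<dots> = kernel_inner f g" using assms rep_cl by (intro kernel_inner_cong) auto
  finally show ?thesis .
qed

lemma vnorm_cl: "f \<in> L2 \<Longrightarrow> vnorm H (cl f) = sqrt (enn2real (gns_sq M f))"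
  by (simp add: vnorm_def vinner_cl L2_kern kernel_inner_self)

lemma vnorm_nonneg: "\<xi> \<in> vecs H \<Longrightarrow> 0 \<le> vnorm H \<xi>"
  by (auto simp: vecs_eq vnorm_cl)

lemma left_mult_cl:
  assumes "a \<in> kern" "f \<in> L2"
  shows "gns_left_mult M E a (cl f) = cl (kmult a f)"
proof -
  have f: "f \<in> kern" using assms(2) by (rule L2_kern)
  have "gns_left_mult M E a (cl f) = cl (kmult a (rep (cl f)))"
    using cl_vecs[OF assms(2)] by (simp add: gns_left_mult_def)
  also have "\<dots> = cl (kmult a f)"
    using cl_eq_iff[OF kmult_kern[OF assms(1) rep_cl(1)[OF f]] kmult_kern[OF assms(1) f]] kmult_col_eq[OF rep_cl(2)[OF f]] by simp
  finally show ?thesis .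
qed

lemma W_cl: "aut \<phi> \<Longrightarrow> C \<in> sets M \<Longrightarrow> f \<in> L2 \<Longrightarrow> W \<phi> C (cl f) = cl (translate \<phi> C f)"
  unfolding W_def by (simp add: left_mult_cl M0_kern graph_kernel_M0 kmult_graph_kernel)

lemma W_ext: "W \<phi> C \<in> extensional (vecs H)"
  by (simp add: W_def gns_left_mult_def)

lemma W_bounded:
  assumes "aut \<phi>" "C \<in> sets M"
  shows "W \<phi> C \<in> bounded_operators H"
proof -
  have "W \<phi> C (vadd H \<xi> \<eta>) = vadd H (W \<phi> C \<xi>) (W \<phi> C \<eta>)" if v: "\<xi> \<in> vecs H" "\<eta> \<in> vecs H" for \<xi> \<eta>
  proof -
    obtain f g where f: "f \<in> L2" "\<xi> = cl f" and g: "g \<in> L2" "\<eta> = cl g" using v by (auto simp: vecs_eq)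
    have "translate \<phi> C (\<lambda>p. f p + g p) = (\<lambda>p. translate \<phi> C f p + translate \<phi> C g p)" by (auto simp: translate_def)
    then show ?thesis using f g assms by (simp add: vadd_cl W_cl L2_kern L2_add translate_kern)
  qed
  moreover have "W \<phi> C (vscale H c \<xi>) = vscale H c (W \<phi> C \<xi>)" if v: "\<xi> \<in> vecs H" for c \<xi>
  proof -
    obtain f where f: "f \<in> L2" "\<xi> = cl f" using v by (auto simp: vecs_eq)
    have "translate \<phi> C (\<lambda>p. c * f p) = (\<lambda>p. c * translate \<phi> C f p)" by (auto simp: translate_def)
    then show ?thesis using f assms by (simp add: vscale_cl W_cl L2_kern L2_scale translate_kern)
  qed
  moreover have "vnorm H (W \<phi> C \<xi>) \<le> 1 * vnorm H \<xi>" if v: "\<xi> \<in> vecs H" for \<xi>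
  proof -
    obtain f where f: "f \<in> L2" "\<xi> = cl f" using v by (auto simp: vecs_eq)
    have "enn2real (gns_sq M (translate \<phi> C f)) \<le> enn2real (gns_sq M f)"
      using gns_sq_translate[OF assms] f by (intro enn2real_mono) (auto simp: L2_def)
    then show ?thesis using f assms by (simp add: W_cl vnorm_cl translate_L2)
  qed
  moreover have "W \<phi> C \<in> vecs H \<rightarrow>\<^sub>E vecs H"
    using W_ext assms by (auto simp: PiE_def vecs_eq W_cl translate_L2)
  ultimately show ?thesis unfolding bounded_operators_def by blast
qed

abbreviation "WC \<equiv> weak_closure H (gns_left_mult M E ` M0 M E)"

lemma carrier_vN: "carrier vN = WC"
  and mult_vN: "S \<otimes>\<^bsub>vN\<^esub> T = compose (vecs H) S T"
  and one_vN: "\<one>\<^bsub>vN\<^esub> = (\<lambda>\<xi>\<in>vecs H. \<xi>)"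
  and involution_vN: "involution vN = operator_adjoint H"
  and tau_vN: "tau vN T = vinner H (T (gns_unit M E)) (gns_unit M E)"
  by (simp_all add: vN_algebra_def operator_algebra_def)

lemma W_carrier:
  assumes "aut \<phi>" "C \<in> sets M"
  shows "W \<phi> C \<in> WC"
proof -
  have "\<exists>S\<in>gns_left_mult M E ` M0 M E. \<forall>(\<xi>, \<eta>)\<in>F. cmod (vinner H (W \<phi> C \<xi>) \<eta> - vinner H (S \<xi>) \<eta>) < \<epsilon>" if "\<epsilon> > 0" for F \<epsilon>
    using that graph_kernel_M0[OF assms] by (intro bexI[of _ "W \<phi> C"]) (auto simp: W_def)
  then show ?thesis using W_bounded[OF assms] unfolding weak_closure_def by simp
qed

lemma W_mult:
  assumes "aut \<phi>" "C \<in> sets M" "aut \<psi>" "D \<in> sets M"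
  shows "W \<phi> C \<otimes>\<^bsub>vN\<^esub> W \<psi> D = W (\<lambda>x. \<psi> (\<phi> x)) {x \<in> C. \<phi> x \<in> D}" "{x \<in> C. \<phi> x \<in> D} \<in> sets M"
proof -
  have "{x \<in> C. \<phi> x \<in> D} = C \<inter> (\<phi> -` D \<inter> space M)"
    using sets.sets_into_space[OF assms(2)] by auto
  also have "\<dots> \<in> sets M" using assms(2) measurable_sets[OF aut_meas[OF assms(1)] assms(4)] by (rule sets.Int)
  finally show s: "{x \<in> C. \<phi> x \<in> D} \<in> sets M" .
  have "compose (vecs H) (W \<phi> C) (W \<psi> D) = W (\<lambda>x. \<psi> (\<phi> x)) {x \<in> C. \<phi> x \<in> D}"
  proof (rule extensionalityI[OF compose_extensional W_ext])
    fix \<xi> assume v: "\<xi> \<in> vecs H"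
    then obtain f where f: "f \<in> L2" "\<xi> = cl f" by (auto simp: vecs_eq)
    have e: "translate \<phi> C (translate \<psi> D f) = translate (\<lambda>x. \<psi> (\<phi> x)) {x \<in> C. \<phi> x \<in> D} f" by (auto simp: translate_def)
    show "compose (vecs H) (W \<phi> C) (W \<psi> D) \<xi> = W (\<lambda>x. \<psi> (\<phi> x)) {x \<in> C. \<phi> x \<in> D} \<xi>"
      unfolding f(2) compose_eq[OF v[unfolded f(2)]] W_cl[OF assms(3,4) f(1)] W_cl[OF assms(1,2) translate_L2[OF assms(3,4) f(1)]]
        W_cl[OF aut_comp[OF assms(1,3)] s f(1)] e ..
  qed
  then show "W \<phi> C \<otimes>\<^bsub>vN\<^esub> W \<psi> D = W (\<lambda>x. \<psi> (\<phi> x)) {x \<in> C. \<phi> x \<in> D}" by (simp add: mult_vN)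
qed

lemma W_cong: "(\<And>x. x \<in> C \<Longrightarrow> \<phi> x = \<psi> x) \<Longrightarrow> W \<phi> C = W \<psi> C"
  unfolding W_def graph_kernel_def by (intro arg_cong[of _ _ "gns_left_mult M E"] ext) auto

lemma translate_id: "f \<in> kern \<Longrightarrow> translate (\<lambda>x. x) (space M) f = f"
  using kern_zero[of f] E_space by (auto simp: translate_def fun_eq_iff)

lemma W_one: "W (\<lambda>x. x) (space M) = \<one>\<^bsub>vN\<^esub>"
  unfolding one_vN
proof (rule extensionalityI[OF W_ext])
  fix \<xi> assume v: "\<xi> \<in> vecs H"
  then obtain f where f: "f \<in> L2" "\<xi> = cl f" by (auto simp: vecs_eq)
  then show "W (\<lambda>x. x) (space M) \<xi> = (\<lambda>\<xi>\<in>vecs H. \<xi>) \<xi>"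
    using v by (simp add: W_cl aut_id translate_id L2_kern)
qed simp

lemma kernel_inner_translate:
  assumes "f \<in> kern" "g \<in> kern"
  shows "kernel_inner (translate (t n) (space M) f) g = kernel_inner f (translate (t n) (space M) g)"
proof -
  have "(\<Sum>\<^sub>\<infinity>y. cnj (g (y, x)) * translate (t n) (space M) f (y, x)) = (\<Sum>\<^sub>\<infinity>y. cnj (translate (t n) (space M) g (y, x)) * f (y, x))" for x
  proof -
    have "(\<Sum>\<^sub>\<infinity>y. cnj (g (y, x)) * translate (t n) (space M) f (y, x)) = (\<Sum>\<^sub>\<infinity>y\<in>space M. cnj (g (y, x)) * f (t n y, x))"
      by (rule infsum_cong_neutral) (auto simp: translate_def)
    also have "\<dots> = (\<Sum>\<^sub>\<infinity>y\<in>space M. cnj (g (t n y, x)) * f (t n (t n y), x))"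
      using infsum_reindex_bij_betw[OF bij_t, of "\<lambda>y. cnj (g (y, x)) * f (t n y, x)" n] by simp
    also have "\<dots> = (\<Sum>\<^sub>\<infinity>y. cnj (translate (t n) (space M) g (y, x)) * f (y, x))"
      by (rule infsum_cong_neutral) (auto simp: translate_def t_inv)
    finally show ?thesis .
  qed
  then show ?thesis by (simp add: kernel_inner_def)
qed

lemma right_shift_kern:
  assumes "f \<in> kern"
  shows "right_shift n f \<in> kern"
proof (rule kernI)
  note [measurable] = assms[THEN kern_meas]
  have "(\<lambda>p. f (fst p, t n (snd p))) \<in> borel_measurable (M \<Otimes>\<^sub>M M)" by measurable
  moreover have "right_shift n f \<in> borel_measurable (M \<Otimes>\<^sub>M M) \<longleftrightarrow> (\<lambda>p. f (fst p, t n (snd p))) \<in> borel_measurable (M \<Otimes>\<^sub>M M)"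
    by (rule measurable_cong) (auto simp: right_shift_def space_pair_measure)
  ultimately show "right_shift n f \<in> borel_measurable (M \<Otimes>\<^sub>M M)" by (simp only:)
  fix p assume pE: "p \<notin> E"
  obtain y z where p: "p = (y, z)" by (cases p)
  have "f (y, t n z) = 0" if "z \<in> space M"
    using kern_zero[OF assms, of "(y, t n z)"] E_trans[of y "t n z" z] E_sym[OF t_E[OF that]] pE p by blast
  then show "right_shift n f p = 0" by (simp add: right_shift_def p)
qed

text \<open>Left translations permute the entries within a column, right translations permute the
  columns themselves, so here invariance of the measure under \<open>t n\<close> enters.\<close>

lemma gns_sq_right_shift:
  assumes "f \<in> kern"
  shows "gns_sq M (right_shift n f) = gns_sq M f"
proof -
  let ?S = "\<lambda>x. \<integral>\<^sup>+y. ennreal ((cmod (f (y, x)))\<^sup>2) \<partial>count_space UNIV"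
  note [measurable] = assms[THEN kern_meas]
  have m: "?S \<in> borel_measurable M"
    by (rule nn_integral_nu(2)[where F = "\<lambda>p. ennreal ((cmod (f p))\<^sup>2)"]) (measurable, simp add: kern_zero assms)
  have "gns_sq M (right_shift n f) = (\<integral>\<^sup>+x. ?S (t n x) \<partial>M)"
    unfolding gns_sq_def by (rule nn_integral_cong) (simp add: right_shift_def)
  also have "\<dots> = (\<integral>\<^sup>+x. ?S x \<partial>distr M M (t n))" by (rule nn_integral_distr[symmetric, OF t_meas]) (simp add: m)
  finally show ?thesis by (simp add: t_distr gns_sq_def)
qed

lemma right_shift_L2: "f \<in> L2 \<Longrightarrow> right_shift n f \<in> L2"
  by (simp add: L2_def right_shift_kern gns_sq_right_shift)

lemma kernel_inner_right_shift:
  assumes "f \<in> kern" "g \<in> kern"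
  shows "kernel_inner (right_shift n f) g = kernel_inner f (right_shift n g)"
proof -
  let ?h = "\<lambda>x. \<Sum>\<^sub>\<infinity>y. cnj (right_shift n g (y, x)) * f (y, x)"
  have m: "?h \<in> borel_measurable M" using assms right_shift_kern by (intro kernel_inner_measurable)
  have "kernel_inner (right_shift n f) g = (LINT x|M. ?h (t n x))" unfolding kernel_inner_def
    by (rule Bochner_Integration.integral_cong) (auto simp: right_shift_def t_space t_inv)
  also have "\<dots> = (LINT x|distr M M (t n). ?h x)" by (rule integral_distr[symmetric, OF t_meas m])
  finally show ?thesis by (simp add: t_distr kernel_inner_def)
qed

lemma kmult_right_shift: "kmult a (right_shift n f) = right_shift n (kmult a f)"
  by (auto simp: kmult_def right_shift_def fun_eq_iff)

lemma WC_vecs: "T \<in> WC \<Longrightarrow> \<xi> \<in> vecs H \<Longrightarrow> T \<xi> \<in> vecs H"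
  unfolding weak_closure_def bounded_operators_def by auto

lemma WC_approx:
  assumes "T \<in> WC" "finite F" "F \<subseteq> vecs H \<times> vecs H" "\<epsilon> > 0"
  shows "\<exists>a. a \<in> M0 M E \<and> (\<forall>(\<xi>, \<eta>)\<in>F. cmod (vinner H (T \<xi>) \<eta> - vinner H (gns_left_mult M E a \<xi>) \<eta>) < \<epsilon>)"
proof -
  have "\<exists>S\<in>gns_left_mult M E ` M0 M E. \<forall>(\<xi>, \<eta>)\<in>F. cmod (vinner H (T \<xi>) \<eta> - vinner H (S \<xi>) \<eta>) < \<epsilon>"
    using assms unfolding weak_closure_def by simp
  then show ?thesis by (elim bexE imageE) (intro exI conjI, assumption, simp)
qed

text \<open>Right translations commute with all left multiplications, hence with the weak closure. This
  lets the cyclic vector determine the conjugate of an operator by \<open>U n\<close>.\<close>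

lemma WC_commute_right_shift:
  assumes T: "T \<in> WC" and f: "f \<in> L2" and g: "g \<in> L2" "T (cl f) = cl g"
  shows "T (cl (right_shift n f)) = cl (right_shift n g)"
proof -
  obtain g' where g': "g' \<in> L2" "T (cl (right_shift n f)) = cl g'"
    using WC_vecs[OF T cl_vecs[OF right_shift_L2[OF f, of n]]] by (auto simp: vecs_eq)
  have "kernel_inner g' h = kernel_inner (right_shift n g) h" if h: "h \<in> L2" for h
  proof (rule ccontr)
    assume ne: "\<not> ?thesis"
    define \<epsilon> where "\<epsilon> = cmod (kernel_inner g' h - kernel_inner (right_shift n g) h) / 2"
    have "\<epsilon> > 0" using ne by (simp add: \<epsilon>_def)
    \<comment> \<open>A single approximant must serve both pairs. Moving the right translation
      across the inner product makes its two matrix coefficients equal, so the discrepancy is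
      smaller than \<open>\<epsilon> + \<epsilon>\<close>, which is its own value.\<close>
    have "{(cl (right_shift n f), cl h), (cl f, cl (right_shift n h))} \<subseteq> vecs H \<times> vecs H" using cl_vecs f h right_shift_L2 by simp
    from WC_approx[OF T _ this \<open>\<epsilon> > 0\<close>] obtain a where a': "a \<in> M0 M E \<and>
        (\<forall>(\<xi>, \<eta>)\<in>{(cl (right_shift n f), cl h), (cl f, cl (right_shift n h))}. cmod (vinner H (T \<xi>) \<eta> - vinner H (gns_left_mult M E a \<xi>) \<eta>) < \<epsilon>)"
      by (elim exE meta_impE) simp_all
    then have a: "a \<in> M0 M E" "\<And>\<xi> \<eta>. (\<xi>, \<eta>) \<in> {(cl (right_shift n f), cl h), (cl f, cl (right_shift n h))} \<Longrightarrow>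
        cmod (vinner H (T \<xi>) \<eta> - vinner H (gns_left_mult M E a \<xi>) \<eta>) < \<epsilon>" by auto
    note k = f[THEN L2_kern] h[THEN L2_kern] g(1)[THEN L2_kern] g'(1)[THEN L2_kern] M0_kern[OF a(1)]
    have "cmod (kernel_inner g' h - kernel_inner (kmult a (right_shift n f)) h) < \<epsilon>"
      using a(2)[of "cl (right_shift n f)" "cl h"] k right_shift_L2[OF f, of n] by (simp add: g'(2) left_mult_cl vinner_cl kmult_kern right_shift_kern)
    moreover have "cmod (kernel_inner g (right_shift n h) - kernel_inner (kmult a f) (right_shift n h)) < \<epsilon>"
      using a(2)[of "cl f" "cl (right_shift n h)"] k f by (simp add: g(2) left_mult_cl vinner_cl kmult_kern right_shift_kern)
    moreover have "kernel_inner (kmult a f) (right_shift n h) = kernel_inner (kmult a (right_shift n f)) h" "kernel_inner g (right_shift n h) = kernel_inner (right_shift n g) h"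
      using k by (simp_all add: kmult_right_shift kernel_inner_right_shift kmult_kern)
    ultimately have "cmod (kernel_inner g' h - kernel_inner (right_shift n g) h) < \<epsilon> + \<epsilon>"
      using norm_triangle_ineq4[of "kernel_inner g' h - kernel_inner (kmult a (right_shift n f)) h" "kernel_inner (right_shift n g) h - kernel_inner (kmult a (right_shift n f)) h"] by simp
    then show False by (simp add: \<epsilon>_def)
  qed
  then have "col_eq g' (right_shift n g)" by (intro kernel_inner_nondegenerate g' right_shift_L2 g) auto
  then show ?thesis using g' cl_eq_iff L2_kern right_shift_L2[OF g(1)] by auto
qed

section \<open>The unitaries of the involutions normalize the Cartan subalgebra\<close>

abbreviation "U n \<equiv> W (t n) (space M)"

lemma U_U: "U n \<otimes>\<^bsub>vN\<^esub> U n = \<one>\<^bsub>vN\<^esub>"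
proof -
  have "{x \<in> space M. t n x \<in> space M} = space M" using t_space by auto
  then have "U n \<otimes>\<^bsub>vN\<^esub> U n = W (\<lambda>x. t n (t n x)) (space M)" using W_mult(1)[OF aut_t _ aut_t, of "space M" "space M" n n] by simp
  also have "\<dots> = W (\<lambda>x. x) (space M)" by (rule W_cong) (simp add: t_inv)
  finally show ?thesis by (simp add: W_one)
qed

text \<open>As \<open>operator_adjoint\<close> is a definite description, uniqueness has to be shown
  as well; it follows from nondegeneracy of the inner product.\<close>

lemma U_adjoint: "operator_adjoint H (U n) = U n"
  unfolding operator_adjoint_def
proof (rule the_equality)
  have U: "vinner H (U n \<xi>) \<eta> = vinner H \<xi> (U n \<eta>)" if v: "\<xi> \<in> vecs H" "\<eta> \<in> vecs H" for \<xi> \<eta>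
  proof -
    obtain f g where f: "f \<in> L2" "\<xi> = cl f" and g: "g \<in> L2" "\<eta> = cl g" using v by (auto simp: vecs_eq)
    then show ?thesis by (simp add: W_cl aut_t vinner_cl L2_kern translate_kern kernel_inner_translate)
  qed
  then show "U n \<in> bounded_operators H \<and> (\<forall>\<xi>\<in>vecs H. \<forall>\<eta>\<in>vecs H. vinner H (U n \<xi>) \<eta> = vinner H \<xi> (U n \<eta>))"
    using W_bounded[OF aut_t, of "space M"] by simp
  fix S assume S: "S \<in> bounded_operators H \<and> (\<forall>\<xi>\<in>vecs H. \<forall>\<eta>\<in>vecs H. vinner H (U n \<xi>) \<eta> = vinner H \<xi> (S \<eta>))"
  then have SE: "S \<in> vecs H \<rightarrow>\<^sub>E vecs H" by (simp add: bounded_operators_def)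
  show "S = U n"
  proof (rule extensionalityI[OF _ W_ext])
    show "S \<in> extensional (vecs H)" using SE by (simp add: PiE_def)
    fix \<eta> assume v: "\<eta> \<in> vecs H"
    then obtain g where g: "g \<in> L2" "\<eta> = cl g" by (auto simp: vecs_eq)
    have "S \<eta> \<in> vecs H" using SE v by auto
    then obtain s where s: "s \<in> L2" "S \<eta> = cl s" by (auto simp: vecs_eq)
    have u: "U n \<eta> = cl (translate (t n) (space M) g)" "translate (t n) (space M) g \<in> L2" using g by (simp_all add: W_cl aut_t translate_L2)
    have "kernel_inner h s = kernel_inner h (translate (t n) (space M) g)" if h: "h \<in> L2" for h
    proof -
      have "vinner H (cl h) (S \<eta>) = vinner H (cl h) (U n \<eta>)" using S U v cl_vecs[OF h] by metis
      then show ?thesis using s u h by (simp add: vinner_cl L2_kern)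
    qed
    then have "col_eq s (translate (t n) (space M) g)" by (intro kernel_inner_nondegenerate s u) auto
    then show "S \<eta> = U n \<eta>" using s u cl_eq_iff L2_kern by auto
  qed
qed

lemma bounded_compose:
  assumes S: "S \<in> bounded_operators H" and T: "T \<in> bounded_operators H"
  shows "compose (vecs H) S T \<in> bounded_operators H"
proof -
  have S': "S \<in> vecs H \<rightarrow>\<^sub>E vecs H" "\<And>\<xi> \<eta>. \<xi> \<in> vecs H \<Longrightarrow> \<eta> \<in> vecs H \<Longrightarrow> S (vadd H \<xi> \<eta>) = vadd H (S \<xi>) (S \<eta>)"
    "\<And>c \<xi>. \<xi> \<in> vecs H \<Longrightarrow> S (vscale H c \<xi>) = vscale H c (S \<xi>)" using S by (auto simp: bounded_operators_def)
  have T': "T \<in> vecs H \<rightarrow>\<^sub>E vecs H" "\<And>\<xi> \<eta>. \<xi> \<in> vecs H \<Longrightarrow> \<eta> \<in> vecs H \<Longrightarrow> T (vadd H \<xi> \<eta>) = vadd H (T \<xi>) (T \<eta>)"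
    "\<And>c \<xi>. \<xi> \<in> vecs H \<Longrightarrow> T (vscale H c \<xi>) = vscale H c (T \<xi>)" using T by (auto simp: bounded_operators_def)
  obtain K where K: "\<And>\<xi>. \<xi> \<in> vecs H \<Longrightarrow> vnorm H (S \<xi>) \<le> K * vnorm H \<xi>" using S unfolding bounded_operators_def by blast
  obtain L where L: "\<And>\<xi>. \<xi> \<in> vecs H \<Longrightarrow> vnorm H (T \<xi>) \<le> L * vnorm H \<xi>" using T unfolding bounded_operators_def by blast
  have Tv: "T \<xi> \<in> vecs H" if "\<xi> \<in> vecs H" for \<xi> using T'(1) that by auto
  have add: "vadd H \<xi> \<eta> \<in> vecs H" if "\<xi> \<in> vecs H" "\<eta> \<in> vecs H" for \<xi> \<eta>
    using that by (auto simp: vecs_eq vadd_cl L2_kern L2_add)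
  have scale: "vscale H c \<xi> \<in> vecs H" if "\<xi> \<in> vecs H" for c \<xi>
    using that by (auto simp: vecs_eq vscale_cl L2_kern L2_scale)
  have "vnorm H (S (T \<xi>)) \<le> (\<bar>K\<bar> * L) * vnorm H \<xi>" if v: "\<xi> \<in> vecs H" for \<xi>
  proof -
    have "vnorm H (S (T \<xi>)) \<le> K * vnorm H (T \<xi>)" using K Tv[OF v] by blast
    also have "\<dots> \<le> \<bar>K\<bar> * vnorm H (T \<xi>)" using vnorm_nonneg[OF Tv[OF v]] by (intro mult_right_mono) auto
    also have "\<dots> \<le> \<bar>K\<bar> * (L * vnorm H \<xi>)" using L[OF v] by (intro mult_left_mono) auto
    finally show ?thesis by (simp add: mult.assoc)
  qed
  then have "\<exists>K. \<forall>\<xi>\<in>vecs H. vnorm H (compose (vecs H) S T \<xi>) \<le> K * vnorm H \<xi>"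
    by (intro exI[of _ "\<bar>K\<bar> * L"]) (simp add: compose_eq)
  moreover have "compose (vecs H) S T \<in> vecs H \<rightarrow>\<^sub>E vecs H"
    using S'(1) Tv by (auto simp: PiE_def compose_def)
  ultimately show ?thesis unfolding bounded_operators_def
    using S'(2,3) T'(2,3) Tv add scale by (simp add: compose_eq)
qed

text \<open>The kernel of the conjugate of \<open>a\<close> by \<open>U n\<close>, see
  \<open>kmult_conj_kernel\<close>.\<close>

definition conj_kernel :: "nat \<Rightarrow> 'a kernel \<Rightarrow> 'a kernel" where
  "conj_kernel n a = (\<lambda>(x, y). if x \<in> space M \<and> y \<in> space M then a (t n x, t n y) else 0)"

lemma conj_kernel_M0:
  assumes a: "a \<in> M0 M E"
  shows "conj_kernel n a \<in> M0 M E"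
proof -
  note [measurable] = M0_kern[OF a, THEN kern_meas]
  obtain K m where K: "\<And>p. cmod (a p) \<le> K" and m: "\<And>x. finite {y. a (x, y) \<noteq> 0} \<and> card {y. a (x, y) \<noteq> 0} \<le> m \<and>
              finite {y. a (y, x) \<noteq> 0} \<and> card {y. a (y, x) \<noteq> 0} \<le> m"
    using a unfolding M0_def by blast
  have "conj_kernel n a \<in> kern"
  proof (rule kernI)
    have "(\<lambda>p. a (t n (fst p), t n (snd p))) \<in> borel_measurable (M \<Otimes>\<^sub>M M)" by measurable
    moreover have "conj_kernel n a \<in> borel_measurable (M \<Otimes>\<^sub>M M) \<longleftrightarrow> (\<lambda>p. a (t n (fst p), t n (snd p))) \<in> borel_measurable (M \<Otimes>\<^sub>M M)"
      by (rule measurable_cong) (auto simp: conj_kernel_def space_pair_measure)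
    ultimately show "conj_kernel n a \<in> borel_measurable (M \<Otimes>\<^sub>M M)" by (simp only:)
    fix p assume pE: "p \<notin> E"
    obtain x y where p: "p = (x, y)" by (cases p)
    have "a (t n x, t n y) = 0" if "x \<in> space M" "y \<in> space M"
      using kern_zero[OF M0_kern[OF a], of "(t n x, t n y)"] E_trans[OF E_trans[OF t_E[OF that(1)]] E_sym[OF t_E[OF that(2)]]] pE p by blast
    then show "conj_kernel n a p = 0" by (simp add: conj_kernel_def p)
  qed
  moreover have "cmod (conj_kernel n a p) \<le> max K 0" for p
    using K by (auto simp: conj_kernel_def le_max_iff_disj split: prod.splits)
  moreover have "finite {y. conj_kernel n a (x, y) \<noteq> 0} \<and> card {y. conj_kernel n a (x, y) \<noteq> 0} \<le> m \<and>
              finite {y. conj_kernel n a (y, x) \<noteq> 0} \<and> card {y. conj_kernel n a (y, x) \<noteq> 0} \<le> m" for x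
  proof -
    have s: "{y. conj_kernel n a (x, y) \<noteq> 0} \<subseteq> t n ` {y. a (t n x, y) \<noteq> 0}"
      "{y. conj_kernel n a (y, x) \<noteq> 0} \<subseteq> t n ` {y. a (y, t n x) \<noteq> 0}"
      using t_inv by (auto simp: conj_kernel_def intro!: image_eqI[where x = "t n _"] split: if_splits)
    have f: "finite {y. a (t n x, y) \<noteq> 0}" "card {y. a (t n x, y) \<noteq> 0} \<le> m"
      "finite {y. a (y, t n x) \<noteq> 0}" "card {y. a (y, t n x) \<noteq> 0} \<le> m" using m by auto
    show ?thesis
      using finite_subset[OF s(1) finite_imageI[OF f(1)]] finite_subset[OF s(2) finite_imageI[OF f(3)]]
        card_mono[OF finite_imageI[OF f(1)] s(1)] card_mono[OF finite_imageI[OF f(3)] s(2)]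
        card_image_le[OF f(1), of "t n"] card_image_le[OF f(3), of "t n"] f by linarith
  qed
  ultimately show ?thesis unfolding M0_def by blast
qed

lemma kmult_conj_kernel:
  "kmult (conj_kernel n a) f = translate (t n) (space M) (kmult a (translate (t n) (space M) f))"
  if "a \<in> kern"
proof (rule ext, clarify)
  fix x z
  show "kmult (conj_kernel n a) f (x, z) = translate (t n) (space M) (kmult a (translate (t n) (space M) f)) (x, z)"
  proof (cases "x \<in> space M")
    case True
    have "(\<Sum>\<^sub>\<infinity>y. conj_kernel n a (x, y) * f (y, z)) = (\<Sum>\<^sub>\<infinity>y\<in>space M. a (t n x, t n y) * f (y, z))"
      by (rule infsum_cong_neutral) (auto simp: conj_kernel_def True)
    also have "\<dots> = (\<Sum>\<^sub>\<infinity>y\<in>space M. a (t n x, t n (t n y)) * f (t n y, z))"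
      using infsum_reindex_bij_betw[OF bij_t, of "\<lambda>y. a (t n x, t n y) * f (y, z)" n] by simp
    also have "\<dots> = (\<Sum>\<^sub>\<infinity>y. a (t n x, y) * translate (t n) (space M) f (y, z))"
      by (rule infsum_cong_neutral) (auto simp: translate_def t_inv)
    finally show ?thesis using True by (simp add: kmult_def translate_def)
  next
    case False
    then show ?thesis by (simp add: kmult_def translate_def conj_kernel_def)
  qed
qed

text \<open>Conjugation by a fixed \<open>U n\<close> can be shifted to the test vectors: a kernel
  that approximates \<open>T\<close> at the pairs \<open>(U n \<xi>, U n \<eta>)\<close> yields,
  after conjugation, one that approximates the conjugate of \<open>T\<close> at
  \<open>(\<xi>, \<eta>)\<close>.\<close>

lemma U_conj_WC:
  assumes T: "T \<in> WC"
  shows "U n \<otimes>\<^bsub>vN\<^esub> T \<otimes>\<^bsub>vN\<^esub> U n \<in> WC"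
proof -
  have Tb: "T \<in> bounded_operators H" using T by (simp add: weak_closure_def)
  have Ub: "U n \<in> bounded_operators H" by (rule W_bounded[OF aut_t]) simp
  have Uv: "U n \<xi> \<in> vecs H" if "\<xi> \<in> vecs H" for \<xi>
    using that by (auto simp: vecs_eq W_cl aut_t translate_L2)
  let ?T = "compose (vecs H) (compose (vecs H) (U n) T) (U n)"
  have "\<exists>S\<in>gns_left_mult M E ` M0 M E. \<forall>(\<xi>, \<eta>)\<in>F. cmod (vinner H (?T \<xi>) \<eta> - vinner H (S \<xi>) \<eta>) < \<epsilon>"
    if F: "finite F \<and> F \<subseteq> vecs H \<times> vecs H \<and> \<epsilon> > 0" for F \<epsilon>
  proof -
    have fin: "finite ((\<lambda>(\<xi>, \<eta>). (U n \<xi>, U n \<eta>)) ` F)" and e: "\<epsilon> > 0" using F by simp_all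
    have sub: "(\<lambda>(\<xi>, \<eta>). (U n \<xi>, U n \<eta>)) ` F \<subseteq> vecs H \<times> vecs H" using F Uv by auto
    from WC_approx[OF T fin sub e] obtain a where a': "a \<in> M0 M E \<and> (\<forall>(\<xi>, \<eta>)\<in>(\<lambda>(\<xi>, \<eta>). (U n \<xi>, U n \<eta>)) ` F.
        cmod (vinner H (T \<xi>) \<eta> - vinner H (gns_left_mult M E a \<xi>) \<eta>) < \<epsilon>)" by (elim exE)
    then have a: "a \<in> M0 M E" "\<And>\<xi> \<eta>. (\<xi>, \<eta>) \<in> (\<lambda>(\<xi>, \<eta>). (U n \<xi>, U n \<eta>)) ` F \<Longrightarrow>
        cmod (vinner H (T \<xi>) \<eta> - vinner H (gns_left_mult M E a \<xi>) \<eta>) < \<epsilon>" by auto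
    have "cmod (vinner H (?T \<xi>) \<eta> - vinner H (gns_left_mult M E (conj_kernel n a) \<xi>) \<eta>) < \<epsilon>" if p: "(\<xi>, \<eta>) \<in> F" for \<xi> \<eta>
    proof -
      have v: "\<xi> \<in> vecs H" "\<eta> \<in> vecs H" using p F by auto
      obtain f h where f: "f \<in> L2" "\<xi> = cl f" and h: "h \<in> L2" "\<eta> = cl h" using v by (auto simp: vecs_eq)
      have uf: "translate (t n) (space M) f \<in> L2" "translate (t n) (space M) h \<in> L2" using f h by (simp_all add: translate_L2 aut_t)
      obtain g where g: "g \<in> L2" "T (cl (translate (t n) (space M) f)) = cl g"
        using WC_vecs[OF T cl_vecs[OF uf(1)]] by (auto simp: vecs_eq)
      note k = L2_kern[OF f(1)] L2_kern[OF h(1)] L2_kern[OF g(1)] uf[THEN L2_kern] M0_kern[OF a(1)] M0_kern[OF conj_kernel_M0[OF a(1)]]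
      have 1: "vinner H (?T \<xi>) \<eta> = kernel_inner g (translate (t n) (space M) h)"
        using v Uv[OF v(1)] f h g uf k by (simp add: compose_eq W_cl aut_t vinner_cl translate_kern kernel_inner_translate)
      have 2: "vinner H (gns_left_mult M E (conj_kernel n a) \<xi>) \<eta> = kernel_inner (kmult a (translate (t n) (space M) f)) (translate (t n) (space M) h)"
        using f h k by (simp add: left_mult_cl kmult_conj_kernel vinner_cl translate_kern aut_t kmult_kern kernel_inner_translate)
      have "(U n \<xi>, U n \<eta>) \<in> (\<lambda>(\<xi>, \<eta>). (U n \<xi>, U n \<eta>)) ` F" using p by force
      from a(2)[OF this] show ?thesis unfolding 1 2
        using f h g uf k by (simp add: W_cl aut_t left_mult_cl vinner_cl kmult_kern)
    qed
    then show ?thesis using conj_kernel_M0[OF a(1), of n] by (intro bexI[of _ "gns_left_mult M E (conj_kernel n a)"]) auto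
  qed
  moreover have "?T \<in> bounded_operators H" by (intro bounded_compose Ub Tb)
  ultimately show ?thesis unfolding weak_closure_def mult_vN by blast
qed

lemma one_kernel_L2: "one_kernel \<in> L2"
proof -
  have "one_kernel = graph_kernel (\<lambda>x. x) (space M)" by (auto simp: graph_kernel_def indicator_def fun_eq_iff)
  then show ?thesis using M0_L2[OF graph_kernel_M0[OF aut_id sets.top]] by simp
qed

lemma unit_eq: "gns_unit M E = cl one_kernel"
  by (simp add: gns_unit_def)

abbreviation "cartan \<equiv> cartan_subalgebra M E"

lemma cartan_rep:
  assumes "T \<in> cartan"
  shows "\<exists>f. f \<in> L2 \<and> T (cl one_kernel) = cl f \<and> (\<forall>x y. f (x, y) \<noteq> 0 \<longrightarrow> x = y)"
proof -
  have T: "T \<in> WC" using assms by (simp add: cartan_subalgebra_def carrier_vN)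
  obtain f where f: "f \<in> T (cl one_kernel)" "\<And>x y. f (x, y) \<noteq> 0 \<Longrightarrow> x = y"
    using assms by (auto simp: cartan_subalgebra_def unit_eq)
  obtain g where g: "g \<in> L2" "T (cl one_kernel) = cl g"
    using WC_vecs[OF T cl_vecs[OF one_kernel_L2]] by (auto simp: vecs_eq)
  have c: "f \<in> kern" "col_eq f g" using f(1) g L2_kern by (auto simp: mem_cl)
  have "f \<in> L2" using c(1) gns_sq_cong[OF c(2)] g(1) by (simp add: L2_def)
  moreover have "T (cl one_kernel) = cl f" using c g cl_eq_iff[OF c(1) L2_kern[OF g(1)]] by simp
  ultimately show ?thesis using f(2) by (intro exI[of _ f]) simp
qed

lemma U_conj_cartan:
  assumes T: "T \<in> cartan"
  shows "U n \<otimes>\<^bsub>vN\<^esub> T \<otimes>\<^bsub>vN\<^esub> U n \<in> cartan"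
proof -
  have TW: "T \<in> WC" using T by (simp add: cartan_subalgebra_def carrier_vN)
  obtain f where f': "f \<in> L2 \<and> T (cl one_kernel) = cl f \<and> (\<forall>x y. f (x, y) \<noteq> 0 \<longrightarrow> x = y)"
    using cartan_rep[OF T] by (elim exE)
  then have f: "f \<in> L2" "T (cl one_kernel) = cl f" "\<And>x y. f (x, y) \<noteq> 0 \<Longrightarrow> x = y" by simp_all
  \<comment> \<open>On the cyclic vector, left and right translation by an involution agree. Hence
    the conjugate of \<open>T\<close> maps it to the left translate of the right translate of
    \<open>f\<close>, whose entry at \<open>(x, y)\<close> is \<open>f (t n x, t n y)\<close>; this
    is again diagonal.\<close>
  have eq: "translate (t n) (space M) one_kernel = right_shift n one_kernel"
  proof (rule ext, clarify)
    fix x z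
    have "x \<in> space M \<and> t n x = z \<longleftrightarrow> z \<in> space M \<and> x = t n z" using t_inv t_space by metis
    then show "translate (t n) (space M) one_kernel (x, z) = right_shift n one_kernel (x, z)"
      using t_space[of x n] t_space[of z n] by (auto simp: translate_def right_shift_def indicator_def)
  qed
  have U1: "U n (cl one_kernel) = cl (right_shift n one_kernel)" by (simp add: W_cl aut_t one_kernel_L2 eq)
  have v: "cl (right_shift n one_kernel) \<in> vecs H" "cl one_kernel \<in> vecs H" by (simp_all add: cl_vecs right_shift_L2 one_kernel_L2)
  have "compose (vecs H) (compose (vecs H) (U n) T) (U n) (cl one_kernel) = cl (translate (t n) (space M) (right_shift n f))"
    using v f by (simp add: compose_eq U1 WC_commute_right_shift[OF TW one_kernel_L2 f(1,2)] W_cl aut_t right_shift_L2)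
  moreover have "translate (t n) (space M) (right_shift n f) \<in> cl (translate (t n) (space M) (right_shift n f))"
    using f by (simp add: mem_cl translate_kern aut_t right_shift_kern L2_kern)
  moreover have "x = y" if "translate (t n) (space M) (right_shift n f) (x, y) \<noteq> 0" for x y
  proof -
    have "x \<in> space M" "y \<in> space M" "f (t n x, t n y) \<noteq> 0" using that by (auto simp: translate_def right_shift_def split: if_splits)
    then show ?thesis using f(3) t_inv by metis
  qed
  ultimately show ?thesis using U_conj_WC[OF TW] unfolding cartan_subalgebra_def carrier_vN unit_eq mult_vN by auto
qed

lemma U_normalizer: "U n \<in> normalizer_group vN cartan"
proof -
  have Uc: "U n \<in> WC" by (rule W_carrier[OF aut_t]) simp
  have "U n \<in> unitaries vN" unfolding unitaries_def involution_vN using Uc U_U by (simp add: U_adjoint carrier_vN)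
  moreover have "(\<lambda>T. U n \<otimes>\<^bsub>vN\<^esub> T \<otimes>\<^bsub>vN\<^esub> U n) ` cartan = cartan"
  proof (intro equalityI subsetI)
    fix T assume T: "T \<in> cartan"
    have TW: "T \<in> bounded_operators H" using T by (simp add: cartan_subalgebra_def carrier_vN weak_closure_def)
    have Uv: "U n \<xi> \<in> vecs H" "U n (U n \<xi>) = \<xi>" if "\<xi> \<in> vecs H" for \<xi>
    proof -
      show "U n \<xi> \<in> vecs H" using that by (auto simp: vecs_eq W_cl aut_t translate_L2)
      have "compose (vecs H) (U n) (U n) \<xi> = \<xi>" using U_U[of n] that by (simp add: mult_vN one_vN)
      then show "U n (U n \<xi>) = \<xi>" using that by (simp add: compose_eq)
    qed
    let ?T = "U n \<otimes>\<^bsub>vN\<^esub> T \<otimes>\<^bsub>vN\<^esub> U n"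
    have "U n \<otimes>\<^bsub>vN\<^esub> ?T \<otimes>\<^bsub>vN\<^esub> U n = T"
    proof (rule extensionalityI[of _ "vecs H"])
      show "U n \<otimes>\<^bsub>vN\<^esub> ?T \<otimes>\<^bsub>vN\<^esub> U n \<in> extensional (vecs H)" by (simp add: mult_vN)
      show "T \<in> extensional (vecs H)" using TW by (simp add: bounded_operators_def PiE_def)
      fix \<xi> assume v: "\<xi> \<in> vecs H"
      have "T \<xi> \<in> vecs H" using TW v by (auto simp: bounded_operators_def)
      then show "(U n \<otimes>\<^bsub>vN\<^esub> ?T \<otimes>\<^bsub>vN\<^esub> U n) \<xi> = T \<xi>" using v Uv by (simp add: mult_vN compose_eq)
    qed
    then show "T \<in> (\<lambda>T. U n \<otimes>\<^bsub>vN\<^esub> T \<otimes>\<^bsub>vN\<^esub> U n) ` cartan" using U_conj_cartan[OF T] by (intro image_eqI[of T _ ?T]) simp_all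
  qed (use U_conj_cartan in auto)
  ultimately show ?thesis unfolding normalizer_group_def involution_vN by (simp add: U_adjoint)
qed

section \<open>Projections in the Cartan subalgebra\<close>

abbreviation "P C \<equiv> W (\<lambda>x. x) C"

lemma P_cartan:
  assumes "C \<in> sets M"
  shows "P C \<in> cartan"
proof -
  have "P C (cl one_kernel) = cl (translate (\<lambda>x. x) C one_kernel)" using assms by (simp add: W_cl aut_id one_kernel_L2)
  moreover have "translate (\<lambda>x. x) C one_kernel \<in> cl (translate (\<lambda>x. x) C one_kernel)"
    using assms by (simp add: mem_cl translate_kern aut_id L2_kern one_kernel_L2)
  moreover have "x = y" if "translate (\<lambda>x. x) C one_kernel (x, y) \<noteq> 0" for x y
    using that by (auto simp: translate_def indicator_def split: if_splits)
  ultimately show ?thesis using W_carrier[OF aut_id assms] unfolding cartan_subalgebra_def carrier_vN unit_eq by auto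
qed

lemma P_tau:
  assumes C: "C \<in> sets M"
  shows "tau vN (P C) = complex_of_real (measure M C)"
proof -
  have CM: "C \<subseteq> space M" using sets.sets_into_space[OF C] .
  have "tau vN (P C) = kernel_inner (translate (\<lambda>x. x) C one_kernel) one_kernel"
    using C by (simp add: tau_vN unit_eq W_cl aut_id one_kernel_L2 vinner_cl translate_kern L2_kern)
  also have "\<dots> = (LINT x|M. complex_of_real (indicator C x))" unfolding kernel_inner_def
  proof (rule Bochner_Integration.integral_cong[OF refl])
    fix x assume x: "x \<in> space M"
    have "(\<Sum>\<^sub>\<infinity>y. cnj (one_kernel (y, x)) * translate (\<lambda>x. x) C one_kernel (y, x)) = (\<Sum>\<^sub>\<infinity>y. if y = x then complex_of_real (indicator C y) else 0)"
      by (rule infsum_cong) (use x CM in \<open>auto simp: translate_def indicator_def\<close>)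
    then show "(\<Sum>\<^sub>\<infinity>y. cnj (one_kernel (y, x)) * translate (\<lambda>x. x) C one_kernel (y, x)) = complex_of_real (indicator C x)"
      by (simp add: infsum_delta)
  qed
  also have "\<dots> = complex_of_real (LINT x|M. indicator C x)" by (rule integral_complex_of_real)
  also have "(LINT x|M. indicator C x) = measure M C" using C CM by (simp add: Int_absorb2)
  finally show ?thesis .
qed

end

section \<open>Tracial ultraproducts of matrix algebras\<close>

text \<open>The unnormalized squared Hilbert-Schmidt norm, on entry functions rather than matrices,
  so that sums can be rearranged without dimension conditions.\<close>

definition hs_sq :: "nat \<Rightarrow> (nat \<Rightarrow> nat \<Rightarrow> complex) \<Rightarrow> real" where
  "hs_sq m a = (\<Sum>i<m. \<Sum>j<m. (cmod (a i j))\<^sup>2)"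

text \<open>A bound on the operator norm in squared form; the sign of \<open>K\<close> does not
  matter.\<close>

definition op_bounded :: "nat \<Rightarrow> real \<Rightarrow> (nat \<Rightarrow> nat \<Rightarrow> complex) \<Rightarrow> bool" where
  "op_bounded m K a \<longleftrightarrow> (\<forall>v. (\<Sum>i<m. (cmod (\<Sum>k<m. a i k * v k))\<^sup>2) \<le> K\<^sup>2 * (\<Sum>k<m. (cmod (v k))\<^sup>2))"

lemma hs_sq_swap: "hs_sq m (\<lambda>i j. cnj (a j i)) = hs_sq m a"
  unfolding hs_sq_def by (subst sum.swap) simp

lemma hs_sq_nonneg: "0 \<le> hs_sq m a"
  unfolding hs_sq_def by (intro sum_nonneg) auto

lemma hs_sq_add: "hs_sq m (\<lambda>i j. a i j + b i j) \<le> 2 * hs_sq m a + 2 * hs_sq m b"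
proof -
  have "(cmod (x + y))\<^sup>2 \<le> 2 * (cmod x)\<^sup>2 + 2 * (cmod y)\<^sup>2" for x y
  proof -
    have "(cmod (x + y))\<^sup>2 \<le> (cmod x + cmod y)\<^sup>2" by (intro power_mono norm_triangle_ineq) auto
    also have "\<dots> \<le> 2 * (cmod x)\<^sup>2 + 2 * (cmod y)\<^sup>2"
      using zero_le_power2[of "cmod x - cmod y"] by (simp add: power2_eq_square algebra_simps)
    finally show ?thesis .
  qed
  then show ?thesis unfolding hs_sq_def sum_distrib_left sum.distrib[symmetric] by (intro sum_mono)
qed

lemma hs_sq_mult_left:
  assumes "op_bounded m K a"
  shows "hs_sq m (\<lambda>i j. \<Sum>k<m. a i k * b k j) \<le> K\<^sup>2 * hs_sq m b"
proof -
  have "hs_sq m (\<lambda>i j. \<Sum>k<m. a i k * b k j) = (\<Sum>j<m. \<Sum>i<m. (cmod (\<Sum>k<m. a i k * b k j))\<^sup>2)"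
    unfolding hs_sq_def by (rule sum.swap)
  also have "\<dots> \<le> (\<Sum>j<m. K\<^sup>2 * (\<Sum>k<m. (cmod (b k j))\<^sup>2))"
    by (rule sum_mono) (rule assms[unfolded op_bounded_def, rule_format])
  also have "\<dots> = K\<^sup>2 * hs_sq m b"
    unfolding hs_sq_def sum_distrib_left by (rule sum.swap)
  finally show ?thesis .
qed

text \<open>For the image \<open>w\<close> of \<open>v\<close> under the adjoint, the squared norm
  \<open>S\<close> of \<open>w\<close> is the inner product of \<open>v\<close> with the image
  \<open>z\<close> of \<open>w\<close> under \<open>a\<close>. Cauchy-Schwarz and the bound for
  \<open>a\<close> give \<open>S * S \<le> K\<^sup>2 * V * S\<close>, and \<open>S\<close>
  cancels.\<close>

lemma op_bounded_adjoint:
  assumes "op_bounded m K a"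
  shows "op_bounded m K (\<lambda>i j. cnj (a j i))"
  unfolding op_bounded_def
proof
  fix v :: "nat \<Rightarrow> complex"
  define w where "w i = (\<Sum>k<m. cnj (a k i) * v k)" for i
  define S where "S = (\<Sum>i<m. (cmod (w i))\<^sup>2)"
  define V where "V = (\<Sum>k<m. (cmod (v k))\<^sup>2)"
  define z where "z k = (\<Sum>i<m. a k i * w i)" for k
  have z: "(\<Sum>k<m. (cmod (z k))\<^sup>2) \<le> K\<^sup>2 * S" using assms unfolding op_bounded_def z_def S_def by blast
  have S0: "0 \<le> S" "0 \<le> V" unfolding S_def V_def by (intro sum_nonneg; simp)+
  have "complex_of_real S = (\<Sum>i<m. w i * cnj (w i))"
    unfolding S_def of_real_sum complex_norm_square ..
  also have "\<dots> = (\<Sum>i<m. \<Sum>k<m. v k * cnj (a k i * w i))"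
  proof (rule sum.cong[OF refl])
    fix i
    have "(\<Sum>k<m. cnj (a k i) * v k) * cnj c = (\<Sum>k<m. v k * cnj (a k i * c))" for c
      by (simp add: sum_distrib_left mult_ac)
    from this[of "w i"] show "w i * cnj (w i) = (\<Sum>k<m. v k * cnj (a k i * w i))" by (simp only: w_def[symmetric])
  qed
  also have "\<dots> = (\<Sum>k<m. v k * cnj (z k))"
    by (subst sum.swap) (simp add: z_def sum_distrib_left)
  finally have "S = cmod (\<Sum>k<m. v k * cnj (z k))" using S0 by (metis norm_of_real abs_of_nonneg)
  also have "\<dots> \<le> (\<Sum>k<m. cmod (v k) * cmod (z k))"
    by (rule order_trans[OF norm_sum]) (simp add: norm_mult)
  finally have "S\<^sup>2 \<le> (\<Sum>k<m. cmod (v k) * cmod (z k))\<^sup>2" using S0 by (intro power_mono)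
  also have "\<dots> \<le> V * (\<Sum>k<m. (cmod (z k))\<^sup>2)" unfolding V_def by (rule Cauchy_Schwarz_ineq_sum)
  also have "\<dots> \<le> V * (K\<^sup>2 * S)" using z S0 by (intro mult_left_mono)
  finally have "S * S \<le> (K\<^sup>2 * V) * S" by (simp add: power2_eq_square mult_ac)
  then have "S \<le> K\<^sup>2 * V" using S0 by (cases "S = 0") (auto simp: mult_le_cancel_right)
  then show "(\<Sum>i<m. (cmod (\<Sum>k<m. cnj (a k i) * v k))\<^sup>2) \<le> K\<^sup>2 * (\<Sum>k<m. (cmod (v k))\<^sup>2)"
    by (simp add: S_def V_def w_def)
qed

lemma hs_sq_mult_right:
  assumes "op_bounded m K b"
  shows "hs_sq m (\<lambda>i j. \<Sum>k<m. a i k * b k j) \<le> K\<^sup>2 * hs_sq m a"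
proof -
  have "hs_sq m (\<lambda>i j. \<Sum>k<m. a i k * b k j) = hs_sq m (\<lambda>i j. cnj (\<Sum>k<m. a j k * b k i))" by (rule hs_sq_swap[symmetric])
  also have "\<dots> = hs_sq m (\<lambda>i j. \<Sum>k<m. cnj (b k i) * cnj (a j k))" by (simp add: mult.commute)
  also have "\<dots> \<le> K\<^sup>2 * hs_sq m (\<lambda>i j. cnj (a j i))" by (rule hs_sq_mult_left[OF op_bounded_adjoint[OF assms]])
  finally show ?thesis by (simp add: hs_sq_swap)
qed

lemma op_bounded_mult:
  assumes "op_bounded m K a" "op_bounded m L b"
  shows "op_bounded m (K * L) (\<lambda>i j. \<Sum>k<m. a i k * b k j)"
  unfolding op_bounded_def
proof
  fix v :: "nat \<Rightarrow> complex"
  have e: "(\<Sum>k<m. (\<Sum>l<m. a i l * b l k) * v k) = (\<Sum>l<m. a i l * (\<Sum>k<m. b l k * v k))" for i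
    by (simp add: sum_distrib_left sum_distrib_right mult.assoc) (rule sum.swap)
  have "(\<Sum>i<m. (cmod (\<Sum>k<m. (\<Sum>l<m. a i l * b l k) * v k))\<^sup>2) \<le> K\<^sup>2 * (\<Sum>l<m. (cmod (\<Sum>k<m. b l k * v k))\<^sup>2)"
    unfolding e by (rule assms(1)[unfolded op_bounded_def, rule_format])
  also have "\<dots> \<le> K\<^sup>2 * (L\<^sup>2 * (\<Sum>k<m. (cmod (v k))\<^sup>2))"
    by (intro mult_left_mono assms(2)[unfolded op_bounded_def, rule_format]) simp
  finally show "(\<Sum>i<m. (cmod (\<Sum>k<m. (\<Sum>l<m. a i l * b l k) * v k))\<^sup>2) \<le> (K * L)\<^sup>2 * (\<Sum>k<m. (cmod (v k))\<^sup>2)"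
    by (simp add: power_mult_distrib mult.assoc)
qed

lemma card_eq_sum: fixes m :: nat shows "real (card (A \<inter> {..<m})) = (\<Sum>i<m. if i \<in> A then 1 else 0)"
  using sum.inter_restrict[of "{..<m}" "\<lambda>_. 1 :: real" A] by (simp add: Int_commute)

definition entry :: "complex mat \<Rightarrow> nat \<Rightarrow> nat \<Rightarrow> complex" where
  "entry x i j = x $$ (i, j)"

lemma hs_sq_cong: "(\<And>i j. i < m \<Longrightarrow> j < m \<Longrightarrow> a i j = b i j) \<Longrightarrow> hs_sq m a = hs_sq m b"
  unfolding hs_sq_def by (intro sum.cong refl) auto

lemma entry_mult:
  assumes "x \<in> carrier_mat m m" "y \<in> carrier_mat m m" "i < m" "j < m"
  shows "entry (x * y) i j = (\<Sum>k<m. entry x i k * entry y k j)"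
  using assms by (simp add: entry_def scalar_prod_def atLeast0LessThan)

lemma adjoint_carrier [simp]: "x \<in> carrier_mat m m \<Longrightarrow> mat_adjoint x \<in> carrier_mat m m"
  by (auto simp: mat_adjoint_def)

lemma entry_adjoint:
  assumes "x \<in> carrier_mat m m" "i < m" "j < m"
  shows "entry (mat_adjoint x) i j = cnj (entry x j i)"
  using assms by (simp add: entry_def mat_adjoint_def mat_of_rows_def)

lemma norm2_hs_sq:
  assumes "x \<in> carrier_mat m m"
  shows "norm2_mat x = sqrt (hs_sq m (entry x) / real m)"
proof -
  have "(\<Sum>j<m. (mat_adjoint x * x) $$ (j, j)) = (\<Sum>j<m. \<Sum>i<m. complex_of_real ((cmod (entry x i j))\<^sup>2))"
  proof (rule sum.cong[OF refl])
    fix j assume j: "j \<in> {..<m}"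
    have "(mat_adjoint x * x) $$ (j, j) = (\<Sum>i<m. cnj (entry x i j) * entry x i j)"
      using entry_mult[OF adjoint_carrier[OF assms] assms, of j j] entry_adjoint[OF assms, of j] j
      by (simp add: entry_def[of "mat_adjoint x * x"])
    then show "(mat_adjoint x * x) $$ (j, j) = (\<Sum>i<m. complex_of_real ((cmod (entry x i j))\<^sup>2))"
      unfolding complex_norm_square by (simp only: mult.commute)
  qed
  also have "\<dots> = complex_of_real (hs_sq m (entry x))" unfolding hs_sq_def by (subst sum.swap) simp
  finally have "ntr (mat_adjoint x * x) = complex_of_real (hs_sq m (entry x) / real m)"
    using adjoint_carrier[OF assms] by (simp add: ntr_def)
  then show ?thesis unfolding norm2_mat_def by simp
qed

lemma op_bounded_of_cvec:
  assumes x: "x \<in> carrier_mat m m" and b: "\<forall>v\<in>carrier_vec m. cvec_norm (x *\<^sub>v v) \<le> K * cvec_norm v"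
  shows "op_bounded m K (entry x)"
  unfolding op_bounded_def
proof
  fix v :: "nat \<Rightarrow> complex"
  have 1: "(cvec_norm (vec m v))\<^sup>2 = (\<Sum>k<m. (cmod (v k))\<^sup>2)"
    unfolding cvec_norm_def by (subst real_sqrt_pow2) (auto intro!: sum_nonneg sum.cong)
  have 2: "(cvec_norm (x *\<^sub>v vec m v))\<^sup>2 = (\<Sum>i<m. (cmod (\<Sum>k<m. entry x i k * v k))\<^sup>2)"
    unfolding cvec_norm_def using x
    by (subst real_sqrt_pow2) (auto intro!: sum_nonneg sum.cong simp: scalar_prod_def entry_def atLeast0LessThan)
  have "(cvec_norm (x *\<^sub>v vec m v))\<^sup>2 \<le> (K * cvec_norm (vec m v))\<^sup>2"
    using bspec[OF b, of "vec m v"] by (intro power_mono) (simp, simp add: cvec_norm_def sum_nonneg)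
  then show "(\<Sum>i<m. (cmod (\<Sum>k<m. entry x i k * v k))\<^sup>2) \<le> K\<^sup>2 * (\<Sum>k<m. (cmod (v k))\<^sup>2)"
    by (simp add: 1 2 power_mult_distrib)
qed

lemma cvec_of_op_bounded:
  assumes x: "x \<in> carrier_mat m m" and b: "op_bounded m K (entry x)" and v: "v \<in> carrier_vec m"
  shows "cvec_norm (x *\<^sub>v v) \<le> \<bar>K\<bar> * cvec_norm v"
proof -
  have 2: "(\<Sum>i<dim_vec (x *\<^sub>v v). (cmod (vec_index (x *\<^sub>v v) i))\<^sup>2) = (\<Sum>i<m. (cmod (\<Sum>k<m. entry x i k * vec_index v k))\<^sup>2)"
    using x v by (auto intro!: sum.cong simp: scalar_prod_def entry_def atLeast0LessThan)
  also have "\<dots> \<le> K\<^sup>2 * (\<Sum>k<m. (cmod (vec_index v k))\<^sup>2)" using b unfolding op_bounded_def by blast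
  finally have "cvec_norm (x *\<^sub>v v) \<le> sqrt (K\<^sup>2 * (\<Sum>k<m. (cmod (vec_index v k))\<^sup>2))"
    unfolding cvec_norm_def by (rule real_sqrt_le_mono)
  then show ?thesis using v by (simp add: real_sqrt_mult cvec_norm_def)
qed

lemma bounded_seqs_iff:
  "x \<in> bounded_seqs n \<longleftrightarrow> (\<forall>k. x k \<in> carrier_mat (n k) (n k)) \<and> (\<exists>K. \<forall>k. op_bounded (n k) K (entry (x k)))"
proof
  assume "x \<in> bounded_seqs n"
  then show "(\<forall>k. x k \<in> carrier_mat (n k) (n k)) \<and> (\<exists>K. \<forall>k. op_bounded (n k) K (entry (x k)))"
    unfolding bounded_seqs_def using op_bounded_of_cvec by blast
next
  assume a: "(\<forall>k. x k \<in> carrier_mat (n k) (n k)) \<and> (\<exists>K. \<forall>k. op_bounded (n k) K (entry (x k)))"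
  then obtain K where "\<forall>k. op_bounded (n k) K (entry (x k))" by blast
  then have "\<forall>k. \<forall>v\<in>carrier_vec (n k). cvec_norm (x k *\<^sub>v v) \<le> \<bar>K\<bar> * cvec_norm v" using cvec_of_op_bounded a by blast
  then show "x \<in> bounded_seqs n" unfolding bounded_seqs_def using a by blast
qed

lemma bounded_carrier: "x \<in> bounded_seqs n \<Longrightarrow> x k \<in> carrier_mat (n k) (n k)"
  by (simp add: bounded_seqs_iff)

lemma op_bounded_cong: "(\<And>i j. i < m \<Longrightarrow> j < m \<Longrightarrow> a i j = b i j) \<Longrightarrow> op_bounded m K a = op_bounded m K b"
  unfolding op_bounded_def by simp

lemma bounded_mult:
  assumes "x \<in> bounded_seqs n" "y \<in> bounded_seqs n"
  shows "(\<lambda>k. x k * y k) \<in> bounded_seqs n"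
proof -
  obtain K L where K: "\<And>k. op_bounded (n k) K (entry (x k))" "\<And>k. op_bounded (n k) L (entry (y k))"
    using assms unfolding bounded_seqs_iff by blast
  have "op_bounded (n k) (K * L) (entry (x k * y k))" for k
    using op_bounded_mult[OF K(1)[of k] K(2)[of k]] op_bounded_cong[of "n k" "entry (x k * y k)"]
      entry_mult[OF bounded_carrier[OF assms(1)] bounded_carrier[OF assms(2)]] by simp
  moreover have "x k * y k \<in> carrier_mat (n k) (n k)" for k using assms bounded_carrier by (metis mult_carrier_mat)
  ultimately show ?thesis unfolding bounded_seqs_iff by blast
qed

lemma bounded_adjoint:
  assumes "x \<in> bounded_seqs n"
  shows "(\<lambda>k. mat_adjoint (x k)) \<in> bounded_seqs n"
proof -
  obtain K where K: "\<And>k. op_bounded (n k) K (entry (x k))" using assms unfolding bounded_seqs_iff by blast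
  have "op_bounded (n k) K (entry (mat_adjoint (x k)))" for k
    using op_bounded_adjoint[OF K[of k]] op_bounded_cong[of "n k" "entry (mat_adjoint (x k))"] entry_adjoint[OF bounded_carrier[OF assms]] by simp
  then show ?thesis unfolding bounded_seqs_iff using adjoint_carrier bounded_carrier[OF assms] by blast
qed

text \<open>Compactness gives a cluster point of the image filter, and for an ultrafilter a cluster
  point is a limit.\<close>

lemma ultrafilter_converges:
  fixes f :: "nat \<Rightarrow> real"
  assumes \<omega>: "free_ultrafilter \<omega>" and f: "\<And>k. f k \<in> {0..1}"
  shows "\<exists>l. (f \<longlongrightarrow> l) \<omega>"
proof -
  have nb: "filtermap f \<omega> \<noteq> bot" using \<omega> by (simp add: free_ultrafilter_def filtermap_bot_iff)
  have ev: "eventually (\<lambda>y. y \<in> {0..1}) (filtermap f \<omega>)" using f by (simp add: eventually_filtermap)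
  have "compact {0..1::real}" by (rule compact_Icc)
  then obtain x where x: "inf (nhds x) (filtermap f \<omega>) \<noteq> bot"
    using nb ev unfolding compact_filter by blast
  have "(f \<longlongrightarrow> x) \<omega>"
  proof (rule topological_tendstoI)
    fix U assume U: "open U" "x \<in> U"
    have d: "eventually (\<lambda>k. f k \<in> U) \<omega> \<or> eventually (\<lambda>k. f k \<notin> U) \<omega>"
      using \<omega> unfolding free_ultrafilter_def by blast
    have "\<not> eventually (\<lambda>k. f k \<notin> U) \<omega>"
    proof
      assume "eventually (\<lambda>k. f k \<notin> U) \<omega>"
      then have "eventually (\<lambda>y. y \<notin> U) (filtermap f \<omega>)" by (simp add: eventually_filtermap)
      moreover have "eventually (\<lambda>y. y \<in> U) (nhds x)" using U by (rule eventually_nhds_in_open)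
      ultimately have "eventually (\<lambda>y. False) (inf (nhds x) (filtermap f \<omega>))"
        unfolding eventually_inf by blast
      then show False using x by (simp add: trivial_limit_def)
    qed
    then show "eventually (\<lambda>k. f k \<in> U) \<omega>" using d by blast
  qed
  then show ?thesis by blast
qed

section \<open>Representing sequences of elements of the ultraproduct\<close>

locale ultra =
  fixes \<omega> :: "nat filter" and n :: "nat \<Rightarrow> nat"
  assumes n_pos: "\<And>k. n k > 0"
begin

text \<open>Squared, which avoids square roots in the estimates at the price of a factor 2 in the
  triangle inequality.\<close>

definition dist2 :: "(nat \<Rightarrow> complex mat) \<Rightarrow> (nat \<Rightarrow> complex mat) \<Rightarrow> nat \<Rightarrow> real" where
  "dist2 x y k = hs_sq (n k) (\<lambda>i j. entry (x k) i j - entry (y k) i j) / real (n k)"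

definition near :: "(nat \<Rightarrow> complex mat) \<Rightarrow> (nat \<Rightarrow> complex mat) \<Rightarrow> bool" where
  "near x y \<longleftrightarrow> (dist2 x y \<longlongrightarrow> 0) \<omega>"

lemma dist2_nonneg: "0 \<le> dist2 x y k"
  by (simp add: dist2_def hs_sq_nonneg)

lemma near_le:
  assumes "\<And>k. f k \<le> c * g k" "\<And>k. 0 \<le> f k" "(g \<longlongrightarrow> (0::real)) \<omega>"
  shows "(f \<longlongrightarrow> 0) \<omega>"
proof (rule tendsto_sandwich[OF _ _ tendsto_const])
  show "((\<lambda>k. c * g k) \<longlongrightarrow> 0) \<omega>" using tendsto_mult_left[OF assms(3), of c] by simp
qed (use assms in auto)

lemma near_refl [simp]: "near x x"
proof -
  have "dist2 x x = (\<lambda>k. 0)" by (simp add: fun_eq_iff dist2_def hs_sq_def)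
  then show ?thesis by (simp add: near_def)
qed

lemma near_sym: "near x y \<Longrightarrow> near y x"
  unfolding near_def dist2_def hs_sq_def by (simp add: norm_minus_commute)

lemma dist2_triangle: "dist2 x z k \<le> 2 * (dist2 x y k + dist2 y z k)"
proof -
  have "hs_sq (n k) (\<lambda>i j. entry (x k) i j - entry (z k) i j) \<le> 2 * hs_sq (n k) (\<lambda>i j. entry (x k) i j - entry (y k) i j) + 2 * hs_sq (n k) (\<lambda>i j. entry (y k) i j - entry (z k) i j)"
    using hs_sq_add[of "n k" "\<lambda>i j. entry (x k) i j - entry (y k) i j" "\<lambda>i j. entry (y k) i j - entry (z k) i j"] by simp
  then show ?thesis using n_pos[of k] by (simp add: dist2_def divide_simps)
qed

lemma near_trans: "near x y \<Longrightarrow> near y z \<Longrightarrow> near x z"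
  unfolding near_def
  by (rule near_le[OF dist2_triangle dist2_nonneg]) (auto intro: tendsto_eq_intros)

lemma mem_class:
  assumes "x \<in> bounded_seqs n"
  shows "y \<in> ultra_class \<omega> n x \<longleftrightarrow> y \<in> bounded_seqs n \<and> near y x"
proof -
  have "((\<lambda>k. norm2_mat (y k - x k)) \<longlongrightarrow> 0) \<omega> \<longleftrightarrow> near y x" if y: "y \<in> bounded_seqs n"
  proof -
    have e: "norm2_mat (y k - x k) = sqrt (dist2 y x k)" for k
    proof -
      have c: "y k \<in> carrier_mat (n k) (n k)" "x k \<in> carrier_mat (n k) (n k)" using y assms bounded_carrier by auto
      then have "y k - x k \<in> carrier_mat (n k) (n k)" by (metis minus_carrier_mat)
      moreover have "hs_sq (n k) (entry (y k - x k)) = hs_sq (n k) (\<lambda>i j. entry (y k) i j - entry (x k) i j)"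
        by (rule hs_sq_cong) (use c in \<open>simp add: entry_def\<close>)
      ultimately show ?thesis using norm2_hs_sq by (simp add: dist2_def)
    qed
    show ?thesis
    proof
      assume "((\<lambda>k. norm2_mat (y k - x k)) \<longlongrightarrow> 0) \<omega>"
      from tendsto_power[OF this, of 2] show "near y x"
        unfolding near_def e using dist2_nonneg by (simp add: real_sqrt_pow2)
    next
      assume "near y x"
      from tendsto_real_sqrt[OF this[unfolded near_def]] show "((\<lambda>k. norm2_mat (y k - x k)) \<longlongrightarrow> 0) \<omega>"
        unfolding e by simp
    qed
  qed
  then show ?thesis unfolding ultra_class_def by blast
qed

abbreviation "cls \<equiv> ultra_class \<omega> n"

lemma cls_eq_iff:
  assumes "x \<in> bounded_seqs n" "y \<in> bounded_seqs n"
  shows "cls x = cls y \<longleftrightarrow> near x y"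
proof
  assume "cls x = cls y"
  moreover have "x \<in> cls x" using assms by (simp add: mem_class)
  ultimately show "near x y" using assms by (simp add: mem_class)
next
  assume "near x y"
  then have "near z x \<longleftrightarrow> near z y" for z using near_trans near_sym by blast
  then show "cls x = cls y" using assms by (simp add: set_eq_iff mem_class)
qed

lemma rep_cls:
  assumes "x \<in> bounded_seqs n"
  shows "rep (cls x) \<in> bounded_seqs n" "near (rep (cls x)) x"
proof -
  have "x \<in> cls x" using assms by (simp add: mem_class)
  then have "rep (cls x) \<in> cls x" unfolding rep_def by (rule someI[of "\<lambda>z. z \<in> cls x"])
  then show "rep (cls x) \<in> bounded_seqs n" "near (rep (cls x)) x" using assms by (auto simp: mem_class)
qed

text \<open>The factors are exchanged one at a time. The difference is then multiplied by a sequence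
  bounded in operator norm, which scales the Hilbert-Schmidt norm by a bounded factor only.\<close>

lemma near_mult:
  assumes b: "x \<in> bounded_seqs n" "x' \<in> bounded_seqs n" "y \<in> bounded_seqs n" "y' \<in> bounded_seqs n"
    and "near x x'" "near y y'"
  shows "near (\<lambda>k. x k * y k) (\<lambda>k. x' k * y' k)"
proof (rule near_trans)
  obtain K where K: "\<And>k. op_bounded (n k) K (entry (y k))" using b unfolding bounded_seqs_iff by blast
  obtain L where L: "\<And>k. op_bounded (n k) L (entry (x' k))" using b unfolding bounded_seqs_iff by blast
  show "near (\<lambda>k. x k * y k) (\<lambda>k. x' k * y k)" unfolding near_def
  proof (rule near_le[OF _ dist2_nonneg])
    fix k
    have "hs_sq (n k) (\<lambda>i j. entry (x k * y k) i j - entry (x' k * y k) i j) =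
        hs_sq (n k) (\<lambda>i j. \<Sum>l<n k. (entry (x k) i l - entry (x' k) i l) * entry (y k) l j)"
      by (rule hs_sq_cong) (simp add: entry_mult[OF b(1)[THEN bounded_carrier] b(3)[THEN bounded_carrier]]
        entry_mult[OF b(2)[THEN bounded_carrier] b(3)[THEN bounded_carrier]] left_diff_distrib sum_subtractf)
    also have "\<dots> \<le> K\<^sup>2 * hs_sq (n k) (\<lambda>i j. entry (x k) i j - entry (x' k) i j)" by (rule hs_sq_mult_right[OF K])
    finally show "dist2 (\<lambda>k. x k * y k) (\<lambda>k. x' k * y k) k \<le> K\<^sup>2 * dist2 x x' k"
      using n_pos[of k] by (simp add: dist2_def divide_simps)
  qed (use assms(5) in \<open>simp add: near_def\<close>)
  show "near (\<lambda>k. x' k * y k) (\<lambda>k. x' k * y' k)" unfolding near_def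
  proof (rule near_le[OF _ dist2_nonneg])
    fix k
    have "hs_sq (n k) (\<lambda>i j. entry (x' k * y k) i j - entry (x' k * y' k) i j) =
        hs_sq (n k) (\<lambda>i j. \<Sum>l<n k. entry (x' k) i l * (entry (y k) l j - entry (y' k) l j))"
      by (rule hs_sq_cong) (simp add: entry_mult[OF b(2)[THEN bounded_carrier] b(3)[THEN bounded_carrier]]
        entry_mult[OF b(2)[THEN bounded_carrier] b(4)[THEN bounded_carrier]] right_diff_distrib sum_subtractf)
    also have "\<dots> \<le> L\<^sup>2 * hs_sq (n k) (\<lambda>i j. entry (y k) i j - entry (y' k) i j)" by (rule hs_sq_mult_left[OF L])
    finally show "dist2 (\<lambda>k. x' k * y k) (\<lambda>k. x' k * y' k) k \<le> L\<^sup>2 * dist2 y y' k"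
      using n_pos[of k] by (simp add: dist2_def divide_simps)
  qed (use assms(6) in \<open>simp add: near_def\<close>)
qed

lemma near_adjoint:
  assumes b: "x \<in> bounded_seqs n" "y \<in> bounded_seqs n" and "near x y"
  shows "near (\<lambda>k. mat_adjoint (x k)) (\<lambda>k. mat_adjoint (y k))"
proof -
  have "dist2 (\<lambda>k. mat_adjoint (x k)) (\<lambda>k. mat_adjoint (y k)) k = dist2 x y k" for k
  proof -
    have "hs_sq (n k) (\<lambda>i j. entry (mat_adjoint (x k)) i j - entry (mat_adjoint (y k)) i j) =
      hs_sq (n k) (\<lambda>i j. cnj (entry (x k) j i - entry (y k) j i))"
      by (rule hs_sq_cong) (simp add: entry_adjoint[OF b(1)[THEN bounded_carrier]] entry_adjoint[OF b(2)[THEN bounded_carrier]])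
    then show ?thesis using hs_sq_swap[of "n k" "\<lambda>i j. entry (x k) i j - entry (y k) i j"] by (simp add: dist2_def)
  qed
  then have "dist2 (\<lambda>k. mat_adjoint (x k)) (\<lambda>k. mat_adjoint (y k)) = dist2 x y" by (rule ext)
  then show ?thesis using assms(3) by (simp add: near_def)
qed

abbreviation "\<U> \<equiv> ultraproduct \<omega> n"

lemma mult_cls:
  assumes "x \<in> bounded_seqs n" "y \<in> bounded_seqs n"
  shows "cls x \<otimes>\<^bsub>\<U>\<^esub> cls y = cls (\<lambda>k. x k * y k)"
proof -
  have "cls x \<otimes>\<^bsub>\<U>\<^esub> cls y = cls (\<lambda>k. rep (cls x) k * rep (cls y) k)" by (simp add: ultraproduct_def)
  also have "\<dots> = cls (\<lambda>k. x k * y k)"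
    using assms rep_cls by (subst cls_eq_iff) (auto intro!: bounded_mult near_mult)
  finally show ?thesis .
qed

lemma involution_cls:
  assumes "x \<in> bounded_seqs n"
  shows "involution \<U> (cls x) = cls (\<lambda>k. mat_adjoint (x k))"
proof -
  have "involution \<U> (cls x) = cls (\<lambda>k. mat_adjoint (rep (cls x) k))" by (simp add: ultraproduct_def)
  also have "\<dots> = cls (\<lambda>k. mat_adjoint (x k))"
    using assms rep_cls by (subst cls_eq_iff) (auto intro!: bounded_adjoint near_adjoint)
  finally show ?thesis .
qed

lemma one_cls: "\<one>\<^bsub>\<U>\<^esub> = cls (\<lambda>k. 1\<^sub>m (n k))"
  by (simp add: ultraproduct_def)

lemma ntr_near:
  assumes b: "x \<in> bounded_seqs n" "y \<in> bounded_seqs n" and "near x y"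
  shows "((\<lambda>k. ntr (x k) - ntr (y k)) \<longlongrightarrow> 0) \<omega>"
proof -
  have le: "cmod (ntr (x k) - ntr (y k)) \<le> sqrt (dist2 x y k)" for k
  proof -
    let ?d = "\<lambda>i. entry (x k) i i - entry (y k) i i"
    have dims: "dim_row (x k) = n k" "dim_row (y k) = n k" using b bounded_carrier by blast+
    have "ntr (x k) - ntr (y k) = (\<Sum>i<n k. ?d i) / of_nat (n k)"
      by (simp add: ntr_def dims entry_def sum_subtractf diff_divide_distrib)
    then have "cmod (ntr (x k) - ntr (y k)) = cmod (\<Sum>i<n k. ?d i) / real (n k)" by (simp add: norm_divide)
    also have "\<dots> \<le> (\<Sum>i<n k. cmod (?d i)) / real (n k)" by (intro divide_right_mono norm_sum) simp
    finally have 1: "cmod (ntr (x k) - ntr (y k)) \<le> (\<Sum>i<n k. cmod (?d i)) / real (n k)" .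
    have "(\<Sum>i<n k. 1 * cmod (?d i))\<^sup>2 \<le> (\<Sum>i<n k. 1\<^sup>2) * (\<Sum>i<n k. (cmod (?d i))\<^sup>2)" by (rule Cauchy_Schwarz_ineq_sum)
    also have "\<dots> \<le> real (n k) * hs_sq (n k) (\<lambda>i j. entry (x k) i j - entry (y k) i j)"
      unfolding hs_sq_def by (simp, intro mult_left_mono sum_mono) (auto intro!: member_le_sum[where f = "\<lambda>j. (cmod (entry (x k) _ j - entry (y k) _ j))\<^sup>2"])
    finally have "((\<Sum>i<n k. cmod (?d i)) / real (n k))\<^sup>2 \<le> dist2 x y k"
      using n_pos[of k] by (simp add: dist2_def power_divide divide_simps power2_eq_square mult.commute)
    then have "(\<Sum>i<n k. cmod (?d i)) / real (n k) \<le> sqrt (dist2 x y k)" by (rule real_le_rsqrt)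
    then show ?thesis using 1 by linarith
  qed
  have "((\<lambda>k. sqrt (dist2 x y k)) \<longlongrightarrow> 0) \<omega>" using tendsto_real_sqrt[OF assms(3)[unfolded near_def]] by simp
  then show ?thesis by (rule Lim_null_comparison[rotated]) (use le in simp)
qed

section \<open>Counting points by Hilbert-Schmidt distances\<close>

definition negligible :: "(nat \<Rightarrow> nat set) \<Rightarrow> bool" where
  "negligible S \<longleftrightarrow> ((\<lambda>k. real (card (S k \<inter> {..<n k})) / real (n k)) \<longlongrightarrow> 0) \<omega>"

text \<open>A Chebyshev estimate: it applies when every point of \<open>S k\<close> contributes at
  least \<open>1 / c\<close> to the squared distance of two sequences that are near each
  other.\<close>

lemma negligible_le:
  assumes "\<And>k. real (card (S k \<inter> {..<n k})) \<le> c * hs_sq (n k) (\<lambda>i j. entry (x k) i j - entry (y k) i j)" "near x y"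
  shows "negligible S"
  unfolding negligible_def
proof (rule near_le[where c = c and g = "dist2 x y"])
  fix k show "real (card (S k \<inter> {..<n k})) / real (n k) \<le> c * dist2 x y k"
    using assms(1)[of k] n_pos[of k] by (simp add: dist2_def divide_simps)
qed (use assms(2) in \<open>auto simp: near_def\<close>)

definition diag_indicator :: "(nat \<Rightarrow> nat set) \<Rightarrow> nat \<Rightarrow> complex mat" where
  "diag_indicator S k = mat (n k) (n k) (\<lambda>(i, j). if i = j \<and> i \<in> S k then 1 else 0)"

text \<open>Satisfied by a diagonal matrix times the permutation matrix of \<open>\<sigma>\<close>.
  The values on the graph are left open and may vanish, so the property survives products whatever
  the phases are.\<close>

definition supported :: "(nat \<Rightarrow> nat \<Rightarrow> nat) \<Rightarrow> (nat \<Rightarrow> complex mat) \<Rightarrow> bool" where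
  "supported \<sigma> x \<longleftrightarrow> (\<forall>k. \<forall>i<n k. \<forall>j<n k. entry (x k) i j \<noteq> 0 \<longrightarrow> i = \<sigma> k j)"

lemma diag_indicator_entry: "i < n k \<Longrightarrow> j < n k \<Longrightarrow> entry (diag_indicator S k) i j = (if i = j \<and> i \<in> S k then 1 else 0)"
  by (simp add: entry_def diag_indicator_def)

lemma diag_indicator_bounded: "diag_indicator S \<in> bounded_seqs n"
proof -
  have "op_bounded (n k) 1 (entry (diag_indicator S k))" for k
    unfolding op_bounded_def
  proof
    fix v :: "nat \<Rightarrow> complex"
    have "(\<Sum>l<n k. entry (diag_indicator S k) i l * v l) = (if i \<in> S k then v i else 0)" if i: "i < n k" for i
    proof -
      have "(\<Sum>l<n k. entry (diag_indicator S k) i l * v l) = (\<Sum>l<n k. if l = i then (if i \<in> S k then v i else 0) else 0)"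
        by (rule sum.cong) (use i in \<open>auto simp: diag_indicator_entry\<close>)
      then show ?thesis using i by simp
    qed
    then show "(\<Sum>i<n k. (cmod (\<Sum>l<n k. entry (diag_indicator S k) i l * v l))\<^sup>2) \<le> 1\<^sup>2 * (\<Sum>l<n k. (cmod (v l))\<^sup>2)"
      by (simp, intro sum_mono) auto
  qed
  then show ?thesis unfolding bounded_seqs_iff by (auto simp: diag_indicator_def)
qed

lemma entry_mult_single:
  assumes "x \<in> carrier_mat m m" "y \<in> carrier_mat m m" "i < m" "j < m" "l < m"
    and "\<And>k. k < m \<Longrightarrow> k \<noteq> l \<Longrightarrow> entry x i k * entry y k j = 0"
  shows "entry (x * y) i j = entry x i l * entry y l j"
proof -
  have "entry (x * y) i j = (\<Sum>k<m. if k = l then entry x i l * entry y l j else 0)"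
    unfolding entry_mult[OF assms(1-4)] by (rule sum.cong) (use assms(6) in auto)
  then show ?thesis using assms(5) by simp
qed

lemma diag_indicator_carrier: "diag_indicator S k \<in> carrier_mat (n k) (n k)"
  by (simp add: diag_indicator_def)

lemma entry_diag_indicator_mult:
  assumes "x \<in> carrier_mat (n k) (n k)" "i < n k" "j < n k"
  shows "entry (diag_indicator S k * x) i j = (if i \<in> S k then entry x i j else 0)"
    "entry (x * diag_indicator S k) i j = (if j \<in> S k then entry x i j else 0)"
  using entry_mult_single[OF diag_indicator_carrier assms(1,2,3,2), of S] entry_mult_single[OF assms(1) diag_indicator_carrier assms(2,3,3), of S] assms
  by (auto simp: diag_indicator_entry)

lemma diag_indicator_mult: "(\<lambda>k. diag_indicator S k * diag_indicator T k) = diag_indicator (\<lambda>k. S k \<inter> T k)"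
proof (rule ext, rule eq_matI)
  fix k i j assume "i < dim_row (diag_indicator (\<lambda>k. S k \<inter> T k) k)" "j < dim_col (diag_indicator (\<lambda>k. S k \<inter> T k) k)"
  then have "i < n k" "j < n k" by (auto simp: diag_indicator_def)
  then show "(diag_indicator S k * diag_indicator T k) $$ (i, j) = diag_indicator (\<lambda>k. S k \<inter> T k) k $$ (i, j)"
    using entry_diag_indicator_mult(1)[OF diag_indicator_carrier, of i k j S T] by (auto simp: entry_def[symmetric] diag_indicator_entry)
qed (auto simp: diag_indicator_def)

lemma diag_indicator_near:
  assumes "near (diag_indicator S) (diag_indicator T)"
  shows "negligible (\<lambda>k. sym_diff (S k) (T k))"
proof (rule negligible_le[where c = 1, OF _ assms])
  fix k
  have "real (card (sym_diff (S k) (T k) \<inter> {..<n k})) = (\<Sum>i<n k. if i \<in> sym_diff (S k) (T k) then 1 else 0)"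
    by (rule card_eq_sum)
  also have "\<dots> \<le> (\<Sum>i<n k. \<Sum>j<n k. (cmod (entry (diag_indicator S k) i j - entry (diag_indicator T k) i j))\<^sup>2)"
  proof (rule sum_mono)
    fix i assume i: "i \<in> {..<n k}"
    have "(if i \<in> sym_diff (S k) (T k) then 1 else 0) \<le> (cmod (entry (diag_indicator S k) i i - entry (diag_indicator T k) i i))\<^sup>2"
      using i by (auto simp: diag_indicator_entry)
    also have "\<dots> \<le> (\<Sum>j<n k. (cmod (entry (diag_indicator S k) i j - entry (diag_indicator T k) i j))\<^sup>2)"
      using i by (intro member_le_sum[where f = "\<lambda>j. (cmod (entry (diag_indicator S k) i j - entry (diag_indicator T k) i j))\<^sup>2"]) auto
    finally show "(if i \<in> sym_diff (S k) (T k) then 1 else 0) \<le> (\<Sum>j<n k. (cmod (entry (diag_indicator S k) i j - entry (diag_indicator T k) i j))\<^sup>2)" .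
  qed
  finally show "real (card (sym_diff (S k) (T k) \<inter> {..<n k})) \<le> 1 * hs_sq (n k) (\<lambda>i j. entry (diag_indicator S k) i j - entry (diag_indicator T k) i j)"
    by (simp add: hs_sq_def)
qed

text \<open>A diagonal almost idempotent is rounded to the indicator of the entries closer to one.\<close>

lemma diag_idempotent:
  assumes z: "z \<in> bounded_seqs n" "\<And>k. diagonal_mat (z k)" and idem: "near (\<lambda>k. z k * z k) z"
  shows "\<exists>S. near z (diag_indicator S)"
proof -
  define S where "S k = {i. cmod (entry (z k) i i - 1) < 1 / 2}" for k
  have off: "entry (z k) i j = 0" if "i < n k" "j < n k" "i \<noteq> j" for k i j
    using z(2)[of k] bounded_carrier[OF z(1), of k] that unfolding diagonal_mat_def entry_def by auto
  have zz: "entry (z k * z k) i j = entry (z k) i j * entry (z k) i j" if "i < n k" "j < n k" for k i j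
    using entry_mult_single[OF bounded_carrier[OF z(1)] bounded_carrier[OF z(1)] that that(1)] off that
    by (cases "i = j") auto
  have "near z (diag_indicator S)" unfolding near_def
  proof (rule near_le[OF _ dist2_nonneg])
    fix k
    have "hs_sq (n k) (\<lambda>i j. entry (z k) i j - entry (diag_indicator S k) i j) \<le> 4 * hs_sq (n k) (\<lambda>i j. entry (z k * z k) i j - entry (z k) i j)"
      unfolding hs_sq_def sum_distrib_left
    proof (intro sum_mono)
      fix i j assume ij: "i \<in> {..<n k}" "j \<in> {..<n k}"
      show "(cmod (entry (z k) i j - entry (diag_indicator S k) i j))\<^sup>2 \<le> 4 * (cmod (entry (z k * z k) i j - entry (z k) i j))\<^sup>2"
      proof (cases "i = j")
        case True
        define c where "c = entry (z k) i i"
        have e: "cmod (c * c - c) = cmod c * cmod (c - 1)" by (simp add: norm_mult[symmetric] algebra_simps)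
        \<comment> \<open>One of the factors \<open>cmod c\<close> and \<open>cmod (c - 1)\<close>
          is the rounding error, and the other is at least 1/2 by the choice of \<open>S\<close>.
          Squaring gives the constant 4.\<close>
        have "cmod (c - (if cmod (c - 1) < 1 / 2 then 1 else 0)) \<le> 2 * (cmod c * cmod (c - 1))"
        proof (cases "cmod (c - 1) < 1 / 2")
          case True
          have "1 \<le> cmod c + cmod (c - 1)" using norm_triangle_ineq4[of c "c - 1"] by simp
          then have "1 / 2 \<le> cmod c" using True by linarith
          then have "1 * cmod (c - 1) \<le> (2 * cmod c) * cmod (c - 1)" by (intro mult_right_mono) auto
          then show ?thesis using True by (simp add: mult.assoc)
        next
          case False
          then have "cmod c * 1 \<le> cmod c * (2 * cmod (c - 1))" by (intro mult_left_mono) auto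
          then show ?thesis using False by simp
        qed
        then have "(cmod (c - (if cmod (c - 1) < 1 / 2 then 1 else 0)))\<^sup>2 \<le> (2 * cmod (c * c - c))\<^sup>2"
          unfolding e by (intro power_mono) auto
        then show ?thesis using ij True zz[of i k i] by (simp add: c_def diag_indicator_entry S_def power_mult_distrib)
      next
        case False
        then show ?thesis using ij off[of i k j] by (simp add: diag_indicator_entry)
      qed
    qed
    then show "dist2 z (diag_indicator S) k \<le> 4 * dist2 (\<lambda>k. z k * z k) z k" using n_pos[of k] by (simp add: dist2_def divide_simps)
  qed (use idem in \<open>simp add: near_def\<close>)
  then show ?thesis by blast
qed

lemma supported_mult:
  assumes b: "x \<in> bounded_seqs n" "y \<in> bounded_seqs n" and s: "supported \<sigma> x" "supported \<tau> y"
    and \<tau>: "\<And>k j. j < n k \<Longrightarrow> \<tau> k j < n k"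
  shows "supported (\<lambda>k j. \<sigma> k (\<tau> k j)) (\<lambda>k. x k * y k)"
  unfolding supported_def
proof (intro allI impI)
  fix k i j assume ij: "i < n k" "j < n k" and ne: "entry (x k * y k) i j \<noteq> 0"
  have "entry (x k * y k) i j = entry (x k) i (\<tau> k j) * entry (y k) (\<tau> k j) j"
    using entry_mult_single[OF b(1)[THEN bounded_carrier] b(2)[THEN bounded_carrier] ij \<tau>[OF ij(2)]] s(2) ij
    unfolding supported_def by (metis mult_eq_0_iff)
  then have "entry (x k) i (\<tau> k j) \<noteq> 0" using ne by auto
  then show "i = \<sigma> k (\<tau> k j)" using s(1) ij \<tau>[OF ij(2)] unfolding supported_def by blast
qed

text \<open>A point of \<open>S k\<close> that \<open>\<sigma> k\<close> moves forces a diagonal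
  entry 0 of \<open>x\<close> where the indicator has 1. Fixed points outside \<open>S k\<close> are
  not counted this way, because the support condition forces no entry to be nonzero.\<close>

lemma supported_fixed:
  assumes s: "supported \<sigma> x" and near: "near x (diag_indicator S)"
  shows "negligible (\<lambda>k. {y \<in> S k. \<sigma> k y \<noteq> y})"
proof (rule negligible_le[where c = 1, OF _ near])
  fix k
  have "real (card ({y \<in> S k. \<sigma> k y \<noteq> y} \<inter> {..<n k})) = (\<Sum>i<n k. if i \<in> {y \<in> S k. \<sigma> k y \<noteq> y} then 1 else 0)"
    by (rule card_eq_sum)
  also have "\<dots> \<le> (\<Sum>i<n k. \<Sum>j<n k. (cmod (entry (x k) i j - entry (diag_indicator S k) i j))\<^sup>2)"
  proof (rule sum_mono)
    fix i assume i: "i \<in> {..<n k}"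
    have "(if i \<in> {y \<in> S k. \<sigma> k y \<noteq> y} then 1 else 0) \<le> (cmod (entry (x k) i i - entry (diag_indicator S k) i i))\<^sup>2"
    proof (cases "i \<in> S k \<and> \<sigma> k i \<noteq> i")
      case True
      then have "entry (x k) i i = 0" using s i unfolding supported_def by (metis lessThan_iff)
      then show ?thesis using True i by (simp add: diag_indicator_entry)
    qed auto
    also have "\<dots> \<le> (\<Sum>j<n k. (cmod (entry (x k) i j - entry (diag_indicator S k) i j))\<^sup>2)"
      using i by (intro member_le_sum[where f = "\<lambda>j. (cmod (entry (x k) i j - entry (diag_indicator S k) i j))\<^sup>2"]) auto
    finally show "(if i \<in> {y \<in> S k. \<sigma> k y \<noteq> y} then 1 else 0) \<le> (\<Sum>j<n k. (cmod (entry (x k) i j - entry (diag_indicator S k) i j))\<^sup>2)" .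
  qed
  finally show "real (card ({y \<in> S k. \<sigma> k y \<noteq> y} \<inter> {..<n k})) \<le> 1 * hs_sq (n k) (\<lambda>i j. entry (x k) i j - entry (diag_indicator S k) i j)"
    by (simp add: hs_sq_def)
qed

lemma negligible_Un:
  assumes "negligible S" "negligible T"
  shows "negligible (\<lambda>k. S k \<union> T k)"
  unfolding negligible_def
proof (rule near_le[where c = 1 and g = "\<lambda>k. real (card (S k \<inter> {..<n k})) / real (n k) + real (card (T k \<inter> {..<n k})) / real (n k)"])
  fix k
  have "card ((S k \<union> T k) \<inter> {..<n k}) \<le> card (S k \<inter> {..<n k}) + card (T k \<inter> {..<n k})"
    by (metis Int_Un_distrib2 card_Un_le)
  then have "real (card ((S k \<union> T k) \<inter> {..<n k})) \<le> real (card (S k \<inter> {..<n k})) + real (card (T k \<inter> {..<n k}))" by linarith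
  then show "real (card ((S k \<union> T k) \<inter> {..<n k})) / real (n k) \<le>
      1 * (real (card (S k \<inter> {..<n k})) / real (n k) + real (card (T k \<inter> {..<n k})) / real (n k))"
    using n_pos[of k] by (simp add: add_divide_distrib[symmetric] divide_right_mono)
next
  show "((\<lambda>k. real (card (S k \<inter> {..<n k})) / real (n k) + real (card (T k \<inter> {..<n k})) / real (n k)) \<longlongrightarrow> 0) \<omega>"
    using tendsto_add[OF assms[unfolded negligible_def]] by simp
qed simp

lemma negligible_subset: "negligible T \<Longrightarrow> (\<And>k. S k \<inter> {..<n k} \<subseteq> T k) \<Longrightarrow> negligible S"
  unfolding negligible_def
proof (rule near_le[where c = 1 and g = "\<lambda>k. real (card (T k \<inter> {..<n k})) / real (n k)"])
  fix k assume "\<And>k. S k \<inter> {..<n k} \<subseteq> T k"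
  then have "card (S k \<inter> {..<n k}) \<le> card (T k \<inter> {..<n k})" by (intro card_mono) auto
  then show "real (card (S k \<inter> {..<n k})) / real (n k) \<le> 1 * (real (card (T k \<inter> {..<n k})) / real (n k))"
    by (simp add: divide_right_mono)
qed auto

text \<open>In column \<open>y\<close> only the entry in row \<open>\<sigma> k y\<close> can be
  nonzero. Right multiplication by the indicator of \<open>S\<close> keeps it if \<open>y\<close> is
  in \<open>S k\<close>, left multiplication by that of \<open>T\<close> if
  \<open>\<sigma> k y\<close> is in \<open>T k\<close>; a mismatch costs the square of its modulus.
  Columns where this entry is small are few because \<open>x\<close> is almost an isometry.\<close>

lemma supported_conj:
  assumes b: "x \<in> bounded_seqs n" and s: "supported \<sigma> x" and \<sigma>: "\<And>k. \<sigma> k permutes {..<n k}"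
    and unit: "near (\<lambda>k. mat_adjoint (x k) * x k) (\<lambda>k. 1\<^sub>m (n k))"
    and comm: "near (\<lambda>k. x k * diag_indicator S k) (\<lambda>k. diag_indicator T k * x k)"
  shows "negligible (\<lambda>k. {y. (y \<in> S k) \<noteq> (\<sigma> k y \<in> T k)})"
proof -
  have sp: "\<sigma> k y < n k" if "y < n k" for k y using permutes_in_image[OF \<sigma>, of k y] that by simp
  define c where "c k y = entry (x k) (\<sigma> k y) y" for k y
  \<comment> \<open>With the threshold 1/2, a mismatch in \<open>A\<close> costs at least 1/2, hence
    the constant 2. In \<open>B\<close> the diagonal entry of the adjoint times \<open>x\<close> is
    off 1 by more than 1/2, which costs at least 1/4 and gives the constant 4.\<close>
  define A where "A k = {y. (y \<in> S k) \<noteq> (\<sigma> k y \<in> T k) \<and> 1 / 2 \<le> (cmod (c k y))\<^sup>2}" for k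
  define B where "B k = {y. (cmod (c k y))\<^sup>2 < 1 / 2}" for k
  have xc: "x k \<in> carrier_mat (n k) (n k)" for k using bounded_carrier[OF b] .
  have "negligible A"
  proof (rule negligible_le[where c = 2, OF _ comm])
    fix k
    let ?e = "\<lambda>i j. entry (x k * diag_indicator S k) i j - entry (diag_indicator T k * x k) i j"
    have "real (card (A k \<inter> {..<n k})) = (\<Sum>j<n k. if j \<in> A k then 1 else 0)"
      by (rule card_eq_sum)
    also have "\<dots> \<le> (\<Sum>j<n k. 2 * (\<Sum>i<n k. (cmod (?e i j))\<^sup>2))"
    proof (rule sum_mono)
      fix j assume j: "j \<in> {..<n k}"
      have "(if j \<in> A k then 1 else 0) \<le> 2 * (cmod (?e (\<sigma> k j) j))\<^sup>2"
        using j sp[of j k] by (auto simp: entry_diag_indicator_mult[OF xc] A_def c_def)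
      also have "\<dots> \<le> 2 * (\<Sum>i<n k. (cmod (?e i j))\<^sup>2)"
        using sp[of j k] j by (intro mult_left_mono member_le_sum[where f = "\<lambda>i. (cmod (?e i j))\<^sup>2"]) auto
      finally show "(if j \<in> A k then 1 else 0) \<le> 2 * (\<Sum>i<n k. (cmod (?e i j))\<^sup>2)" .
    qed
    also have "\<dots> = 2 * hs_sq (n k) ?e" unfolding hs_sq_def sum_distrib_left by (rule sum.swap)
    finally show "real (card (A k \<inter> {..<n k})) \<le> 2 * hs_sq (n k) ?e" .
  qed
  moreover have "negligible B"
  proof (rule negligible_le[where c = 4, OF _ unit])
    fix k
    let ?e = "\<lambda>i j. entry (mat_adjoint (x k) * x k) i j - entry (1\<^sub>m (n k)) i j"
    have d: "entry (mat_adjoint (x k) * x k) j j = complex_of_real ((cmod (c k j))\<^sup>2)" if j: "j < n k" for j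
    proof -
      have "entry (mat_adjoint (x k)) j l * entry (x k) l j = 0" if "l < n k" "l \<noteq> \<sigma> k j" for l
        using s j that unfolding supported_def by (metis mult_zero_right)
      then have "entry (mat_adjoint (x k) * x k) j j = entry (mat_adjoint (x k)) j (\<sigma> k j) * entry (x k) (\<sigma> k j) j"
        by (rule entry_mult_single[OF adjoint_carrier[OF xc] xc j j sp[OF j]])
      also have "\<dots> = cnj (c k j) * c k j" by (simp add: entry_adjoint[OF xc j sp[OF j]] c_def)
      also have "\<dots> = complex_of_real ((cmod (c k j))\<^sup>2)" unfolding complex_norm_square by (simp only: mult.commute)
      finally show ?thesis .
    qed
    have "real (card (B k \<inter> {..<n k})) = (\<Sum>j<n k. if j \<in> B k then 1 else 0)"
      by (rule card_eq_sum)
    also have "\<dots> \<le> (\<Sum>j<n k. 4 * (\<Sum>i<n k. (cmod (?e j i))\<^sup>2))"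
    proof (rule sum_mono)
      fix j assume j: "j \<in> {..<n k}"
      have "?e j j = complex_of_real ((cmod (c k j))\<^sup>2 - 1)" using d[of j] j by (simp add: entry_def[of "1\<^sub>m _"])
      then have ce: "cmod (?e j j) = \<bar>(cmod (c k j))\<^sup>2 - 1\<bar>" by (simp only: norm_of_real)
      have "(if j \<in> B k then 1 else 0) \<le> 4 * (cmod (?e j j))\<^sup>2"
      proof (cases "j \<in> B k")
        case True
        then have "1 / 2 \<le> \<bar>(cmod (c k j))\<^sup>2 - 1\<bar>" by (simp add: B_def)
        then have "(1 / 2)\<^sup>2 \<le> (cmod (?e j j))\<^sup>2" unfolding ce by (intro power_mono) auto
        then show ?thesis using True by (simp add: power2_eq_square)
      qed simp
      also have "\<dots> \<le> 4 * (\<Sum>i<n k. (cmod (?e j i))\<^sup>2)"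
        using j by (intro mult_left_mono member_le_sum[where f = "\<lambda>i. (cmod (?e j i))\<^sup>2"]) auto
      finally show "(if j \<in> B k then 1 else 0) \<le> 4 * (\<Sum>i<n k. (cmod (?e j i))\<^sup>2)" .
    qed
    also have "\<dots> = 4 * hs_sq (n k) ?e" unfolding hs_sq_def sum_distrib_left ..
    finally show "real (card (B k \<inter> {..<n k})) \<le> 4 * hs_sq (n k) ?e" .
  qed
  ultimately have "negligible (\<lambda>k. A k \<union> B k)" by (rule negligible_Un)
  then show ?thesis by (rule negligible_subset) (auto simp: A_def B_def)
qed

lemma diag_indicator_trim: "diag_indicator (\<lambda>k. S k \<inter> {..<n k}) = diag_indicator S"
  by (rule ext, rule eq_matI) (auto simp: diag_indicator_def)

lemma one_diag_indicator: "(\<lambda>k. 1\<^sub>m (n k)) = diag_indicator (\<lambda>_. UNIV)"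
  by (rule ext, rule eq_matI) (auto simp: diag_indicator_def)

lemma supported_diag_indicator: "supported (\<lambda>k y. y) (diag_indicator S)"
  unfolding supported_def by (auto simp: diag_indicator_entry)

lemma ntr_diag_indicator:
  assumes "S k \<subseteq> {..<n k}"
  shows "ntr (diag_indicator S k) = complex_of_real (real (card (S k)) / real (n k))"
proof -
  have "(\<Sum>i<n k. diag_indicator S k $$ (i, i)) = (\<Sum>i<n k. complex_of_real (if i \<in> S k then 1 else 0))"
    by (rule sum.cong) (auto simp: diag_indicator_def)
  also have "\<dots> = complex_of_real (real (card (S k \<inter> {..<n k})))" unfolding card_eq_sum of_real_sum ..
  finally show ?thesis using assms by (simp add: ntr_def diag_indicator_def Int_absorb2)
qed

text \<open>The trace is a \<open>Lim\<close>, which says nothing before convergence is known.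
  Compactness first yields some limit of the proportions; the trace then identifies it.\<close>

lemma tau_diag_indicator:
  assumes \<omega>: "free_ultrafilter \<omega>" and S: "\<And>k. S k \<subseteq> {..<n k}" and tau: "tau \<U> (cls (diag_indicator S)) = complex_of_real c"
  shows "((\<lambda>k. real (card (S k)) / real (n k)) \<longlongrightarrow> c) \<omega>"
proof -
  have nb: "\<omega> \<noteq> bot" using \<omega> by (simp add: free_ultrafilter_def)
  have "real (card (S k)) / real (n k) \<in> {0..1}" for k
    using card_mono[OF _ S[of k]] n_pos[of k] by simp
  then obtain l where l: "((\<lambda>k. real (card (S k)) / real (n k)) \<longlongrightarrow> l) \<omega>"
    using ultrafilter_converges[OF \<omega>, of "\<lambda>k. real (card (S k)) / real (n k)"] by blast
  let ?x = "rep (cls (diag_indicator S))"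
  have "((\<lambda>k. complex_of_real (real (card (S k)) / real (n k))) \<longlongrightarrow> complex_of_real l) \<omega>"
    using l by (rule tendsto_of_real)
  then have "((\<lambda>k. ntr (diag_indicator S k)) \<longlongrightarrow> complex_of_real l) \<omega>" using ntr_diag_indicator[of S] S by simp
  from tendsto_add[OF ntr_near[OF rep_cls(1)[OF diag_indicator_bounded[of S]] diag_indicator_bounded[of S] rep_cls(2)[OF diag_indicator_bounded[of S]]] this]
  have "((\<lambda>k. ntr (?x k)) \<longlongrightarrow> complex_of_real l) \<omega>" by simp
  from tendsto_Lim[OF nb this] have "complex_of_real l = complex_of_real c"
    using tau by (simp add: ultraproduct_def)
  then show ?thesis using l by simp
qed

definition perm_seq :: "(nat \<Rightarrow> nat \<Rightarrow> nat) \<Rightarrow> nat \<Rightarrow> complex mat" where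
  "perm_seq \<sigma> k = mat (n k) (n k) (\<lambda>(i, j). if i = \<sigma> k j then 1 else 0)"

lemma perm_seq_entry: "i < n k \<Longrightarrow> j < n k \<Longrightarrow> entry (perm_seq \<sigma> k) i j = (if i = \<sigma> k j then 1 else 0)"
  by (simp add: entry_def perm_seq_def)

lemma perm_seq_supported: "supported \<sigma> (perm_seq \<sigma>)"
  unfolding supported_def by (auto simp: perm_seq_entry split: if_splits)

lemma perm_seq_bounded:
  assumes \<sigma>: "\<And>k. \<sigma> k permutes {..<n k}"
  shows "perm_seq \<sigma> \<in> bounded_seqs n"
proof -
  have "op_bounded (n k) 1 (entry (perm_seq \<sigma> k))" for k
    unfolding op_bounded_def
  proof
    fix v :: "nat \<Rightarrow> complex"
    have e: "(\<Sum>l<n k. entry (perm_seq \<sigma> k) (\<sigma> k i) l * v l) = v i" if i: "i < n k" for i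
    proof -
      have "\<sigma> k i < n k" using permutes_in_image[OF \<sigma>, of k i] i by simp
      moreover have "\<sigma> k i = \<sigma> k l \<longleftrightarrow> i = l" for l using permutes_inj[OF \<sigma>, of k] by (auto dest: injD)
      ultimately have "(\<Sum>l<n k. entry (perm_seq \<sigma> k) (\<sigma> k i) l * v l) = (\<Sum>l<n k. if l = i then v l else 0)"
        by (intro sum.cong) (auto simp: perm_seq_entry)
      then show ?thesis using i by simp
    qed
    have "(\<Sum>i<n k. (cmod (\<Sum>l<n k. entry (perm_seq \<sigma> k) i l * v l))\<^sup>2) = (\<Sum>i<n k. (cmod (\<Sum>l<n k. entry (perm_seq \<sigma> k) (\<sigma> k i) l * v l))\<^sup>2)"
      using sum.permute[OF \<sigma>, of "\<lambda>i. (cmod (\<Sum>l<n k. entry (perm_seq \<sigma> k) i l * v l))\<^sup>2" k] by (simp add: comp_def)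
    also have "\<dots> = (\<Sum>i<n k. (cmod (v i))\<^sup>2)" by (rule sum.cong) (simp_all add: e)
    finally show "(\<Sum>i<n k. (cmod (\<Sum>l<n k. entry (perm_seq \<sigma> k) i l * v l))\<^sup>2) \<le> 1\<^sup>2 * (\<Sum>l<n k. (cmod (v l))\<^sup>2)" by simp
  qed
  then show ?thesis unfolding bounded_seqs_iff by (auto simp: perm_seq_def)
qed

lemma supported_diagonal:
  assumes "z \<in> bounded_seqs n" "\<And>k. diagonal_mat (z k)"
  shows "supported (\<lambda>k y. y) z"
  using assms(2) bounded_carrier[OF assms(1)] unfolding supported_def diagonal_mat_def entry_def
  by (metis carrier_matD)

lemma supported_adjoint:
  assumes "x \<in> bounded_seqs n" "supported \<sigma> x" "\<And>k. \<sigma> k permutes {..<n k}"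
  shows "supported (\<lambda>k. inv_into UNIV (\<sigma> k)) (\<lambda>k. mat_adjoint (x k))"
  unfolding supported_def
proof (intro allI impI)
  fix k i j assume ij: "i < n k" "j < n k" and ne: "entry (mat_adjoint (x k)) i j \<noteq> 0"
  have "entry (x k) j i \<noteq> 0" using ne entry_adjoint[OF bounded_carrier[OF assms(1)] ij] by auto
  then have "j = \<sigma> k i" using assms(2) ij unfolding supported_def by blast
  then show "i = inv_into UNIV (\<sigma> k) j" using permutes_inverses(2)[OF assms(3)] by simp
qed

end

context involution_relation
begin

section \<open>Finite models of a sofic relation\<close>

text \<open>The sign of a letter is ignored because each generator acts by an involution.\<close>

definition act :: "letter list \<Rightarrow> 'a \<Rightarrow> 'a" where
  "act v x = foldr (\<lambda>g. t (fst g)) v x"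

text \<open>The order in which the product of the unitaries of \<open>v\<close> composes the maps.
  As the letters act by involutions, it inverts \<open>act v\<close>.\<close>

definition act_opposite :: "letter list \<Rightarrow> 'a \<Rightarrow> 'a" where
  "act_opposite v x = foldl (\<lambda>x g. t (fst g) x) x v"

lemma act_simps [simp]: "act [] x = x" "act (g # v) x = t (fst g) (act v x)"
  by (simp_all add: act_def)

lemma act_opposite_simps [simp]: "act_opposite [] x = x" "act_opposite (g # v) x = act_opposite v (t (fst g) x)"
  by (simp_all add: act_opposite_def)

lemma act_space: "x \<in> space M \<Longrightarrow> act v x \<in> space M"
  by (induction v) (simp_all add: t_space)

lemma act_act_opposite: "x \<in> space M \<Longrightarrow> act v (act_opposite v x) = x"
  by (induction v arbitrary: x) (simp_all add: t_space t_inv)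

lemma aut_act_opposite: "aut (act_opposite v)"
proof (induction v)
  case Nil
  have "act_opposite [] = (\<lambda>x. x)" by (simp add: fun_eq_iff)
  then show ?case using aut_id by simp
next
  case (Cons g v)
  have "act_opposite (g # v) = (\<lambda>x. act_opposite v (t (fst g) x))" by (simp add: fun_eq_iff)
  then show ?case using aut_comp[OF aut_t Cons] by simp
qed

lemma act_opposite_set: "F \<in> sets M \<Longrightarrow> {x \<in> space M. act_opposite v x \<in> F} \<in> sets M"
  using W_mult(2)[OF aut_act_opposite sets.top aut_id] .

text \<open>Induction step for the product of the unitaries of a word with \<open>P F\<close>: the
  domain of the resulting partial isometry is always the full preimage of \<open>F\<close>.\<close>

lemma W_act_opposite:
  assumes F: "F \<in> sets M"
  shows "U n \<otimes>\<^bsub>vN\<^esub> W (act_opposite v) {x \<in> space M. act_opposite v x \<in> F} = W (act_opposite ((n, b) # v)) {x \<in> space M. act_opposite ((n, b) # v) x \<in> F}"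
proof -
  have e: "{x \<in> space M. t n x \<in> {x \<in> space M. act_opposite v x \<in> F}} = {x \<in> space M. act_opposite ((n, b) # v) x \<in> F}"
    using t_space by auto
  have f: "act_opposite ((n, b) # v) = (\<lambda>x. act_opposite v (t n x))" by (simp add: fun_eq_iff)
  show ?thesis
    unfolding W_mult(1)[OF aut_t sets.top aut_act_opposite act_opposite_set[OF F]] e unfolding f ..
qed

text \<open>Being inverse to \<open>act v\<close>, the map \<open>act_opposite v\<close> is the
  identity on \<open>F\<close> and sends no other point into \<open>F\<close>.\<close>

lemma W_act_opposite_fixed:
  assumes F: "F \<in> sets M" and fx: "\<And>x. x \<in> F \<Longrightarrow> act v x = x"
  shows "W (act_opposite v) {x \<in> space M. act_opposite v x \<in> F} = P F"
proof -
  have FM: "F \<subseteq> space M" using sets.sets_into_space[OF F] .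
  have 1: "act_opposite v x = x" if "x \<in> space M" "act_opposite v x \<in> F" for x
    using fx[OF that(2)] act_act_opposite[OF that(1)] by simp
  have 2: "act_opposite v x = x" if "x \<in> F" for x
  proof -
    obtain y where y: "y \<in> space M" "act_opposite v y = x"
      using bij_betw_imp_surj_on[OF aut_bij[OF aut_act_opposite[of v]]] subsetD[OF FM \<open>x \<in> F\<close>] by (metis imageE)
    then show ?thesis using 1[of y] that by simp
  qed
  have e: "{x \<in> space M. act_opposite v x \<in> F} = F" using FM by (auto simp: 2) (use 1 in force)
  show ?thesis unfolding e by (rule W_cong) (rule 2)
qed

definition pact :: "(letter \<Rightarrow> nat \<Rightarrow> nat \<Rightarrow> nat) \<Rightarrow> letter list \<Rightarrow> nat \<Rightarrow> nat \<Rightarrow> nat" where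
  "pact p v k y = foldr (\<lambda>g. p g k) v y"

lemma pact_simps [simp]: "pact p [] k y = y" "pact p (g # v) k y = p g k (pact p v k y)"
  by (simp_all add: pact_def)

text \<open>All that is kept of the embedding: \<open>D C\<close> models the indicator of
  \<open>C\<close> and \<open>p g\<close> the letter \<open>g\<close>. The clauses on permutations
  are exact, so that the free group acts; those comparing with \<open>M\<close> hold asymptotically.
  The last clause bounds one direction only; the converse is obtained in
  \<open>tracks_fix\<close>.\<close>

definition model :: "nat filter \<Rightarrow> (nat \<Rightarrow> nat) \<Rightarrow> ('a set \<Rightarrow> nat \<Rightarrow> nat set) \<Rightarrow> (letter \<Rightarrow> nat \<Rightarrow> nat \<Rightarrow> nat) \<Rightarrow> bool" where
  "model \<omega> n D p \<longleftrightarrow> (\<forall>k. n k > 0) \<and> (\<forall>C\<in>sets M. \<forall>k. D C k \<subseteq> {..<n k}) \<and>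
     (\<forall>C\<in>sets M. ((\<lambda>k. real (card (D C k)) / real (n k)) \<longlongrightarrow> measure M C) \<omega>) \<and>
     (\<forall>C\<in>sets M. \<forall>C'\<in>sets M. ultra.negligible \<omega> n (\<lambda>k. sym_diff (D (C \<inter> C') k) (D C k \<inter> D C' k))) \<and>
     (\<forall>g k. p g k permutes {..<n k} \<and> p (linv g) k = inv_into UNIV (p g k)) \<and>
     (\<forall>g. \<forall>C\<in>sets M. ultra.negligible \<omega> n (\<lambda>k. {y. (y \<in> D C k) \<noteq> (p g k y \<in> D {x \<in> space M. t (fst g) x \<in> C} k)})) \<and>
     (\<forall>v. \<forall>F\<in>sets M. (\<forall>x\<in>F. act v x = x) \<longrightarrow> ultra.negligible \<omega> n (\<lambda>k. {y \<in> D F k. pact p v k y \<noteq> y}))"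

lemma sofic_model:
  assumes \<omega>: "free_ultrafilter \<omega>" and s: "sofic_relation \<omega> M E"
  shows "\<exists>n D p. model \<omega> n D p"
proof -
  obtain n \<Theta> where n: "\<And>k. n k > 0" and emb: "tracial_embedding vN (ultraproduct \<omega> n) \<Theta>"
    and diag_im: "\<Theta> ` cartan \<subseteq> ultra_diag \<omega> n"
    and norm_im: "\<Theta> ` normalizer_group vN cartan \<subseteq>
       \<Theta> ` (unitaries vN \<inter> cartan) <#>\<^bsub>ultraproduct \<omega> n\<^esub> ultra_perm \<omega> n"
    using s unfolding sofic_relation_def by (elim exE conjE) (rule that, auto)
  interpret ultra \<omega> n by unfold_locales (rule n)
  have hom: "\<Theta> \<in> Ring.ring_hom vN \<U>" using emb by (simp add: tracial_embedding_def)
  have \<Theta>_mult: "\<Theta> (S \<otimes>\<^bsub>vN\<^esub> T) = \<Theta> S \<otimes>\<^bsub>\<U>\<^esub> \<Theta> T" if "S \<in> WC" "T \<in> WC" for S T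
    using ring_hom_mult[OF hom] that by (simp add: carrier_vN)
  have \<Theta>_one: "\<Theta> \<one>\<^bsub>vN\<^esub> = \<one>\<^bsub>\<U>\<^esub>" using ring_hom_one[OF hom] .
  have \<Theta>_inv: "\<Theta> (involution vN T) = involution \<U> (\<Theta> T)" if "T \<in> WC" for T
    using emb that by (simp add: tracial_embedding_def carrier_vN)
  have \<Theta>_tau: "tau \<U> (\<Theta> T) = tau vN T" if "T \<in> WC" for T
    using emb that by (simp add: tracial_embedding_def carrier_vN)
  have PW: "P C \<in> WC" if "C \<in> sets M" for C using W_carrier[OF aut_id that] .
  have UW: "U m \<in> WC" for m by (rule W_carrier[OF aut_t]) simp
  have PP: "P C \<otimes>\<^bsub>vN\<^esub> P C' = P (C \<inter> C')" if "C \<in> sets M" "C' \<in> sets M" for C C'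
  proof -
    have "{x \<in> C. x \<in> C'} = C \<inter> C'" by blast
    then show ?thesis using W_mult(1)[OF aut_id that(1) aut_id that(2)] by simp
  qed
  have "\<exists>S. (\<forall>k. S k \<subseteq> {..<n k}) \<and> \<Theta> (P C) = cls (diag_indicator S)" if C: "C \<in> sets M" for C
  proof -
    have "\<Theta> (P C) \<in> ultra_diag \<omega> n" using diag_im P_cartan[OF C] by blast
    then obtain z where z: "z \<in> bounded_seqs n" "\<And>k. diagonal_mat (z k)" "\<Theta> (P C) = cls z"
      unfolding ultra_diag_def by blast
    have "cls (\<lambda>k. z k * z k) = cls z"
      using \<Theta>_mult[OF PW[OF C] PW[OF C]] PP[OF C C] z by (simp add: mult_cls)
    then have "near (\<lambda>k. z k * z k) z" using cls_eq_iff[OF bounded_mult[OF z(1) z(1)] z(1)] by simp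
    then obtain S where "near z (diag_indicator S)" using diag_idempotent[OF z(1,2)] by blast
    then have "\<Theta> (P C) = cls (diag_indicator S)" using z cls_eq_iff[OF z(1) diag_indicator_bounded] by simp
    \<comment> \<open>The rounded set may contain indices beyond the matrix; cutting them off leaves
      the matrices unchanged.\<close>
    then show ?thesis by (intro exI[of _ "\<lambda>k. S k \<inter> {..<n k}"]) (simp add: diag_indicator_trim)
  qed
  then obtain D where D: "\<And>C k. C \<in> sets M \<Longrightarrow> D C k \<subseteq> {..<n k}" "\<And>C. C \<in> sets M \<Longrightarrow> \<Theta> (P C) = cls (diag_indicator (D C))"
    by metis
  have "\<exists>\<sigma> x. (\<forall>k. \<sigma> k permutes {..<n k}) \<and> x \<in> bounded_seqs n \<and> supported \<sigma> x \<and> \<Theta> (U m) = cls x" for m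
  proof -
    have "\<Theta> (U m) \<in> \<Theta> ` (unitaries vN \<inter> cartan) <#>\<^bsub>\<U>\<^esub> ultra_perm \<omega> n" using norm_im U_normalizer by blast
    then obtain a h where ah: "a \<in> cartan" "h \<in> ultra_perm \<omega> n" "\<Theta> (U m) = \<Theta> a \<otimes>\<^bsub>\<U>\<^esub> h"
      unfolding set_mult_def by blast
    obtain z where z: "z \<in> bounded_seqs n" "\<And>k. diagonal_mat (z k)" "\<Theta> a = cls z"
      using diag_im ah(1) unfolding ultra_diag_def by blast
    obtain q where q: "\<And>k. q k \<in> permutation_matrices (n k)" "h = cls q" using ah(2) unfolding ultra_perm_def by blast
    have "\<forall>k. \<exists>\<sigma>. \<sigma> permutes {..<n k} \<and> q k = mat (n k) (n k) (\<lambda>(i, j). if i = \<sigma> j then 1 else 0)"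
      using q(1) unfolding permutation_matrices_def by blast
    then obtain \<sigma> where \<sigma>: "\<And>k. \<sigma> k permutes {..<n k}" "\<And>k. q k = mat (n k) (n k) (\<lambda>(i, j). if i = \<sigma> k j then 1 else 0)"
      by metis
    have q': "q = perm_seq \<sigma>" using \<sigma>(2) by (simp add: fun_eq_iff perm_seq_def)
    have qb: "q \<in> bounded_seqs n" unfolding q' by (rule perm_seq_bounded[OF \<sigma>(1)])
    have "supported \<sigma> (\<lambda>k. z k * q k)"
      using supported_mult[OF z(1) qb supported_diagonal[OF z(1,2)], of \<sigma>] perm_seq_supported[of \<sigma>] permutes_in_image[OF \<sigma>(1)]
      by (simp add: q')
    moreover have "\<Theta> (U m) = cls (\<lambda>k. z k * q k)" using ah(3) z(3) q(2) mult_cls[OF z(1) qb] by simp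
    ultimately show ?thesis using \<sigma>(1) bounded_mult[OF z(1) qb] by blast
  qed
  then obtain \<sigma> x where \<sigma>: "\<And>m k. \<sigma> m k permutes {..<n k}" and x: "\<And>m. x m \<in> bounded_seqs n"
    "\<And>m. supported (\<sigma> m) (x m)" "\<And>m. \<Theta> (U m) = cls (x m)" by metis
  \<comment> \<open>The adjoint matrices represent the same element, as \<open>U m\<close> is
    self-adjoint, but they are supported on the graph of the inverse permutation. So an inverse
    letter can get the exact inverse even if \<open>\<sigma> m k\<close> is not an
    involution.\<close>
  define p where "p = (\<lambda>(m, s) k. if s then \<sigma> m k else inv_into UNIV (\<sigma> m k))"
  define w where "w = (\<lambda>(m, s). if s then x m else (\<lambda>k. mat_adjoint (x m k)))"
  have U_inv: "involution \<U> (\<Theta> (U m)) = \<Theta> (U m)" for m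
    using \<Theta>_inv[OF UW, of m] by (simp add: involution_vN U_adjoint)
  have p: "p g k permutes {..<n k}" "p (linv g) k = inv_into UNIV (p g k)" for g k
    using \<sigma> permutes_inv by (cases g; auto simp: p_def inv_inv_eq[OF permutes_bij[OF \<sigma>]])+
  have w: "w g \<in> bounded_seqs n" "supported (p g) (w g)" "\<Theta> (U (fst g)) = cls (w g)" for g
  proof -
    obtain m s where g: "g = (m, s)" by (cases g)
    have "\<Theta> (U m) = cls (\<lambda>k. mat_adjoint (x m k))" using U_inv[of m] x(3)[of m] involution_cls[OF x(1)] by simp
    then show "w g \<in> bounded_seqs n" "supported (p g) (w g)" "\<Theta> (U (fst g)) = cls (w g)"
      using x[of m] bounded_adjoint[OF x(1)] supported_adjoint[OF x(1,2) \<sigma>] by (auto simp: g w_def p_def)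
  qed
  have unit: "near (\<lambda>k. mat_adjoint (w g k) * w g k) (\<lambda>k. 1\<^sub>m (n k))" for g
  proof -
    have "cls (\<lambda>k. mat_adjoint (w g k) * w g k) = \<Theta> (U (fst g)) \<otimes>\<^bsub>\<U>\<^esub> \<Theta> (U (fst g))"
      using mult_cls[OF bounded_adjoint[OF w(1)] w(1), of g] involution_cls[OF w(1), of g] U_inv[of "fst g"] w(3)[of g] by simp
    also have "\<dots> = cls (\<lambda>k. 1\<^sub>m (n k))"
      using \<Theta>_mult[OF UW UW, of "fst g" "fst g"] by (simp add: U_U \<Theta>_one one_cls)
    finally show ?thesis
      using cls_eq_iff[OF bounded_mult[OF bounded_adjoint[OF w(1)] w(1)] diag_indicator_bounded] by (simp add: one_diag_indicator)
  qed
  have comm: "near (\<lambda>k. w g k * diag_indicator (D C) k) (\<lambda>k. diag_indicator (D {x \<in> space M. t (fst g) x \<in> C}) k * w g k)" if C: "C \<in> sets M" for g C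
  proof -
    let ?C = "{x \<in> space M. t (fst g) x \<in> C}"
    have C': "?C \<in> sets M" using W_mult(2)[OF aut_t sets.top aut_id C] .
    have e: "{x \<in> ?C. x \<in> space M} = ?C" by blast
    have "U (fst g) \<otimes>\<^bsub>vN\<^esub> P C = P ?C \<otimes>\<^bsub>vN\<^esub> U (fst g)"
      unfolding W_mult(1)[OF aut_t sets.top aut_id C] W_mult(1)[OF aut_id C' aut_t sets.top] e ..
    then have "\<Theta> (U (fst g)) \<otimes>\<^bsub>\<U>\<^esub> \<Theta> (P C) = \<Theta> (P ?C) \<otimes>\<^bsub>\<U>\<^esub> \<Theta> (U (fst g))"
      using \<Theta>_mult[OF UW PW[OF C], of "fst g"] \<Theta>_mult[OF PW[OF C'] UW, of "fst g"] by simp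
    then have "cls (\<lambda>k. w g k * diag_indicator (D C) k) = cls (\<lambda>k. diag_indicator (D ?C) k * w g k)"
      by (simp add: D(2)[OF C] D(2)[OF C'] w(3) mult_cls w(1) diag_indicator_bounded)
    then show ?thesis using cls_eq_iff bounded_mult w(1) diag_indicator_bounded by blast
  qed
  have fixed: "negligible (\<lambda>k. {y \<in> D F k. pact p v k y \<noteq> y})" if F: "F \<in> sets M" "\<forall>x\<in>F. act v x = x" for v F
  proof -
    \<comment> \<open>The product of the letter matrices with the model of \<open>F\<close>. The
      induction follows its support and its class together: the support gives the permutation word,
      the class stays the image of an explicit operator.\<close>
    define X where "X v = foldr (\<lambda>g y k. w g k * y k) v (diag_indicator (D F))" for v
    have Xs: "X [] = diag_indicator (D F)" "X (g # v) = (\<lambda>k. w g k * X v k)" for g v by (simp_all add: X_def)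
    have pn: "pact p v k y < n k" if "y < n k" for v k y
      using that permutes_in_image[OF p(1)] by (induction v) auto
    have "X v \<in> bounded_seqs n \<and> supported (pact p v) (X v) \<and>
        cls (X v) = \<Theta> (W (act_opposite v) {x \<in> space M. act_opposite v x \<in> F})" for v
    proof (induction v)
      case Nil
      have "{x \<in> space M. act_opposite [] x \<in> F} = F" using sets.sets_into_space[OF F(1)] by auto
      moreover have "act_opposite [] = (\<lambda>x. x)" by (simp add: fun_eq_iff)
      moreover have "pact p [] = (\<lambda>k y. y)" by (simp add: fun_eq_iff)
      ultimately show ?case by (simp add: Xs diag_indicator_bounded supported_diag_indicator D(2)[OF F(1)])
    next
      case (Cons g v)
      obtain m s where g: "g = (m, s)" by (cases g)
      have "pact p (g # v) = (\<lambda>k y. p g k (pact p v k y))" by (simp add: fun_eq_iff)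
      moreover have "cls (X (g # v)) = \<Theta> (U m) \<otimes>\<^bsub>\<U>\<^esub> \<Theta> (W (act_opposite v) {x \<in> space M. act_opposite v x \<in> F})"
        unfolding Xs using mult_cls[of "w g" "X v"] Cons w[of g] by (simp only: g fst_conv)
      moreover have "\<dots> = \<Theta> (W (act_opposite (g # v)) {x \<in> space M. act_opposite (g # v) x \<in> F})"
        unfolding g W_act_opposite[OF F(1), of m v s, symmetric] by (rule \<Theta>_mult[symmetric, OF UW W_carrier[OF aut_act_opposite act_opposite_set[OF F(1)]]])
      ultimately show ?case using Cons w[of g] bounded_mult[of "w g" n "X v"]
          supported_mult[of "w g" "X v" "p g" "pact p v", OF _ _ _ _ pn] by (simp only: Xs)
    qed
    then have X: "X v \<in> bounded_seqs n" "supported (pact p v) (X v)" "cls (X v) = cls (diag_indicator (D F))"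
      using W_act_opposite_fixed[OF F(1), of v] F(2) D(2)[OF F(1)] by auto
    have "near (X v) (diag_indicator (D F))" using X(3) cls_eq_iff[OF X(1) diag_indicator_bounded] by simp
    then show ?thesis by (rule supported_fixed[OF X(2)])
  qed
  have "model \<omega> n D p" unfolding model_def
  proof (intro conjI allI ballI impI)
    fix C assume C: "C \<in> sets M"
    show "((\<lambda>k. real (card (D C k)) / real (n k)) \<longlongrightarrow> measure M C) \<omega>"
      using \<Theta>_tau[OF PW[OF C]] by (intro tau_diag_indicator[OF \<omega> D(1)[OF C]]) (simp add: D(2)[OF C] P_tau[OF C])
    show "negligible (\<lambda>k. {y. (y \<in> D C k) \<noteq> (p g k y \<in> D {x \<in> space M. t (fst g) x \<in> C} k)})" for g
      by (rule supported_conj[OF w(1,2) p(1) unit comm[OF C]])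
    fix C' assume C': "C' \<in> sets M"
    have "cls (diag_indicator (D (C \<inter> C'))) = cls (diag_indicator (\<lambda>k. D C k \<inter> D C' k))"
      using \<Theta>_mult[OF PW[OF C] PW[OF C']] PP[OF C C'] D(2)[of "C \<inter> C'"] C C' by (simp add: D(2) mult_cls diag_indicator_bounded diag_indicator_mult)
    then show "negligible (\<lambda>k. sym_diff (D (C \<inter> C') k) (D C k \<inter> D C' k))"
      by (intro diag_indicator_near) (simp add: cls_eq_iff diag_indicator_bounded)
  qed (use n D(1) p fixed in auto)
  then show ?thesis by blast
qed

end

section \<open>Transfer of measurable properties to the finite sets\<close>

locale sofic_modelled = involution_relation M E t + ultra \<omega> n
  for M :: "'a measure" and E t \<omega> n +
  fixes D :: "'a set \<Rightarrow> nat \<Rightarrow> nat set" and p :: "letter \<Rightarrow> nat \<Rightarrow> nat \<Rightarrow> nat"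
  assumes \<omega>: "free_ultrafilter \<omega>" and model: "model \<omega> n D p"
begin

lemmas modelD = model[unfolded model_def]

lemma D_subset: "C \<in> sets M \<Longrightarrow> D C k \<subseteq> {..<n k}"
  by (rule modelD[THEN conjunct2, THEN conjunct1, rule_format])

lemma D_density: "C \<in> sets M \<Longrightarrow> ((\<lambda>k. real (card (D C k)) / real (n k)) \<longlongrightarrow> measure M C) \<omega>"
  by (rule modelD[THEN conjunct2, THEN conjunct2, THEN conjunct1, rule_format])

lemma D_Int: "C \<in> sets M \<Longrightarrow> C' \<in> sets M \<Longrightarrow> negligible (\<lambda>k. sym_diff (D (C \<inter> C') k) (D C k \<inter> D C' k))"
  by (rule modelD[THEN conjunct2, THEN conjunct2, THEN conjunct2, THEN conjunct1, rule_format])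

lemmas p_facts = modelD[THEN conjunct2, THEN conjunct2, THEN conjunct2, THEN conjunct2, THEN conjunct1, THEN spec, THEN spec]
lemmas p_permutes = p_facts[THEN conjunct1] and p_linv = p_facts[THEN conjunct2]

lemma D_pre: "C \<in> sets M \<Longrightarrow> negligible (\<lambda>k. {y. (y \<in> D C k) \<noteq> (p g k y \<in> D {x \<in> space M. t (fst g) x \<in> C} k)})"
  by (rule modelD[THEN conjunct2, THEN conjunct2, THEN conjunct2, THEN conjunct2, THEN conjunct2, THEN conjunct1, rule_format])

lemma D_fixed: "F \<in> sets M \<Longrightarrow> (\<And>x. x \<in> F \<Longrightarrow> act v x = x) \<Longrightarrow> negligible (\<lambda>k. {y \<in> D F k. pact p v k y \<noteq> y})"
  by (rule modelD[THEN conjunct2, THEN conjunct2, THEN conjunct2, THEN conjunct2, THEN conjunct2, THEN conjunct2, rule_format])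

lemma negligible_null:
  assumes "C \<in> sets M" "measure M C = 0"
  shows "negligible (D C)"
proof -
  have "D C k \<inter> {..<n k} = D C k" for k using D_subset[OF assms(1), of k] by blast
  then show ?thesis unfolding negligible_def using D_density[OF assms(1)] assms(2) by simp
qed

lemma negligible_pre:
  assumes "negligible S"
  shows "negligible (\<lambda>k. {y. p g k y \<in> S k})"
proof -
  have "card ({y. p g k y \<in> S k} \<inter> {..<n k}) = card (S k \<inter> {..<n k})" for k
  proof -
    have "p g k ` ({y. p g k y \<in> S k} \<inter> {..<n k}) = S k \<inter> {..<n k}"
    proof (intro equalityI subsetI)
      fix z assume z: "z \<in> S k \<inter> {..<n k}"
      then have "z \<in> p g k ` {..<n k}" using permutes_image[OF p_permutes[of g k]] by blast
      then show "z \<in> p g k ` ({y. p g k y \<in> S k} \<inter> {..<n k})" using z by blast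
    next
      fix z assume "z \<in> p g k ` ({y. p g k y \<in> S k} \<inter> {..<n k})"
      then show "z \<in> S k \<inter> {..<n k}" using permutes_in_image[OF p_permutes[of g k]] by auto
    qed
    moreover have "inj_on (p g k) ({y. p g k y \<in> S k} \<inter> {..<n k})"
      using permutes_inj[OF p_permutes[of g k]] by (rule inj_on_subset) simp
    ultimately show ?thesis by (metis card_image)
  qed
  then show ?thesis using assms unfolding negligible_def by simp
qed

text \<open>The models of \<open>C\<close> and of its complement are almost disjoint by
  multiplicativity, and their proportions tend to numbers with sum 1; by inclusion-exclusion, almost
  nothing is left uncovered.\<close>

lemma D_compl:
  assumes C: "C \<in> sets M"
  shows "negligible (\<lambda>k. {y. (y \<in> D (space M - C) k) \<noteq> (y \<notin> D C k)})"
proof -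
  let ?C = "space M - C"
  have C': "?C \<in> sets M" using C by blast
  have e: "C \<inter> ?C = {}" by blast
  have "negligible (D {})" by (rule negligible_null) simp_all
  from negligible_Un[OF this D_Int[OF C C', unfolded e]]
  have I: "negligible (\<lambda>k. D C k \<inter> D ?C k)" by (rule negligible_subset) blast
  have cq: "card ({..<n k} - (D C k \<union> D ?C k)) + card (D C k) + card (D ?C k) = n k + card ((D C k \<inter> D ?C k) \<inter> {..<n k})" for k
  proof -
    have s: "D C k \<subseteq> {..<n k}" "D ?C k \<subseteq> {..<n k}" using D_subset C C' by blast+
    then have f: "finite (D C k)" "finite (D ?C k)" using finite_subset by blast+
    have "card ({..<n k} - (D C k \<union> D ?C k)) = n k - card (D C k \<union> D ?C k)"
      using card_Diff_subset[of "D C k \<union> D ?C k" "{..<n k}"] s f by simp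
    moreover have "card (D C k \<union> D ?C k) \<le> n k" using card_mono[of "{..<n k}" "D C k \<union> D ?C k"] s by simp
    moreover have "(D C k \<inter> D ?C k) \<inter> {..<n k} = D C k \<inter> D ?C k" using s by blast
    ultimately show ?thesis using card_Un_Int[OF f] by simp
  qed
  have "real (card ({..<n k} - (D C k \<union> D ?C k))) = real (n k) + real (card ((D C k \<inter> D ?C k) \<inter> {..<n k})) - real (card (D C k)) - real (card (D ?C k))" for k
    using arg_cong[where f = real, OF cq[of k]] by simp
  then have q: "real (card (({..<n k} - (D C k \<union> D ?C k)) \<inter> {..<n k})) / real (n k) =
    1 + real (card ((D C k \<inter> D ?C k) \<inter> {..<n k})) / real (n k) - real (card (D C k)) / real (n k) - real (card (D ?C k)) / real (n k)" for k
    using n_pos[of k] by (simp add: Int_absorb2 Diff_subset add_divide_distrib diff_divide_distrib)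
  have "((\<lambda>k. 1 + real (card ((D C k \<inter> D ?C k) \<inter> {..<n k})) / real (n k) - real (card (D C k)) / real (n k) - real (card (D ?C k)) / real (n k))
     \<longlongrightarrow> 1 + 0 - measure M C - measure M ?C) \<omega>"
    by (intro tendsto_diff tendsto_add tendsto_const I[unfolded negligible_def] D_density C C')
  then have "negligible (\<lambda>k. {..<n k} - (D C k \<union> D ?C k))"
    unfolding negligible_def q using prob_compl[OF C] by simp
  from negligible_Un[OF I this] show ?thesis by (rule negligible_subset) auto
qed

text \<open>A calculus for limit frequencies: such pairs of predicates are closed under finite
  Boolean operations and under substituting words, and the frequency of the second converges to the
  measure of the first (\<open>tracks_density\<close>). Asymptotic statements can then be read off
  from formulas.\<close>

definition tracks :: "('a \<Rightarrow> bool) \<Rightarrow> (nat \<Rightarrow> nat \<Rightarrow> bool) \<Rightarrow> bool" where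
  "tracks Q q \<longleftrightarrow> {x \<in> space M. Q x} \<in> sets M \<and>
     negligible (\<lambda>k. {y. q k y \<noteq> (y \<in> D {x \<in> space M. Q x} k)})"

lemma tracks_sets: "tracks Q q \<Longrightarrow> {x \<in> space M. Q x} \<in> sets M"
  by (simp add: tracks_def)

lemma tracks_negligible: "tracks Q q \<Longrightarrow> negligible (\<lambda>k. {y. q k y \<noteq> (y \<in> D {x \<in> space M. Q x} k)})"
  by (simp add: tracks_def)

lemma negligible_empty: "negligible (\<lambda>k. {})" by (simp add: negligible_def)

lemma tracks_self: "{x \<in> space M. Q x} \<in> sets M \<Longrightarrow> tracks Q (\<lambda>k y. y \<in> D {x \<in> space M. Q x} k)"
  by (simp add: tracks_def negligible_empty)

lemma tracks_mem:
  assumes "C \<in> sets M"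
  shows "tracks (\<lambda>x. x \<in> C) (\<lambda>k y. y \<in> D C k)"
proof -
  have "{x \<in> space M. x \<in> C} = C" using sets.sets_into_space[OF assms] by blast
  then show ?thesis using tracks_self[of "\<lambda>x. x \<in> C"] assms by simp
qed

lemma tracks_change:
  assumes "tracks Q q" "negligible (\<lambda>k. {y. q k y \<noteq> q' k y})"
  shows "tracks Q q'"
  unfolding tracks_def
proof
  show "negligible (\<lambda>k. {y. q' k y \<noteq> (y \<in> D {x \<in> space M. Q x} k)})"
    by (rule negligible_subset[OF negligible_Un[OF tracks_negligible[OF assms(1)] assms(2)]]) auto
qed (rule tracks_sets[OF assms(1)])

lemma tracks_not:
  assumes "tracks Q q"
  shows "tracks (\<lambda>x. \<not> Q x) (\<lambda>k y. \<not> q k y)"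
proof -
  have e: "{x \<in> space M. \<not> Q x} = space M - {x \<in> space M. Q x}" by blast
  show ?thesis unfolding tracks_def e
  proof
    show "negligible (\<lambda>k. {y. (\<not> q k y) \<noteq> (y \<in> D (space M - {x \<in> space M. Q x}) k)})"
      by (rule negligible_subset[OF negligible_Un[OF tracks_negligible[OF assms] D_compl[OF tracks_sets[OF assms]]]]) auto
  qed (use tracks_sets[OF assms] in blast)
qed

lemma tracks_conj:
  assumes "tracks Q q" "tracks Q' q'"
  shows "tracks (\<lambda>x. Q x \<and> Q' x) (\<lambda>k y. q k y \<and> q' k y)"
proof -
  have e: "{x \<in> space M. Q x \<and> Q' x} = {x \<in> space M. Q x} \<inter> {x \<in> space M. Q' x}" by blast
  show ?thesis unfolding tracks_def e
  proof
    show "negligible (\<lambda>k. {y. (q k y \<and> q' k y) \<noteq> (y \<in> D ({x \<in> space M. Q x} \<inter> {x \<in> space M. Q' x}) k)})"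
      by (rule negligible_subset[OF negligible_Un[OF negligible_Un[OF tracks_negligible[OF assms(1)] tracks_negligible[OF assms(2)]]
        D_Int[OF tracks_sets[OF assms(1)] tracks_sets[OF assms(2)]]]]) auto
  qed (use tracks_sets assms in blast)
qed

lemma tracks_disj:
  assumes "tracks Q q" "tracks Q' q'"
  shows "tracks (\<lambda>x. Q x \<or> Q' x) (\<lambda>k y. q k y \<or> q' k y)"
  using tracks_not[OF tracks_conj[OF tracks_not[OF assms(1)] tracks_not[OF assms(2)]]] by simp

lemma iff_conv: "(a \<longleftrightarrow> b) \<longleftrightarrow> a \<and> b \<or> \<not> a \<and> \<not> b" by blast

lemma tracks_iff:
  assumes "tracks Q q" "tracks Q' q'"
  shows "tracks (\<lambda>x. Q x \<longleftrightarrow> Q' x) (\<lambda>k y. q k y \<longleftrightarrow> q' k y)"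
  using tracks_disj[OF tracks_conj[OF assms] tracks_conj[OF tracks_not[OF assms(1)] tracks_not[OF assms(2)]]]
  unfolding iff_conv .

lemma tracks_False: "tracks (\<lambda>x. False) (\<lambda>k y. False)"
proof -
  have "tracks (\<lambda>x. x \<in> {}) (\<lambda>k y. y \<in> D {} k)" by (rule tracks_mem) simp
  then have "tracks (\<lambda>x. x \<in> {}) (\<lambda>k y. False)"
    by (rule tracks_change) (simp add: negligible_null)
  then show ?thesis by simp
qed

lemma tracks_const: "tracks (\<lambda>x. b) (\<lambda>k y. b)"
  using tracks_False tracks_not[OF tracks_False] by (cases b) simp_all

lemma tracks_ball:
  assumes "finite I" "\<And>i. i \<in> I \<Longrightarrow> tracks (Q i) (q i)"
  shows "tracks (\<lambda>x. \<forall>i\<in>I. Q i x) (\<lambda>k y. \<forall>i\<in>I. q i k y)"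
  using assms
proof (induction I rule: finite_induct)
  case (insert i I)
  have "tracks (\<lambda>x. Q i x \<and> (\<forall>i\<in>I. Q i x)) (\<lambda>k y. q i k y \<and> (\<forall>i\<in>I. q i k y))"
    using insert by (intro tracks_conj) auto
  then show ?case by simp
qed (simp add: tracks_const)

lemma tracks_bex:
  assumes "finite I" "\<And>i. i \<in> I \<Longrightarrow> tracks (Q i) (q i)"
  shows "tracks (\<lambda>x. \<exists>i\<in>I. Q i x) (\<lambda>k y. \<exists>i\<in>I. q i k y)"
  using tracks_not[OF tracks_ball[OF assms(1) tracks_not[OF assms(2)]]] by simp

lemma tracks_density:
  assumes "tracks Q q"
  shows "((\<lambda>k. real (card {y \<in> {..<n k}. q k y}) / real (n k)) \<longlongrightarrow> measure M {x \<in> space M. Q x}) \<omega>"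
proof -
  let ?C = "{x \<in> space M. Q x}"
  let ?N = "\<lambda>k. {y. q k y \<noteq> (y \<in> D ?C k)} \<inter> {..<n k}"
  have le: "norm (real (card {y \<in> {..<n k}. q k y}) / real (n k) - real (card (D ?C k)) / real (n k)) \<le> real (card (?N k)) / real (n k)" for k
  proof -
    have s: "D ?C k \<subseteq> {..<n k}" using D_subset[OF tracks_sets[OF assms]] .
    then have f: "finite (D ?C k)" using finite_subset by blast
    have "card {y \<in> {..<n k}. q k y} \<le> card (D ?C k \<union> ?N k)" using f by (intro card_mono) auto
    then have 1: "card {y \<in> {..<n k}. q k y} \<le> card (D ?C k) + card (?N k)"
      using card_Un_le order_trans by blast
    have "card (D ?C k) \<le> card ({y \<in> {..<n k}. q k y} \<union> ?N k)" using s by (intro card_mono) auto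
    then have 2: "card (D ?C k) \<le> card {y \<in> {..<n k}. q k y} + card (?N k)"
      using card_Un_le order_trans by blast
    have "\<bar>real (card {y \<in> {..<n k}. q k y}) - real (card (D ?C k))\<bar> \<le> real (card (?N k))" using 1 2 by linarith
    then show ?thesis using n_pos[of k] by (simp flip: diff_divide_distrib add: abs_divide divide_right_mono)
  qed
  have "((\<lambda>k. real (card {y \<in> {..<n k}. q k y}) / real (n k) - real (card (D ?C k)) / real (n k)) \<longlongrightarrow> 0) \<omega>"
    by (rule Lim_null_comparison[OF always_eventually[OF allI[OF le]]]) (rule tracks_negligible[OF assms, unfolded negligible_def])
  from tendsto_add[OF this D_density[OF tracks_sets[OF assms]]] show ?thesis by simp
qed

lemma tracks_null:
  assumes "tracks Q q" "AE x in M. \<not> Q x"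
  shows "negligible (\<lambda>k. {y. q k y})"
proof -
  have "measure M {x \<in> space M. Q x} = 0"
    using assms(2) AE_iff_measurable[OF tracks_sets[OF assms(1)], of "\<lambda>x. \<not> Q x"] by (simp add: measure_def)
  then have "((\<lambda>k. real (card {y \<in> {..<n k}. q k y}) / real (n k)) \<longlongrightarrow> 0) \<omega>" using tracks_density[OF assms(1)] by simp
  moreover have "{y \<in> {..<n k}. q k y} = {y. q k y} \<inter> {..<n k}" for k by blast
  ultimately show ?thesis unfolding negligible_def by simp
qed

text \<open>The equivalence of the two properties fails on a null set, whose model is negligible by
  \<open>tracks_null\<close>. This handles the summation relations, which hold only almost
  everywhere.\<close>

lemma tracks_AE:
  assumes "tracks Q q" "{x \<in> space M. Q' x} \<in> sets M" "AE x in M. Q x \<longleftrightarrow> Q' x"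
  shows "tracks Q' q"
proof -
  let ?q = "\<lambda>k y. y \<in> D {x \<in> space M. Q' x} k"
  have t: "tracks Q' ?q" using tracks_self[OF assms(2)] .
  have "negligible (\<lambda>k. {y. \<not> (?q k y \<longleftrightarrow> q k y)})"
    using assms(3) by (intro tracks_null[OF tracks_not[OF tracks_iff[OF t assms(1)]]]) auto
  then show ?thesis by (intro tracks_change[OF t]) simp
qed

lemma tracks_t:
  assumes "tracks Q q"
  shows "tracks (\<lambda>x. Q (t (fst g) x)) (\<lambda>k y. q k (p g k y))"
proof -
  let ?C = "{x \<in> space M. Q x}" and ?C1 = "{x \<in> space M. Q (t (fst g) x)}"
  have e: "?C1 = {x \<in> space M. t (fst g) x \<in> ?C}" using t_space by auto
  have s: "?C1 \<in> sets M" unfolding e using W_mult(2)[OF aut_t sets.top aut_id tracks_sets[OF assms]] .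
  \<comment> \<open>\<open>D_pre\<close> passes from a set at \<open>y\<close> to its preimage at
    \<open>p g k y\<close>. It is applied to the preimage, whose own preimage is the original set
    because the letter is an involution.\<close>
  have e2: "{x \<in> space M. t (fst g) x \<in> ?C1} = ?C" using t_space t_inv by auto
  have "negligible (\<lambda>k. {y. p g k y \<in> {y. q k y \<noteq> (y \<in> D ?C k)}})" by (rule negligible_pre[OF tracks_negligible[OF assms]])
  from negligible_Un[OF this D_pre[OF s, of g, unfolded e2]]
  have "negligible (\<lambda>k. {y. q k (p g k y) \<noteq> (y \<in> D ?C1 k)})" by (rule negligible_subset) auto
  then show ?thesis using s unfolding tracks_def by simp
qed

lemma tracks_act: "tracks Q q \<Longrightarrow> tracks (\<lambda>x. Q (act v x)) (\<lambda>k y. q k (pact p v k y))"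
proof (induction v arbitrary: Q q)
  case (Cons g v)
  from Cons.IH[OF tracks_t[OF Cons.prems, of g]] show ?case by simp
qed simp

text \<open>The complement of the fixed-point set is a countable union of sets that a separating family
  moves off themselves; their models contain almost no fixed points.\<close>

lemma tracks_fix:
  fixes B :: "nat \<Rightarrow> 'a set"
  assumes B: "\<And>l. B l \<in> sets M" and sep: "\<And>x y. x \<in> space M \<Longrightarrow> y \<in> space M \<Longrightarrow> x \<noteq> y \<Longrightarrow> \<exists>l. x \<in> B l \<and> y \<notin> B l"
  shows "tracks (\<lambda>x. act v x = x) (\<lambda>k y. pact p v k y = y)"
proof -
  let ?F = "{x \<in> space M. act v x = x}"
  define Q where "Q l x \<longleftrightarrow> x \<in> B l \<and> \<not> act v x \<in> B l" for l x
  define q where "q l k y \<longleftrightarrow> y \<in> D (B l) k \<and> \<not> pact p v k y \<in> D (B l) k" for l k y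
  have Qq: "tracks (Q l) (q l)" for l
    unfolding Q_def q_def by (intro tracks_conj tracks_not tracks_act[OF tracks_mem] tracks_mem B)
  have Fe: "?F = space M - (\<Union>l. {x \<in> space M. Q l x})"
    using sep act_space unfolding Q_def by (auto) metis
  have F: "?F \<in> sets M" unfolding Fe using tracks_sets[OF Qq] by blast
  \<comment> \<open>The moved points not yet detected by the first \<open>N\<close> separating sets.
    On the finite sets a fixed point satisfies no \<open>q l\<close>, so one outside the model of
    \<open>?F\<close> satisfies the counterpart of \<open>?R N\<close>, whose limit frequency is
    small for large \<open>N\<close>.\<close>
  let ?R = "\<lambda>N x. \<not> act v x = x \<and> (\<forall>l\<in>{..<N}. \<not> Q l x)"
  have R: "tracks (?R N) (\<lambda>k y. \<not> y \<in> D ?F k \<and> (\<forall>l\<in>{..<N}. \<not> q l k y))" for N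
    by (intro tracks_conj tracks_not tracks_ball tracks_self F Qq) simp
  have "(\<lambda>N. measure M {x \<in> space M. ?R N x}) \<longlonglongrightarrow> measure M (\<Inter>N. {x \<in> space M. ?R N x})"
    using tracks_sets[OF R] by (intro finite_Lim_measure_decseq) (auto simp: decseq_def)
  moreover have "(\<Inter>N. {x \<in> space M. ?R N x}) = {}" using Fe by auto
  ultimately have lim: "(\<lambda>N. measure M {x \<in> space M. ?R N x}) \<longlonglongrightarrow> 0" by simp
  have "negligible (\<lambda>k. {y. pact p v k y = y \<and> y \<notin> D ?F k})"
    unfolding negligible_def
  proof (rule tendstoI)
    fix \<epsilon> :: real assume "\<epsilon> > 0"
    then obtain N where "measure M {x \<in> space M. ?R N x} < \<epsilon>"
      using order_tendstoD(2)[OF lim] eventually_happens'[OF sequentially_bot] by blast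
    then have "eventually (\<lambda>k. real (card {y \<in> {..<n k}. \<not> y \<in> D ?F k \<and> (\<forall>l\<in>{..<N}. \<not> q l k y)}) / real (n k) < \<epsilon>) \<omega>"
      using order_tendstoD(2)[OF tracks_density[OF R]] by blast
    then show "eventually (\<lambda>k. dist (real (card ({y. pact p v k y = y \<and> y \<notin> D ?F k} \<inter> {..<n k})) / real (n k)) 0 < \<epsilon>) \<omega>"
    proof (rule eventually_mono)
      fix k assume a: "real (card {y \<in> {..<n k}. \<not> y \<in> D ?F k \<and> (\<forall>l\<in>{..<N}. \<not> q l k y)}) / real (n k) < \<epsilon>"
      have "card ({y. pact p v k y = y \<and> y \<notin> D ?F k} \<inter> {..<n k}) \<le> card {y \<in> {..<n k}. \<not> y \<in> D ?F k \<and> (\<forall>l\<in>{..<N}. \<not> q l k y)}"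
        by (intro card_mono) (auto simp: q_def)
      then have "real (card ({y. pact p v k y = y \<and> y \<notin> D ?F k} \<inter> {..<n k})) / real (n k) \<le> real (card {y \<in> {..<n k}. \<not> y \<in> D ?F k \<and> (\<forall>l\<in>{..<N}. \<not> q l k y)}) / real (n k)"
        by (simp add: divide_right_mono)
      then show "dist (real (card ({y. pact p v k y = y \<and> y \<notin> D ?F k} \<inter> {..<n k})) / real (n k)) 0 < \<epsilon>"
        using a by simp
    qed
  qed
  from negligible_Un[OF this D_fixed[OF F, of v]]
  have "negligible (\<lambda>k. {y. (pact p v k y = y) \<noteq> (y \<in> D ?F k)})" by (rule negligible_subset) auto
  then show ?thesis using F unfolding tracks_def by simp
qed

text \<open>The projections of the basic sequence are corrected level by level, so that the
  summation relations hold exactly on the finite sets.\<close>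

fun level :: "(nat \<Rightarrow> nat \<Rightarrow> 'a set) \<Rightarrow> nat \<Rightarrow> nat \<Rightarrow> nat \<Rightarrow> nat set" where
  "level e k 0 i = {..<n k}"
| "level e k (Suc m) i = (if odd i then level e k m (Suc i div 2) \<inter> D (e i (Suc m)) k
     else level e k m (i div 2) - D (e (i - 1) (Suc m)) k)"

lemma level_subset: "level e k m i \<subseteq> {..<n k}"
  by (induction m arbitrary: i) auto

lemma level_X_set: "X_set {..<n k} (\<lambda>i m. level e k m i)"
  unfolding X_set_def summation_relations_def
proof (intro conjI allI impI ballI)
  show "{..<n k} \<noteq> {}" using n_pos[of k] by auto
  fix m i :: nat assume m: "m \<ge> 1" and i: "i \<in> {1..2 ^ (m - 1)}"
  obtain m' where m': "m = Suc m'" using m by (cases m) auto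
  obtain j where j: "i = Suc j" using i by (cases i) auto
  show "AE y in uniform_count_measure {..<n k}. indicat_real (level e k m (2 * i - 1)) y + indicat_real (level e k m (2 * i)) y = indicat_real (level e k (m - 1) i) y"
    by (rule AE_I2) (auto simp: m' j indicator_def)
qed (use level_subset in auto)

lemma tracks_level:
  assumes e: "basic_sequence M e" and i: "i \<in> {1..2 ^ m}"
  shows "tracks (\<lambda>x. x \<in> e i m) (\<lambda>k y. y \<in> level e k m i)"
  using i
proof (induction m arbitrary: i)
  case 0
  then have i: "i = 1" by simp
  have s: "e 1 0 \<in> sets M" "measure M (e 1 0) = 1" using e unfolding basic_sequence_def by auto
  \<comment> \<open>\<open>e 1 0\<close> has full measure but may differ from the whole space,
    whereas level 0 is the whole finite set.\<close>
  have "tracks (\<lambda>x. x \<in> e 1 0) (\<lambda>k y. True)"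
  proof (rule tracks_AE[OF tracks_const])
    show "{x \<in> space M. x \<in> e 1 0} \<in> sets M" using tracks_sets[OF tracks_mem[OF s(1)]] .
    show "AE x in M. True \<longleftrightarrow> x \<in> e 1 0" using prob_eq_1[OF s(1)] s(2) by simp
  qed
  then show ?case unfolding i
  proof (rule tracks_change)
    show "negligible (\<lambda>k. {y. True \<noteq> (y \<in> level e k 0 1)})" by (rule negligible_subset[OF negligible_empty]) auto
  qed
next
  case (Suc m)
  \<comment> \<open>The parent of index \<open>i\<close>; its children are \<open>2 * j - 1\<close>
    and \<open>2 * j\<close>.\<close>
  define j where "j = Suc i div 2"
  have j: "j \<in> {1..2 ^ m}" using Suc.prems unfolding j_def by auto
  have s: "e i' m' \<in> sets M" if "i' \<in> {1..2 ^ m'}" for i' m' using e that unfolding basic_sequence_def by blast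
  have "AE x in M. indicat_real (e (2 * j - 1) (Suc m)) x + indicat_real (e (2 * j) (Suc m)) x = indicat_real (e j m) x"
    using e j unfolding basic_sequence_def summation_relations_def by (elim conjE allE[of _ "Suc m"]) simp
  \<comment> \<open>Indicators take only the values 0 and 1, so the sum relation makes the two
    children disjoint parts that exhaust their parent.\<close>
  then have AE: "AE x in M. (x \<in> e (2 * j - 1) (Suc m) \<longleftrightarrow> x \<in> e j m \<and> x \<in> e (2 * j - 1) (Suc m)) \<and>
      (x \<in> e (2 * j) (Suc m) \<longleftrightarrow> x \<in> e j m \<and> \<not> x \<in> e (2 * j - 1) (Suc m))"
    by eventually_elim (auto simp: indicator_def of_bool_def split: if_splits)
  have o: "2 * j - 1 \<in> {1..2 ^ Suc m}" "2 * j \<in> {1..2 ^ Suc m}" using j by auto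
  show ?case
  proof (cases "odd i")
    case True
    then have i: "i = 2 * j - 1" unfolding j_def by presburger
    have "tracks (\<lambda>x. x \<in> e j m \<and> x \<in> e (2 * j - 1) (Suc m)) (\<lambda>k y. y \<in> level e k m j \<and> y \<in> D (e (2 * j - 1) (Suc m)) k)"
      by (rule tracks_conj[OF Suc.IH[OF j] tracks_mem[OF s[OF o(1)]]])
    then have "tracks (\<lambda>x. x \<in> e (2 * j - 1) (Suc m)) (\<lambda>k y. y \<in> level e k m j \<and> y \<in> D (e (2 * j - 1) (Suc m)) k)"
      by (rule tracks_AE) (use tracks_sets[OF tracks_mem[OF s[OF o(1)]]] AE in auto)
    then show ?thesis using True i by (simp add: j_def[symmetric])
  next
    case False
    then have i: "i = 2 * j" unfolding j_def by presburger
    have "tracks (\<lambda>x. x \<in> e j m \<and> \<not> x \<in> e (2 * j - 1) (Suc m)) (\<lambda>k y. y \<in> level e k m j \<and> \<not> y \<in> D (e (2 * j - 1) (Suc m)) k)"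
      by (rule tracks_conj[OF Suc.IH[OF j] tracks_not[OF tracks_mem[OF s[OF o(1)]]]])
    then have "tracks (\<lambda>x. x \<in> e (2 * j) (Suc m)) (\<lambda>k y. y \<in> level e k m j \<and> \<not> y \<in> D (e (2 * j - 1) (Suc m)) k)"
      by (rule tracks_AE) (use tracks_sets[OF tracks_mem[OF s[OF o(2)]]] AE in auto)
    then show ?thesis using False i by simp
  qed
qed

end

section \<open>Balls of actions of the free group\<close>

lemma free_group_simps:
  "carrier free_group = {w. reduced_word w \<and> (\<forall>g\<in>set w. fst g \<ge> 1)}"
  "v \<otimes>\<^bsub>free_group\<^esub> w = foldr push v w" "\<one>\<^bsub>free_group\<^esub> = []"
  by (simp_all add: free_group_def)

lemma finite_words: "finite (words r)"
proof (rule finite_subset)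
  show "words r \<subseteq> {w. set w \<subseteq> letters r \<and> length w \<le> r}" by (auto simp: words_def)
  show "finite {w. set w \<subseteq> letters r \<and> length w \<le> r}"
    by (rule finite_lists_length_le) (simp add: letters_def)
qed

lemma Nil_words: "[] \<in> words r" by (simp add: words_def free_group_simps)

text \<open>Serves both the action on the measure space and the permutations of the finite sets:
  maps that are inverse in pairs extend to an action of the free group.\<close>

locale letter_maps =
  fixes X :: "'x set" and \<pi> :: "letter \<Rightarrow> 'x \<Rightarrow> 'x"
  assumes maps: "x \<in> X \<Longrightarrow> \<pi> g x \<in> X" and linv_left: "x \<in> X \<Longrightarrow> \<pi> (linv g) (\<pi> g x) = x"
begin

text \<open>Restricted to \<open>X\<close> because the elements of \<open>BijGroup X\<close> are
  extensional.\<close>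

definition word_action :: "letter list \<Rightarrow> 'x \<Rightarrow> 'x" where
  "word_action w = (\<lambda>x\<in>X. foldr \<pi> w x)"

lemma foldr_maps: "x \<in> X \<Longrightarrow> foldr \<pi> w x \<in> X"
  by (induction w) (simp_all add: maps)

lemma foldr_push_maps: "x \<in> X \<Longrightarrow> foldr \<pi> (push g w) x = \<pi> g (foldr \<pi> w x)"
proof (cases w)
  case (Cons h v)
  assume x: "x \<in> X"
  have "\<pi> g (\<pi> (linv g) (foldr \<pi> v x)) = foldr \<pi> v x"
    using linv_left[of "foldr \<pi> v x" "linv g"] foldr_maps[OF x] by simp
  then show ?thesis using Cons by auto
qed simp

lemma foldr_mult: "x \<in> X \<Longrightarrow> foldr \<pi> (foldr push v w) x = foldr \<pi> v (foldr \<pi> w x)"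
  by (induction v) (simp_all add: foldr_push_maps)

lemma foldr_inverse: "x \<in> X \<Longrightarrow> foldr \<pi> (rev (map linv w)) (foldr \<pi> w x) = x"
  by (induction w) (simp_all add: linv_left foldr_maps)

lemma rev_linv_linv: "rev (map linv (rev (map linv w))) = w"
  by (simp add: rev_map comp_def)

text \<open>Coincidence of two words becomes a fixed-point equation for one possibly unreduced word,
  the kind of equation that \<open>tracks_fix\<close> handles.\<close>

lemma foldr_eq_iff:
  assumes "x \<in> X"
  shows "foldr \<pi> w x = foldr \<pi> w' x \<longleftrightarrow> foldr \<pi> (rev (map linv w) @ w') x = x"
proof
  assume "foldr \<pi> w x = foldr \<pi> w' x"
  then show "foldr \<pi> (rev (map linv w) @ w') x = x" using foldr_inverse[OF assms, of w] by simp
next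
  assume a: "foldr \<pi> (rev (map linv w) @ w') x = x"
  have "foldr \<pi> w (foldr \<pi> (rev (map linv w)) (foldr \<pi> w' x)) = foldr \<pi> w' x"
    using foldr_inverse[OF foldr_maps[OF assms, of w'], of "rev (map linv w)"] by (simp only: rev_linv_linv)
  then show "foldr \<pi> w x = foldr \<pi> w' x" using a by simp
qed

lemma word_action_bij: "bij_betw (word_action w) X X"
proof (rule bij_betw_byWitness[where f' = "foldr \<pi> (rev (map linv w))"])
  show "\<forall>x\<in>X. foldr \<pi> (rev (map linv w)) (word_action w x) = x"
    by (simp add: word_action_def foldr_inverse)
  show "\<forall>x\<in>X. word_action w (foldr \<pi> (rev (map linv w)) x) = x"
  proof
    fix x assume x: "x \<in> X"
    then show "word_action w (foldr \<pi> (rev (map linv w)) x) = x"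
      using foldr_inverse[OF x, of "rev (map linv w)"] foldr_maps[OF x] unfolding rev_linv_linv by (simp add: word_action_def)
  qed
qed (auto simp: word_action_def foldr_maps)

lemma word_action: "group_action free_group X word_action"
proof -
  have h: "word_action \<in> hom free_group (BijGroup X)"
  proof (rule homI)
    fix w show "word_action w \<in> carrier (BijGroup X)"
      using word_action_bij[of w] by (simp add: BijGroup_def Bij_def word_action_def)
    fix v
    show "word_action (v \<otimes>\<^bsub>free_group\<^esub> w) = word_action v \<otimes>\<^bsub>BijGroup X\<^esub> word_action w"
      using word_action_bij[of w] word_action_bij[of v]
      by (auto simp: BijGroup_def Bij_def word_action_def free_group_simps foldr_mult foldr_maps compose_def fun_eq_iff)
  qed
  show ?thesis unfolding group_action_def group_hom_def group_hom_axioms_def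
    using h group_free_group group_BijGroup by blast
qed

end

text \<open>The pattern determines the ball up to isomorphism, uniformly over all actions.\<close>

definition pattern :: "(nat \<Rightarrow> nat \<Rightarrow> 'x set) \<Rightarrow> (letter list \<Rightarrow> 'x \<Rightarrow> 'x) \<Rightarrow> nat \<Rightarrow> 'x \<Rightarrow>
    (letter list \<times> letter list) set \<times> (letter list \<times> nat) set" where
  "pattern e \<alpha> r x = ({(w, w'). w \<in> words r \<and> w' \<in> words r \<and> \<alpha> w x = \<alpha> w' x},
     {(w, i). w \<in> words r \<and> i \<in> {1..2 ^ r} \<and> \<alpha> w x \<in> e i r})"

text \<open>A canonical copy of the ball: a vertex is the class of all words with the same endpoint,
  so that the point and the action enter through the pattern alone.\<close>

definition pattern_graph :: "nat \<Rightarrow> (letter list \<times> letter list) set \<times> (letter list \<times> nat) set \<Rightarrow>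
    letter list set rooted_graph" where
  "pattern_graph r P = \<lparr>
     verts = {fst P `` {w} | w. w \<in> words r},
     root_vertex = fst P `` {[]},
     label = (\<lambda>c. THE i. i \<in> {1..2 ^ r} \<and> (\<exists>w\<in>c. (w, i) \<in> snd P)),
     edges = {(fst P `` {w}, g, fst P `` {[g] \<otimes>\<^bsub>free_group\<^esub> w}) | w g.
       g \<in> letters r \<and> w \<in> words r \<and> [g] \<otimes>\<^bsub>free_group\<^esub> w \<in> words r}\<rparr>"

text \<open>An isomorphism is controlled on vertices only, hence the assumption that edges join
  vertices.\<close>

lemma graph_iso_sym:
  assumes "graph_iso G H" "edges G \<subseteq> verts G \<times> UNIV \<times> verts G" "root_vertex G \<in> verts G"
  shows "graph_iso H G"
proof -
  obtain f where f: "bij_betw f (verts G) (verts H)" "f (root_vertex G) = root_vertex H"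
    "\<forall>v\<in>verts G. label H (f v) = label G v" "edges H = (\<lambda>(x, g, y). (f x, g, f y)) ` edges G"
    using assms(1) unfolding graph_iso_def by (elim exE conjE) (rule that, assumption+)
  let ?h = "inv_into (verts G) f"
  have h: "?h (f v) = v" if "v \<in> verts G" for v using f(1) that by (auto simp: bij_betw_def)
  have "edges G = (\<lambda>(x, g, y). (?h x, g, ?h y)) ` edges H"
  proof -
    have "(\<lambda>(x, g, y). (?h x, g, ?h y)) ` edges H = (\<lambda>q. q) ` edges G"
      unfolding f(4) image_image by (rule image_cong) (use assms(2) h in auto)
    then show ?thesis by simp
  qed
  moreover have "\<forall>v\<in>verts H. label G (?h v) = label H v"
  proof
    fix v assume v: "v \<in> verts H"
    have "?h v \<in> verts G" "f (?h v) = v" using v f(1) by (auto simp: bij_betw_def inv_into_into f_inv_into_f)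
    then show "label G (?h v) = label H v" using f(3) by metis
  qed
  moreover have "?h (root_vertex H) = root_vertex G" using f(2) h[OF assms(3)] by simp
  ultimately show ?thesis unfolding graph_iso_def using bij_betw_inv_into[OF f(1)] by blast
qed

lemma graph_iso_trans:
  assumes "graph_iso G H" "graph_iso H K"
  shows "graph_iso G K"
proof -
  obtain f where f: "bij_betw f (verts G) (verts H)" "f (root_vertex G) = root_vertex H"
    "\<forall>v\<in>verts G. label H (f v) = label G v" "edges H = (\<lambda>(x, g, y). (f x, g, f y)) ` edges G"
    using assms(1) unfolding graph_iso_def by (elim exE conjE) (rule that, assumption+)
  obtain h where h: "bij_betw h (verts H) (verts K)" "h (root_vertex H) = root_vertex K"
    "\<forall>v\<in>verts H. label K (h v) = label H v" "edges K = (\<lambda>(x, g, y). (h x, g, h y)) ` edges H"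
    using assms(2) unfolding graph_iso_def by (elim exE conjE) (rule that, assumption+)
  have "edges K = (\<lambda>(x, g, y). ((h \<circ> f) x, g, (h \<circ> f) y)) ` edges G"
    unfolding h(4) f(4) image_image by (simp add: case_prod_beta)
  moreover have "\<forall>v\<in>verts G. label K ((h \<circ> f) v) = label G v"
    using f(1,3) h(3) bij_betwE[OF f(1)] by simp
  ultimately show ?thesis unfolding graph_iso_def using bij_betw_trans[OF f(1) h(1)] f(2) h(2)
    by (intro exI[of _ "h \<circ> f"]) simp
qed

text \<open>Each vertex corresponds to the set of words that reach it. The assumption places the
  root in the class of the empty word.\<close>

lemma ball_graph_pattern:
  assumes "\<alpha> [] x = x"
  shows "graph_iso (ball_graph e \<alpha> r x) (pattern_graph r (pattern e \<alpha> r x))"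
proof -
  let ?P = "pattern e \<alpha> r x"
  define f where "f v = {w \<in> words r. \<alpha> w x = v}" for v
  have c: "f (\<alpha> w x) = fst ?P `` {w}" if "w \<in> words r" for w
    using that by (auto simp: f_def pattern_def)
  have "bij_betw f (verts (ball_graph e \<alpha> r x)) (verts (pattern_graph r ?P))"
    unfolding bij_betw_def
  proof
    show "inj_on f (verts (ball_graph e \<alpha> r x))"
      by (rule inj_onI) (auto simp: ball_graph_def f_def)
    have "f ` {\<alpha> w x | w. w \<in> words r} = {fst ?P `` {w} | w. w \<in> words r}"
      using c by (force simp: image_iff)
    then show "f ` verts (ball_graph e \<alpha> r x) = verts (pattern_graph r ?P)"
      by (simp add: ball_graph_def pattern_graph_def)
  qed
  moreover have "f (root_vertex (ball_graph e \<alpha> r x)) = root_vertex (pattern_graph r ?P)"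
    using c[OF Nil_words] assms by (simp add: ball_graph_def pattern_graph_def)
  moreover have "label (pattern_graph r ?P) (f v) = label (ball_graph e \<alpha> r x) v"
    if "v \<in> verts (ball_graph e \<alpha> r x)" for v
  proof -
    \<comment> \<open>The predicates under the two \<open>THE\<close> coincide, so labels agree even
      at vertices with no index or with several indices, as may occur on a null set.\<close>
    have "(i \<in> {1..2 ^ r} \<and> (\<exists>w\<in>f v. (w, i) \<in> snd ?P)) \<longleftrightarrow> (i \<in> {1..2 ^ r} \<and> v \<in> e i r)" for i
      using that by (auto simp: ball_graph_def f_def pattern_def)
    then show ?thesis by (simp add: ball_graph_def pattern_graph_def)
  qed
  moreover have "edges (pattern_graph r ?P) = (\<lambda>(x, g, y). (f x, g, f y)) ` edges (ball_graph e \<alpha> r x)"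
  proof -
    let ?S = "{(w, g). g \<in> letters r \<and> w \<in> words r \<and> [g] \<otimes>\<^bsub>free_group\<^esub> w \<in> words r}"
    have "edges (pattern_graph r ?P) = (\<lambda>(w, g). (fst ?P `` {w}, g, fst ?P `` {[g] \<otimes>\<^bsub>free_group\<^esub> w})) ` ?S"
      by (auto simp: pattern_graph_def image_iff)
    also have "\<dots> = (\<lambda>(w, g). (f (\<alpha> w x), g, f (\<alpha> ([g] \<otimes>\<^bsub>free_group\<^esub> w) x))) ` ?S"
      by (rule image_cong) (auto simp: c)
    also have "\<dots> = (\<lambda>(x, g, y). (f x, g, f y)) ` (\<lambda>(w, g). (\<alpha> w x, g, \<alpha> ([g] \<otimes>\<^bsub>free_group\<^esub> w) x)) ` ?S"
      by (simp add: image_image case_prod_beta)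
    also have "(\<lambda>(w, g). (\<alpha> w x, g, \<alpha> ([g] \<otimes>\<^bsub>free_group\<^esub> w) x)) ` ?S = edges (ball_graph e \<alpha> r x)"
      by (auto simp: ball_graph_def image_iff)
    finally show ?thesis .
  qed
  ultimately show ?thesis unfolding graph_iso_def by blast
qed

lemma graph_iso_ball_iff:
  assumes "\<alpha> [] x = x"
  shows "graph_iso (ball_graph e \<alpha> r x) G \<longleftrightarrow> graph_iso (pattern_graph r (pattern e \<alpha> r x)) G"
proof -
  have "edges (ball_graph e \<alpha> r x) \<subseteq> verts (ball_graph e \<alpha> r x) \<times> UNIV \<times> verts (ball_graph e \<alpha> r x)"
    by (auto simp: ball_graph_def)
  moreover have "root_vertex (ball_graph e \<alpha> r x) \<in> verts (ball_graph e \<alpha> r x)"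
    using assms Nil_words[of r] by (force simp: ball_graph_def)
  ultimately show ?thesis
    using ball_graph_pattern[of \<alpha> x e r, OF assms] graph_iso_sym graph_iso_trans by metis
qed

lemma Collect_conj_eq_iff: "{q. q \<in> S \<and> R q} = T \<longleftrightarrow> T \<subseteq> S \<and> (\<forall>q\<in>S. R q \<longleftrightarrow> q \<in> T)"
  by blast

section \<open>Convergence of the pattern frequencies\<close>

context sofic_modelled
begin

definition alpha :: "letter list \<Rightarrow> 'a \<Rightarrow> 'a" where
  "alpha w = (\<lambda>x\<in>space M. act w x)"

definition beta :: "nat \<Rightarrow> letter list \<Rightarrow> nat \<Rightarrow> nat" where
  "beta k w = (\<lambda>y\<in>{..<n k}. pact p w k y)"

sublocale letter_t: letter_maps "space M" "\<lambda>g. t (fst g)"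
  by unfold_locales (simp_all add: t_space t_inv)

lemma letter_p: "letter_maps {..<n k} (\<lambda>g. p g k)"
proof
  fix y g assume y: "y \<in> {..<n k}"
  show "p g k y \<in> {..<n k}" using permutes_in_image[OF p_permutes[of g k], of y] y by blast
  show "p (linv g) k (p g k y) = y" unfolding p_linv by (rule permutes_inverses(2)[OF p_permutes])
qed

lemma alpha_word_action: "alpha = letter_t.word_action"
  by (simp add: fun_eq_iff alpha_def letter_t.word_action_def act_def)

lemma beta_word_action: "beta k = letter_maps.word_action {..<n k} (\<lambda>g. p g k)"
  by (simp add: fun_eq_iff beta_def letter_maps.word_action_def[OF letter_p] pact_def)

lemma tracks_space_cong:
  assumes "tracks Q q" "\<And>x. x \<in> space M \<Longrightarrow> Q x \<longleftrightarrow> Q' x" "\<And>k y. y < n k \<Longrightarrow> q k y \<longleftrightarrow> q' k y"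
  shows "tracks Q' q'"
proof -
  have e: "{x \<in> space M. Q' x} = {x \<in> space M. Q x}" using assms(2) by blast
  show ?thesis unfolding tracks_def e
  proof
    show "negligible (\<lambda>k. {y. q' k y \<noteq> (y \<in> D {x \<in> space M. Q x} k)})"
      by (rule negligible_subset[OF tracks_negligible[OF assms(1)]]) (use assms(3) in auto)
  qed (rule tracks_sets[OF assms(1)])
qed

lemma tracks_eq:
  fixes B :: "nat \<Rightarrow> 'a set"
  assumes B: "\<And>l. B l \<in> sets M" and sep: "\<And>x y. x \<in> space M \<Longrightarrow> y \<in> space M \<Longrightarrow> x \<noteq> y \<Longrightarrow> \<exists>l. x \<in> B l \<and> y \<notin> B l"
  shows "tracks (\<lambda>x. alpha w x = alpha w' x) (\<lambda>k y. beta k w y = beta k w' y)"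
proof (rule tracks_space_cong[OF tracks_fix[OF B sep, of "rev (map linv w) @ w'"]])
  fix x assume "x \<in> space M"
  then show "act (rev (map linv w) @ w') x = x \<longleftrightarrow> alpha w x = alpha w' x"
    using letter_t.foldr_eq_iff[of x w w'] by (simp add: act_def alpha_def)
next
  fix k y assume "y < n k"
  then show "pact p (rev (map linv w) @ w') k y = y \<longleftrightarrow> beta k w y = beta k w' y"
    using letter_maps.foldr_eq_iff[OF letter_p, of y k w w'] by (simp add: pact_def beta_def)
qed

lemma tracks_label:
  assumes e: "basic_sequence M e" and i: "i \<in> {1..2 ^ r}"
  shows "tracks (\<lambda>x. alpha w x \<in> e i r) (\<lambda>k y. beta k w y \<in> level e k r i)"
  by (rule tracks_space_cong[OF tracks_act[OF tracks_level[OF e i], of w]]) (simp_all add: alpha_def beta_def)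

lemma tracks_pattern:
  fixes B :: "nat \<Rightarrow> 'a set"
  assumes B: "\<And>l. B l \<in> sets M" and sep: "\<And>x y. x \<in> space M \<Longrightarrow> y \<in> space M \<Longrightarrow> x \<noteq> y \<Longrightarrow> \<exists>l. x \<in> B l \<and> y \<notin> B l"
    and e: "basic_sequence M e"
  shows "tracks (\<lambda>x. pattern e alpha r x = pt) (\<lambda>k y. pattern (\<lambda>i m. level e k m i) (beta k) r y = pt)"
proof -
  let ?W = "words r \<times> words r" and ?I = "words r \<times> {1..2 ^ r}"
  \<comment> \<open>A \<open>pt\<close> with entries outside the index sets is never attained; this
    constant condition covers that case and leaves finitely many tracked conditions.\<close>
  define ok where "ok \<longleftrightarrow> fst pt \<subseteq> ?W \<and> snd pt \<subseteq> ?I"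
  have eq: "pattern d \<gamma> r y = pt \<longleftrightarrow> ok \<and> (\<forall>q\<in>?W. (\<gamma> (fst q) y = \<gamma> (snd q) y) \<longleftrightarrow> q \<in> fst pt) \<and>
      (\<forall>q\<in>?I. \<gamma> (fst q) y \<in> d (snd q) r \<longleftrightarrow> q \<in> snd pt)" for d and \<gamma> :: "letter list \<Rightarrow> 'c \<Rightarrow> 'c" and y
  proof -
    have "fst (pattern d \<gamma> r y) = {q. q \<in> ?W \<and> \<gamma> (fst q) y = \<gamma> (snd q) y}"
      "snd (pattern d \<gamma> r y) = {q. q \<in> ?I \<and> \<gamma> (fst q) y \<in> d (snd q) r}" by (auto simp: pattern_def)
    then show ?thesis unfolding prod_eq_iff ok_def by (simp only: Collect_conj_eq_iff) blast
  qed
  show ?thesis unfolding eq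
    by (intro tracks_conj tracks_const tracks_ball tracks_iff tracks_eq[OF B sep] tracks_label[OF e] finite_SigmaI finite_words) auto
qed

definition patterns :: "nat \<Rightarrow> ((letter list \<times> letter list) set \<times> (letter list \<times> nat) set) set" where
  "patterns r = Pow (words r \<times> words r) \<times> Pow (words r \<times> {1..2 ^ r})"

lemma finite_patterns: "finite (patterns r)"
  unfolding patterns_def by (intro finite_cartesian_product finite_Pow_iff[THEN iffD2] finite_words finite_atLeastAtMost)

lemma pattern_patterns: "pattern d \<gamma> r y \<in> patterns r"
  by (auto simp: pattern_def patterns_def)

text \<open>Sets of patterns rather than single patterns are compared, so that an isomorphism class
  of balls is covered without knowing how many patterns it contains.\<close>

lemma EL_sofic_alpha:
  fixes B :: "nat \<Rightarrow> 'a set"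
  assumes B: "\<And>l. B l \<in> sets M" and sep: "\<And>x y. x \<in> space M \<Longrightarrow> y \<in> space M \<Longrightarrow> x \<noteq> y \<Longrightarrow> \<exists>l. x \<in> B l \<and> y \<notin> B l"
    and e: "basic_sequence M e"
  shows "EL_sofic_action M e alpha"
proof -
  define d where "d = (\<lambda>k i m. level e k m i)"
  define \<mu> where "\<mu> r A = measure M {x \<in> space M. pattern e alpha r x \<in> A}" for r A
  define f where "f k r A = real (card {y \<in> {..<n k}. pattern (d k) (beta k) r y \<in> A}) / real (n k)" for k r A
  have lim: "((\<lambda>k. f k r A) \<longlongrightarrow> \<mu> r A) \<omega>" if "A \<subseteq> patterns r" for r A
  proof -
    have fA: "finite A" using finite_subset[OF that finite_patterns] .
    have "tracks (\<lambda>x. \<exists>P\<in>A. pattern e alpha r x = P) (\<lambda>k y. \<exists>P\<in>A. pattern (d k) (beta k) r y = P)"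
      unfolding d_def by (intro tracks_bex tracks_pattern[OF B sep e] fA)
    from tracks_density[OF this] show ?thesis unfolding f_def \<mu>_def by simp
  qed
  \<comment> \<open>For each \<open>l\<close> only finitely many frequencies have to be close, and a
    nontrivial filter allows one index for all of them. The chosen indices \<open>k l\<close> may
    fail to increase; only the frequencies matter.\<close>
  have "\<exists>k. \<forall>r\<le>l. \<forall>A\<in>Pow (patterns r). \<bar>f k r A - \<mu> r A\<bar> < 1 / real (Suc l)" for l
  proof -
    have "eventually (\<lambda>k. \<forall>r\<in>{..l}. \<forall>A\<in>Pow (patterns r). dist (f k r A) (\<mu> r A) < 1 / real (Suc l)) \<omega>"
      using lim by (intro eventually_ball_finite ballI finite_Pow_iff[THEN iffD2] finite_patterns tendstoD) auto
    from eventually_happens'[OF _ this] show ?thesis using \<omega> unfolding free_ultrafilter_def dist_real_def by blast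
  qed
  then have "\<exists>k. \<forall>l. \<forall>r\<le>l. \<forall>A\<in>Pow (patterns r). \<bar>f (k l) r A - \<mu> r A\<bar> < 1 / real (Suc l)" by (rule choice[OF allI])
  then obtain k where k0: "\<forall>l. \<forall>r\<le>l. \<forall>A\<in>Pow (patterns r). \<bar>f (k l) r A - \<mu> r A\<bar> < 1 / real (Suc l)" by (elim exE)
  have k: "\<bar>f (k l) r A - \<mu> r A\<bar> < 1 / real (Suc l)" if "r \<le> l" "A \<subseteq> patterns r" for l r A
    using k0 that by blast
  have pointwise_conv: "(\<lambda>l. f (k l) r A) \<longlonglongrightarrow> \<mu> r A" if A: "A \<subseteq> patterns r" for r A
  proof -
    have "(\<lambda>l. f (k l) r A - \<mu> r A) \<longlonglongrightarrow> 0"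
    proof (rule Lim_null_comparison)
      show "eventually (\<lambda>l. norm (f (k l) r A - \<mu> r A) \<le> 1 / real (Suc l)) sequentially"
        using eventually_ge_at_top[of r] by eventually_elim (use k[OF _ A] in \<open>auto intro: less_imp_le\<close>)
      show "(\<lambda>l. 1 / real (Suc l)) \<longlonglongrightarrow> 0" using LIMSEQ_inverse_real_of_nat by (simp add: inverse_eq_divide)
    qed
    then show ?thesis by (simp add: LIM_zero_iff)
  qed
  show ?thesis unfolding EL_sofic_action_def
  proof (intro exI[of _ "\<lambda>l. {..<n (k l)}"] exI[of _ "\<lambda>l. d (k l)"] exI[of _ "\<lambda>l. beta (k l)"] conjI allI impI)
    fix l
    show "X_set {..<n (k l)} (d (k l))" using level_X_set[of "k l" e] by (simp add: d_def)
    show "group_action free_group {..<n (k l)} (beta (k l))"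
      unfolding beta_word_action by (rule letter_maps.word_action[OF letter_p])
  next
    fix r and G :: "nat rooted_graph"
    let ?A = "{P \<in> patterns r. graph_iso (pattern_graph r P) G}"
    have 1: "pattern_measure M e alpha r G = \<mu> r ?A"
    proof -
      have "{x \<in> space M. graph_iso (ball_graph e alpha r x) G} = {x \<in> space M. pattern e alpha r x \<in> ?A}"
        using graph_iso_ball_iff[of alpha _ e r G] pattern_patterns[of e alpha r] by (auto simp: alpha_def)
      then show ?thesis by (simp add: pattern_measure_def \<mu>_def)
    qed
    have 2: "pattern_measure (uniform_count_measure {..<n (k l)}) (d (k l)) (beta (k l)) r G = f (k l) r ?A" for l
    proof -
      have "{y \<in> {..<n (k l)}. graph_iso (ball_graph (d (k l)) (beta (k l)) r y) G} = {y \<in> {..<n (k l)}. pattern (d (k l)) (beta (k l)) r y \<in> ?A}"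
        using graph_iso_ball_iff[of "beta (k l)" _ "d (k l)" r G] pattern_patterns[of "d (k l)" "beta (k l)" r] by (auto simp: beta_def)
      then show ?thesis unfolding pattern_measure_def f_def space_uniform_count_measure
        by (subst measure_uniform_count_measure) auto
    qed
    show "(\<lambda>l. pattern_measure (uniform_count_measure {..<n (k l)}) (d (k l)) (beta (k l)) r G) \<longlonglongrightarrow> pattern_measure M e alpha r G"
      unfolding 1 2 by (rule pointwise_conv) blast
  qed
qed

lemma act_meas: "act w \<in> measurable M M" "distr M M (act w) = M"
proof (induction w)
  case Nil
  case 1 show ?case by simp
  case 2 show ?case by (simp add: distr_id2)
next
  case (Cons g w)
  have e: "act (g # w) = t (fst g) \<circ> act w" by (simp add: fun_eq_iff)
  case 1 show ?case unfolding e using Cons(1) t_meas by (rule measurable_comp)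
  case 2 show ?case unfolding e distr_distr[OF t_meas Cons(1), symmetric] Cons(2) by (rule t_distr)
qed

lemma pmp_alpha: "pmp_action M alpha"
  unfolding pmp_action_def
proof (intro conjI ballI)
  show "group_action free_group (space M) alpha" unfolding alpha_word_action by (rule letter_t.word_action)
  fix w
  have c: "alpha w x = act w x" if "x \<in> space M" for x using that by (simp add: alpha_def)
  show "alpha w \<in> measurable M M" using measurable_cong[of M "alpha w" "act w" M] c act_meas(1) by blast
  show "distr M M (alpha w) = M" using distr_cong[of M M M M "alpha w" "act w"] c act_meas(2) by simp
qed

lemma orbit_alpha:
  assumes gen: "E `` {x} = (\<lambda>n. t (Suc n) x) ` UNIV" and x: "x \<in> space M"
  shows "E `` {x} = {alpha w x | w. w \<in> carrier free_group}"
proof (intro equalityI subsetI)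
  fix y assume "y \<in> E `` {x}"
  then obtain j where "y = t (Suc j) x" using gen by blast
  then have "y = alpha [(Suc j, True)] x" using x by (simp add: alpha_def)
  moreover have "[(Suc j, True)] \<in> carrier free_group" by (simp add: free_group_simps)
  ultimately show "y \<in> {alpha w x | w. w \<in> carrier free_group}" by blast
next
  fix y assume "y \<in> {alpha w x | w. w \<in> carrier free_group}"
  then obtain w where y: "y = act w x" using x by (auto simp: alpha_def)
  have "(x, act w x) \<in> E" for w
  proof (induction w)
    case Nil
    show ?case using E_equiv x by (auto simp: equiv_def refl_on_def)
  next
    case (Cons g w)
    have "(act w x, t (fst g) (act w x)) \<in> E" using t_E[OF act_space[OF x]] .
    then show ?case using Cons E_equiv by (auto simp: equiv_def dest: transD)
  qed
  then show "y \<in> E `` {x}" using y by blast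
qed

lemma EL_sofic:
  fixes B :: "nat \<Rightarrow> 'a set"
  assumes "\<And>l. B l \<in> sets M" "\<And>x y. x \<in> space M \<Longrightarrow> y \<in> space M \<Longrightarrow> x \<noteq> y \<Longrightarrow> \<exists>l. x \<in> B l \<and> y \<notin> B l"
    and "basic_sequence M e" and "\<And>x. x \<in> space M \<Longrightarrow> E `` {x} = (\<lambda>n. t (Suc n) x) ` UNIV"
  shows "EL_sofic_relation M e E"
  unfolding EL_sofic_relation_def
  using pmp_alpha EL_sofic_alpha[OF assms(1-3)] orbit_alpha[OF assms(4)]
  by (intro exI[of _ alpha] conjI AE_I2)

end

section \<open>Soficity in the sense of Elek and Lippner\<close>

text \<open>Two points differ exactly when some \<open>B l\<close> contains the first but not the
  second, so the complement is a countable union of rectangles.\<close>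

lemma standard_borel_diagonal:
  assumes B: "\<And>l::nat. B l \<in> sets M"
    and sep: "\<And>x y. x \<in> space M \<Longrightarrow> y \<in> space M \<Longrightarrow> x \<noteq> y \<Longrightarrow> \<exists>l. x \<in> B l \<and> y \<notin> B l"
  shows "{p \<in> space (M \<Otimes>\<^sub>M M). fst p = snd p} \<in> sets (M \<Otimes>\<^sub>M M)"
proof -
  have "{p \<in> space (M \<Otimes>\<^sub>M M). fst p = snd p} = space (M \<Otimes>\<^sub>M M) - (\<Union>l. B l \<times> (space M - B l))"
    using sep sets.sets_into_space[OF B] by (auto simp: space_pair_measure) blast
  also have "\<dots> \<in> sets (M \<Otimes>\<^sub>M M)" using B by (intro sets.Diff sets.top sets.countable_UN) auto
  finally show ?thesis .
qed

text \<open>An involution maps the preimage of \<open>A\<close> bijectively onto \<open>A\<close>,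
  and within \<open>E\<close>, so that invariance of \<open>E\<close> compares their
  measures.\<close>

lemma pmp_involution_distr:
  assumes M: "prob_space M" and pmp: "pmp_equivalence_relation M E" and t: "t \<in> measurable M M"
    and inE: "\<And>x. x \<in> space M \<Longrightarrow> (x, t x) \<in> E" and inv: "\<And>x. x \<in> space M \<Longrightarrow> t (t x) = x"
  shows "distr M M t = M"
proof (rule measure_eqI)
  interpret prob_space M by (rule M)
  fix A assume "A \<in> sets (distr M M t)"
  then have A: "A \<in> sets M" by simp
  let ?A = "t -` A \<inter> space M"
  have A': "?A \<in> sets M" using t A by (rule measurable_sets)
  have AM: "A \<subseteq> space M" using sets.sets_into_space[OF A] .
  have sp: "t x \<in> space M" if "x \<in> space M" for x using measurable_space[OF t that] .
  have "bij_betw t ?A A"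
    by (rule bij_betw_byWitness[where f' = t]) (use AM inv sp in auto)
  moreover have "t \<in> measurable (restrict_space M ?A) (restrict_space M A)"
    using t sp by (intro measurable_restrict_space3) auto
  moreover have "\<forall>x\<in>?A. (x, t x) \<in> E" using inE by blast
  ultimately have "measure M ?A = measure M A"
    using pmp A A' unfolding pmp_equivalence_relation_def by (elim conjE allE[of _ ?A] allE[of _ A] allE[of _ t]) blast
  then show "emeasure (distr M M t) A = emeasure M A"
    using A A' t by (simp add: emeasure_distr emeasure_eq_measure)
qed simp

theorem proposition4p6:
  fixes \<omega> :: "nat filter" and M :: "'a measure" and E :: "('a \<times> 'a) set"
    and e :: "nat \<Rightarrow> nat \<Rightarrow> 'a set"
  assumes "free_ultrafilter \<omega>"
    and "prob_space M" and "standard_borel M"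
    and "basic_sequence M e"
    and "pmp_equivalence_relation M E"
    and "sofic_relation \<omega> M E"
  shows "EL_sofic_relation M e E"
proof -
  have ne: "space M \<noteq> {}" using prob_space.not_empty[OF assms(2)] .
  have E: "equiv (space M) E" "E \<in> sets (M \<Otimes>\<^sub>M M)" "\<And>x. x \<in> space M \<Longrightarrow> countable (E `` {x})"
    using assms(5) unfolding pmp_equivalence_relation_def by blast+
  have "\<exists>B::nat \<Rightarrow> 'a set. (\<forall>l. B l \<in> sets M) \<and> (\<forall>x\<in>space M. \<forall>y\<in>space M. x \<noteq> y \<longrightarrow> (\<exists>l. x \<in> B l \<and> y \<notin> B l))"
    using standard_borel_separating[OF assms(3) ne] .
  then obtain B :: "nat \<Rightarrow> 'a set" where B: "\<And>l. B l \<in> sets M"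
    "\<And>x y. x \<in> space M \<Longrightarrow> y \<in> space M \<Longrightarrow> x \<noteq> y \<Longrightarrow> \<exists>l. x \<in> B l \<and> y \<notin> B l" by (elim exE conjE) blast
  have "\<exists>t::nat \<Rightarrow> 'a \<Rightarrow> 'a. (\<forall>n. t n \<in> measurable M M) \<and>
      (\<forall>n. \<forall>x\<in>space M. (x, t n x) \<in> E \<and> t n (t n x) = x) \<and>
      (\<forall>x\<in>space M. E `` {x} = range (\<lambda>n. t n x))"
    using feldman_moore[OF assms(3) ne E(2) E(3) E(1)] .
  then obtain t0 :: "nat \<Rightarrow> 'a \<Rightarrow> 'a" where t0: "\<forall>n. t0 n \<in> measurable M M"
    "\<forall>n. \<forall>x\<in>space M. (x, t0 n x) \<in> E \<and> t0 n (t0 n x) = x"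
    "\<forall>x\<in>space M. E `` {x} = range (\<lambda>n. t0 n x)" by (elim exE conjE) (rule that)
  \<comment> \<open>Generators of the free group are numbered from 1.\<close>
  define t where "t = (\<lambda>n. t0 (n - 1))"
  \<comment> \<open>Index 0 belongs to no generator; it repeats the involution of index 1, so the
    enumeration of the classes is unchanged.\<close>
  have shift: "(\<lambda>n. t (Suc n) x) ` UNIV = range (\<lambda>n. t0 n x)" "range (\<lambda>n. t n x) = range (\<lambda>n. t0 n x)" for x
  proof -
    show "(\<lambda>n. t (Suc n) x) ` UNIV = range (\<lambda>n. t0 n x)" by (simp add: t_def)
    have "t0 n x \<in> range (\<lambda>n. t n x)" for n by (rule range_eqI[of _ _ "Suc n"]) (simp add: t_def)
    then show "range (\<lambda>n. t n x) = range (\<lambda>n. t0 n x)" by (auto simp: t_def)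
  qed
  interpret involution_relation M E t
  proof (rule involution_relation.intro[OF assms(2)], unfold_locales)
    fix n x
    show "t n \<in> measurable M M" using t0(1) by (simp add: t_def)
    show "x \<in> space M \<Longrightarrow> (x, t n x) \<in> E" "x \<in> space M \<Longrightarrow> t n (t n x) = x" using t0(2) by (simp_all add: t_def)
    show "x \<in> space M \<Longrightarrow> E `` {x} = range (\<lambda>n. t n x)" using t0(3) shift by simp
    show "distr M M (t n) = M" unfolding t_def
      by (rule pmp_involution_distr[OF assms(2,5)]) (use t0(1,2) in auto)
    show "{p \<in> space (M \<Otimes>\<^sub>M M). fst p = snd p} \<in> sets (M \<Otimes>\<^sub>M M)"
      using B by (rule standard_borel_diagonal)
  qed (rule E)+
  obtain n D p where m: "model \<omega> n D p" using sofic_model[OF assms(1,6)] by (elim exE)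
  have "\<And>k. n k > 0" using m[unfolded model_def] by (elim conjE) (rule spec)
  interpret sofic_modelled M E t \<omega> n D p
    by unfold_locales fact+
  show ?thesis
  proof (rule EL_sofic[OF B assms(4)])
    fix x assume "x \<in> space M"
    then show "E `` {x} = (\<lambda>n. t (Suc n) x) ` UNIV" unfolding shift(1) using t0(3) by (rule bspec[rotated])
  qed
qed

end
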